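(* Let $\mathcal{P}$ be the set of planar tanglegrams and $\mathcal{I}$ the set of irreducible planar tanglegrams (all up to isomorphism). Define the formal power series \[T(x)=\sum_{\mathcal{T}\in\mathcal{P}}x^{|\mathcal{T}|},\qquad H(x)=\frac12x^2+\sum_{\mathcal{T}\in\mathcal{I},\ |\mathcal{T}|>2}x^{|\mathcal{T}|},\] \[T(x,y)=\sum_{\mathcal{T}\in\mathcal{P}}x^{|\mathcal{T}|}y^{|\mathrm{irr}(\mathcal{T})|},\qquad H(x,y)=H(xy)=\frac12x^2y^2+\sum_{\mathcal{T}\in\mathcal{I},\ |\mathcal{T}|>2}x^{|\mathcal{T}|}y^{|\mathcal{T}|}.\] Then \[T(x,y)=H(T(x),y)+\frac{T(x^2)\,y^2}{2}+xy,\] where $H(T(x),y)=H(y\,T(x))$.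
   Context: A rooted binary tree is a finite tree with a distinguished root in which every vertex has zero or two children; children are unordered. A tanglegram $\mathcal{T}=(L,R,\sigma)$ consists of an ordered pair of rooted binary trees $(L,R)$ with the same number of leaves together with a perfect matching $\sigma$ between the leaves of $L$ and the leaves of $R$; its size $|\mathcal{T}|$ is the common number of leaves. Tanglegrams are considered up to isomorphism, i.e. isomorphisms of the underlying graphs (trees plus matching edges) mapping $L$ to $L'$ and $R$ to $R'$. A layout of $\mathcal{T}$ is a drawing with $L$ embedded in the plane to the left of the line $x=0$ with its leaves on $x=0$, $R$ embedded to the right of $x=1$ with its leaves on $x=1$, and the matching edges drawn as straight segments; $\mathcal{T}$ is planar if it has a layout in which no two matching segments cross. If $u\in L$ and $v\in R$ are internal (non-leaf) vertices, neither of which is a root, such that $\sigma$ matches the leaf descendants of $u$ exactly with the leaf descendants of $v$, then the subtrees rooted at $u$ and $v$ with the induced matching form a proper subtanglegram of $\mathcal{T}$. $\mathcal{T}$ is irreducible if it has no proper subtanglegram. $\mathrm{irr}(\mathcal{T})$ is the irreducible tanglegram obtained from $\mathcal{T}$ by contracting each maximal proper subtanglegram to a single pair of matched leaves (for the tanglegram of size $1$, $\mathrm{irr}$ is itself, of size $1$).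
   Formalization: In a layout, the root of L is additionally required to be the leftmost point of its drawing and the root of R the rightmost point of its drawing; without this usual convention, enclosed roots are allowed and the identity fails at size 5. *)

theory Defs
  imports
    "HOL-Analysis.Analysis"
    "HOL-Library.Uprod"
    "HOL-Computational_Algebra.Formal_Power_Series"
begin

section \<open>Rooted binary trees\<close>

text \<open>
  Children are unordered: an inner node carries an unordered pair of subtrees. The leaves carry
  pairwise distinct names (\<open>binary_tree\<close>), so that distinct vertices span distinct subtrees and a
  vertex can be identified with the subtree rooted at it; the root of \<open>t\<close> is \<open>t\<close> itself.
\<close>

datatype (leaves: 'a) btree = Leaf 'a | Node "'a btree uprod"

inductive binary_tree :: "'a btree \<Rightarrow> bool" where
  "binary_tree (Leaf a)"
| "binary_tree l \<Longrightarrow> binary_tree r \<Longrightarrow> leaves l \<inter> leaves r = {}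
    \<Longrightarrow> binary_tree (Node (Upair l r))"

primrec children :: "'a btree \<Rightarrow> 'a btree set" where
  "children (Leaf a) = {}"
| "children (Node p) = set_uprod p"

inductive_set vertices :: "'a btree \<Rightarrow> 'a btree set" for t where
  "t \<in> vertices t"
| "u \<in> vertices t \<Longrightarrow> v \<in> children u \<Longrightarrow> v \<in> vertices t"

text \<open>The pairs (parent, child).\<close>

definition edges :: "'a btree \<Rightarrow> ('a btree \<times> 'a btree) set" where
  "edges t = {(u, v). u \<in> vertices t \<and> v \<in> children u}"

definition adjacent :: "'a btree \<Rightarrow> 'a btree \<Rightarrow> 'a btree \<Rightarrow> bool" where
  "adjacent t u v \<longleftrightarrow> (u, v) \<in> edges t \<or> (v, u) \<in> edges t"

text \<open>
  For binary trees such a map sends the root to the root, the root being the only vertex of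
  degree two (or the only vertex).
\<close>

definition graph_iso :: "('a btree \<Rightarrow> 'b btree) \<Rightarrow> 'a btree \<Rightarrow> 'b btree \<Rightarrow> bool" where
  "graph_iso f t t' \<longleftrightarrow> bij_betw f (vertices t) (vertices t') \<and>
     (\<forall>u\<in>vertices t. \<forall>v\<in>vertices t. adjacent t u v \<longleftrightarrow> adjacent t' (f u) (f v))"

section \<open>Tanglegrams\<close>

text \<open>The matching is given as a set of pairs of leaf names.\<close>

type_synonym 'a tanglegram = "'a btree \<times> 'a btree \<times> ('a \<times> 'a) set"

fun tanglegram :: "'a tanglegram \<Rightarrow> bool" where
  "tanglegram (L, R, M) \<longleftrightarrow> binary_tree L \<and> binary_tree R \<and> M \<subseteq> leaves L \<times> leaves R \<and>
     (\<forall>a\<in>leaves L. \<exists>!b. (a, b) \<in> M) \<and> (\<forall>b\<in>leaves R. \<exists>!a. (a, b) \<in> M)"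

fun tsize :: "'a tanglegram \<Rightarrow> nat" where
  "tsize (L, R, M) = card (leaves L)"

definition matching_edges :: "('a \<times> 'a) set \<Rightarrow> ('a btree \<times> 'a btree) set" where
  "matching_edges M = map_prod Leaf Leaf ` M"

fun isomorphic :: "'a tanglegram \<Rightarrow> 'b tanglegram \<Rightarrow> bool" where
  "isomorphic (L, R, M) (L', R', M') \<longleftrightarrow>
     (\<exists>f g. graph_iso f L L' \<and> graph_iso g R R' \<and>
        map_prod f g ` matching_edges M = matching_edges M')"

text \<open>Natural numbers provide enough leaf names to represent every isomorphism class.\<close>

definition tanglegram_iso :: "(nat tanglegram \<times> nat tanglegram) set" where
  "tanglegram_iso = {(S, T). tanglegram S \<and> tanglegram T \<and> isomorphic S T}"

section \<open>Layouts and planarity\<close>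

text \<open>
  Embedding of a tree in the plane: the vertices are placed at distinct points by \<open>p\<close>, the edge
  \<open>e\<close> is drawn as the arc \<open>c e\<close>, and edges meet vertices and each other only at common endpoints.
\<close>

definition plane_embedding ::
    "'a btree \<Rightarrow> ('a btree \<Rightarrow> complex) \<Rightarrow> ('a btree \<times> 'a btree \<Rightarrow> real \<Rightarrow> complex) \<Rightarrow> bool" where
  "plane_embedding t p c \<longleftrightarrow>
     inj_on p (vertices t) \<and>
     (\<forall>(u, v)\<in>edges t. arc (c (u, v)) \<and> pathstart (c (u, v)) = p u \<and> pathfinish (c (u, v)) = p v) \<and>
     (\<forall>(u, v)\<in>edges t. \<forall>w\<in>vertices t. p w \<in> path_image (c (u, v)) \<longrightarrow> w \<in> {u, v}) \<and>
     (\<forall>(u, v)\<in>edges t. \<forall>(u', v')\<in>edges t. (u, v) \<noteq> (u', v') \<longrightarrow>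
        path_image (c (u, v)) \<inter> path_image (c (u', v')) \<subseteq> p ` ({u, v} \<inter> {u', v'}))"

definition drawing ::
    "'a btree \<Rightarrow> ('a btree \<Rightarrow> complex) \<Rightarrow> ('a btree \<times> 'a btree \<Rightarrow> real \<Rightarrow> complex) \<Rightarrow> complex set" where
  "drawing t p c = p ` vertices t \<union> (\<Union>e\<in>edges t. path_image (c e))"

text \<open>
  Rooted trees are drawn with the root on the far side: the root of the left tree is the leftmost
  point of its drawing, that of the right tree the rightmost point. Without this convention the
  root could be enclosed by other edges, and the leaves below a vertex could be
  interrupted by other leaves; the order of the leaves would then be constrained by the
  unrooted tree only.
\<close>

fun layout :: "'a tanglegram \<Rightarrow>
    ('a btree \<Rightarrow> complex) \<Rightarrow> ('a btree \<times> 'a btree \<Rightarrow> real \<Rightarrow> complex) \<Rightarrow>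
    ('a btree \<Rightarrow> complex) \<Rightarrow> ('a btree \<times> 'a btree \<Rightarrow> real \<Rightarrow> complex) \<Rightarrow> bool" where
  "layout (L, R, M) p c q d \<longleftrightarrow>
     plane_embedding L p c \<and> plane_embedding R q d \<and>
     (\<forall>z\<in>drawing L p c. Re z \<le> 0 \<and> (Re z = 0 \<longleftrightarrow> z \<in> p ` Leaf ` leaves L) \<and>
        (z \<noteq> p L \<longrightarrow> Re (p L) < Re z)) \<and>
     (\<forall>z\<in>drawing R q d. Re z \<ge> 1 \<and> (Re z = 1 \<longleftrightarrow> z \<in> q ` Leaf ` leaves R) \<and>
        (z \<noteq> q R \<longrightarrow> Re z < Re (q R)))"

fun crossing_free ::
    "'a tanglegram \<Rightarrow> ('a btree \<Rightarrow> complex) \<Rightarrow> ('a btree \<Rightarrow> complex) \<Rightarrow> bool" where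
  "crossing_free (L, R, M) p q \<longleftrightarrow>
     (\<forall>(a, b)\<in>M. \<forall>(a', b')\<in>M. (a, b) \<noteq> (a', b') \<longrightarrow>
        closed_segment (p (Leaf a)) (q (Leaf b)) \<inter>
        closed_segment (p (Leaf a')) (q (Leaf b')) = {})"

definition planar :: "'a tanglegram \<Rightarrow> bool" where
  "planar T \<longleftrightarrow> (\<exists>p c q d. layout T p c q d \<and> crossing_free T p q)"

section \<open>Irreducible tanglegrams\<close>

text \<open>A subtanglegram is given by the pair of roots of its two trees.\<close>

fun proper_subs :: "'a tanglegram \<Rightarrow> ('a btree \<times> 'a btree) set" where
  "proper_subs (L, R, M) =
     {(u, v). u \<in> vertices L \<and> v \<in> vertices R \<and> u \<noteq> L \<and> v \<noteq> R \<and>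
        children u \<noteq> {} \<and> children v \<noteq> {} \<and> M `` leaves u = leaves v}"

definition irreducible_tanglegram :: "'a tanglegram \<Rightarrow> bool" where
  "irreducible_tanglegram T \<longleftrightarrow> proper_subs T = {}"

definition maximal_subs :: "'a tanglegram \<Rightarrow> ('a btree \<times> 'a btree) set" where
  "maximal_subs T = {(u, v). (u, v) \<in> proper_subs T \<and>
     (\<forall>(u', v')\<in>proper_subs T. u \<in> vertices u' \<and> v \<in> vertices v' \<longrightarrow> (u', v') = (u, v))}"

text \<open>
  Contraction of the subtrees rooted at the vertices in \<open>U\<close>. Every leaf of the result is named by
  the set of leaves that have been merged into it (a singleton for an untouched leaf).
\<close>

primrec contract :: "'a btree set \<Rightarrow> 'a btree \<Rightarrow> 'a set btree" where
  "contract U (Leaf a) = Leaf {a}"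
| "contract U (Node p) =
     (if Node p \<in> U then Leaf (leaves (Node p)) else Node (map_uprod (contract U) p))"

fun irr :: "'a tanglegram \<Rightarrow> 'a set tanglegram" where
  "irr (L, R, M) =
     (let L' = contract (fst ` maximal_subs (L, R, M)) L;
          R' = contract (snd ` maximal_subs (L, R, M)) R
      in (L', R', {(A, B). A \<in> leaves L' \<and> B \<in> leaves R' \<and> M `` A = B}))"

section \<open>Generating functions\<close>

definition planar_tanglegrams :: "nat tanglegram set" where
  "planar_tanglegrams = {T. tanglegram T \<and> planar T}"

definition irreducible_planar_tanglegrams :: "nat tanglegram set" where
  "irreducible_planar_tanglegrams = {T \<in> planar_tanglegrams. irreducible_tanglegram T}"

text \<open>Number of isomorphism classes in an isomorphism-closed set of tanglegrams.\<close>

definition iso_count :: "nat tanglegram set \<Rightarrow> nat" where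
  "iso_count A = card (A // tanglegram_iso)"

definition T_series :: "rat fps" where
  "T_series = Abs_fps (\<lambda>n. of_nat (iso_count {T \<in> planar_tanglegrams. tsize T = n}))"

definition H_series :: "rat fps" where
  "H_series = fps_const (1 / 2) * fps_X ^ 2 +
     Abs_fps (\<lambda>n. if n > 2
       then of_nat (iso_count {T \<in> irreducible_planar_tanglegrams. tsize T = n}) else 0)"

text \<open>
  A bivariate series is a power series in \<open>x\<close> whose coefficients are power series in \<open>y\<close>;
  \<open>in_x\<close> regards a series in \<open>x\<close> alone as a bivariate one.
\<close>

definition var_x :: "rat fps fps" where
  "var_x = fps_X"

definition var_y :: "rat fps fps" where
  "var_y = fps_const fps_X"

definition half :: "rat fps fps" where
  "half = fps_const (fps_const (1 / 2))"

definition in_x :: "rat fps \<Rightarrow> rat fps fps" where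
  "in_x f = Abs_fps (\<lambda>n. fps_const (fps_nth f n))"

definition T_series2 :: "rat fps fps" where
  "T_series2 = Abs_fps (\<lambda>n. Abs_fps (\<lambda>k.
     of_nat (iso_count {T \<in> planar_tanglegrams. tsize T = n \<and> tsize (irr T) = k})))"

definition H_series2 :: "rat fps fps" where
  "H_series2 = half * var_x ^ 2 * var_y ^ 2 +
     Abs_fps (\<lambda>n. Abs_fps (\<lambda>k. if n > 2 \<and> k = n
       then of_nat (iso_count {T \<in> irreducible_planar_tanglegrams. tsize T = n}) else 0))"

end

theory Submission
  imports Defs
begin

text \<open>
  Relabelling the leaves of the right tree along the matching turns a tanglegram into a pair of
  binary trees on the same leaf set. It is planar iff the leaves can be ordered such that the leaf
  set of every vertex of both trees is an interval: in a drawing, a path below a vertex u joining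
  two leaves of u would have to cross the path to the root from any other leaf lying between them.

  The leaf sets occurring in both trees are those of the subtanglegrams. The maximal proper ones
  partition the leaves, so that a pair of size at least 2 is, uniquely up to isomorphism, obtained
  by grafting planar pairs into the k leaves of an irreducible planar pair. If k > 2, the latter has
  no nontrivial automorphism: otherwise some vertex v in one of the trees has its two children
  swapped, with leaf sets A and B; take v as large as possible. The smallest vertex of the other
  tree above all leaves of v is larger than v by irreducibility, hence its children, with leaf sets
  C and D, are fixed, and each of A, B meets each of C, D, which is impossible for intervals; the
  root is similar. So the tanglegrams over a fixed irreducible one of size k > 2 are counted by
  the k-th power of T(x). For k = 2 the swap remains, and the unordered pairs are counted by
  (T(x)^2 + T(x^2)) / 2.
\<close>

section \<open>Binary trees\<close>

text \<open>Everything is reduced to leaf sets. With distinct leaf names a vertex is determined by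
  the leaves below it, so a subtanglegram becomes a set that is a cluster of both trees, and
  irreducibility, contraction and grafting turn into statements on set families. Planarity is
  compatible with grafting because interval orders compose lexicographically: the parts are ordered
  by the skeleton, the leaves inside a part by its own order. A contracted leaf carries a set as its
  name, and several copies of one class have to be kept apart; hence classes are taken across leaf
  types and counted through representatives on \<open>{..<n}\<close>. The leaves of a skeleton then
  index a list of classes, and lists are what the powers of T(x) count. The terms of the formula are
  the cases of k: xy is the single tanglegram with k = 1, the coefficient 1/2 of H at x^2 is one
  skeleton divided by its two automorphisms, and T(x^2) y^2 / 2 corrects for the lists (c, c) that
  the swap leaves fixed.\<close>

abbreviation node :: "'a btree \<Rightarrow> 'a btree \<Rightarrow> 'a btree" where
  "node l r \<equiv> Node (Upair l r)"

text \<open>Every unordered pair is \<open>Upair l r\<close> for some \<open>l\<close> and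
  \<open>r\<close>, so the induction through \<open>uprod\<close> becomes one over two
  subtrees.\<close>

lemma btree_induct [case_names Leaf node, induct type: btree]:
  assumes "\<And>a. P (Leaf a)" "\<And>l r. P l \<Longrightarrow> P r \<Longrightarrow> P (node l r)"
  shows "P t"
proof (induction t rule: btree.induct)
  case (Node p)
  then show ?case by (cases p) (auto intro: assms(2))
qed (rule assms(1))

lemma btree_exhaust [case_names Leaf node, cases type: btree]:
  obtains a where "t = Leaf a" | l r where "t = node l r"
  by (induction t rule: btree_induct) auto

lemma binary_tree_Leaf [simp]: "binary_tree (Leaf a)"
  by (rule binary_tree.intros)

lemma binary_tree_node [simp]:
  "binary_tree (node l r) \<longleftrightarrow> binary_tree l \<and> binary_tree r \<and> leaves l \<inter> leaves r = {}"
  by (subst binary_tree.simps) auto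

lemma vertices_Leaf [simp]: "vertices (Leaf a) = {Leaf a}"
proof -
  have "u = Leaf a" if "u \<in> vertices (Leaf a)" for u
    using that by induction auto
  then show ?thesis by (auto intro: vertices.intros)
qed

lemma vertices_trans: "v \<in> vertices u \<Longrightarrow> u \<in> vertices t \<Longrightarrow> v \<in> vertices t"
  by (induction rule: vertices.induct) (auto intro: vertices.intros)

lemma vertices_node [simp]: "vertices (node l r) = insert (node l r) (vertices l \<union> vertices r)"
proof -
  have "u \<in> insert (node l r) (vertices l \<union> vertices r)" if "u \<in> vertices (node l r)" for u
    using that by induction (auto intro: vertices.intros)
  moreover have "l \<in> vertices (node l r)" "r \<in> vertices (node l r)"
    by (auto intro: vertices.intros)
  ultimately show ?thesis
    by (auto intro: vertices.intros vertices_trans)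
qed

lemma self_in_vertices [simp]: "t \<in> vertices t"
  by (rule vertices.intros)

lemma finite_leaves [simp]: "finite (leaves t)"
  by (induction t rule: btree_induct) auto

lemma leaves_nonempty [simp]: "leaves t \<noteq> {}"
  by (induction t rule: btree_induct) auto

lemma finite_vertices [simp]: "finite (vertices t)"
  by (induction t rule: btree_induct) auto

lemma leaves_vertex: "u \<in> vertices t \<Longrightarrow> leaves u \<subseteq> leaves t"
  by (induction t rule: btree_induct) auto

lemma binary_vertex: "binary_tree t \<Longrightarrow> u \<in> vertices t \<Longrightarrow> binary_tree u"
  by (induction t rule: btree_induct) auto

lemma Leaf_in_vertices [simp]: "Leaf a \<in> vertices t \<longleftrightarrow> a \<in> leaves t"
  by (induction t rule: btree_induct) auto

lemma child_vertex: "v \<in> children u \<Longrightarrow> u \<in> vertices t \<Longrightarrow> v \<in> vertices t"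
  by (rule vertices.intros(2))

lemma children_empty_iff: "children t = {} \<longleftrightarrow> (\<exists>a. t = Leaf a)"
  by (cases t) auto

lemma vertices_children: "vertices t = insert t (\<Union>v\<in>children t. vertices v)"
  by (cases t) auto

lemma parent_exists: "u \<in> vertices t \<Longrightarrow> u \<noteq> t \<Longrightarrow> \<exists>v\<in>vertices t. u \<in> children v"
  by (erule vertices.cases) auto

lemma leaves_proper_vertex:
  assumes "binary_tree t" "u \<in> vertices t" "u \<noteq> t"
  shows "leaves u \<subset> leaves t"
proof (cases t)
  case (node l r)
  have t: "leaves t = leaves l \<union> leaves r" "leaves l \<inter> leaves r = {}"
    using assms(1) node by simp_all
  have "leaves l \<subset> leaves t" "leaves r \<subset> leaves t"
    unfolding t(1) using t(2) leaves_nonempty[of l] leaves_nonempty[of r] by blast+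
  moreover have "u \<in> vertices l \<or> u \<in> vertices r"
    using assms(2,3) node by simp
  ultimately show ?thesis
    using leaves_vertex[of u l] leaves_vertex[of u r] by (meson subset_psubset_trans)
qed (use assms in auto)

lemma vertices_disjoint: "leaves l \<inter> leaves r = {} \<Longrightarrow> v \<in> vertices l \<Longrightarrow> v \<notin> vertices r"
  using leaves_vertex[of v l] leaves_vertex[of v r] leaves_nonempty[of v] by blast

lemma vertices_antisym: "binary_tree t \<Longrightarrow> u \<in> vertices t \<Longrightarrow> t \<in> vertices u \<Longrightarrow> u = t"
  using leaves_proper_vertex[of t u] leaves_vertex[of t u] by auto

text \<open>Two vertices either lie on a common path to the root or are split apart at a node whose
  two subtrees share no leaf name.\<close>

lemma vertices_laminar:
  assumes "binary_tree t" "u \<in> vertices t" "v \<in> vertices t"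
  shows "u \<in> vertices v \<or> v \<in> vertices u \<or> leaves u \<inter> leaves v = {}"
  using assms
proof (induction t rule: btree_induct)
  case (node l r)
  have "leaves x \<inter> leaves y = {}" if "x \<in> vertices l" "y \<in> vertices r" for x y
    using that node.prems leaves_vertex[of x l] leaves_vertex[of y r] by auto
  then show ?case using node by (auto simp: Int_commute)
qed auto

lemma vertices_leaves_le:
  assumes "binary_tree t" "u \<in> vertices t" "v \<in> vertices t" "leaves u \<subseteq> leaves v"
  shows "u \<in> vertices v"
proof -
  have "u \<in> vertices v" if "v \<in> vertices u"
    using leaves_proper_vertex[OF binary_vertex[OF assms(1,2)] that] assms(4) by (cases "v = u") auto
  moreover have "leaves u \<inter> leaves v \<noteq> {}"
    using assms(4) leaves_nonempty[of u] by blast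
  ultimately show ?thesis using vertices_laminar[OF assms(1-3)] by auto
qed

text \<open>Allows vertices to be replaced by their leaf sets; this is why subtanglegrams can later
  be handled as common clusters.\<close>

lemma vertex_eqI:
  assumes "binary_tree t" "u \<in> vertices t" "v \<in> vertices t" "leaves u = leaves v"
  shows "u = v"
  using vertices_leaves_le[OF assms(1-3)] vertices_leaves_le[OF assms(1,3,2)] assms
    vertices_antisym[OF binary_vertex[OF assms(1,3)]] by auto

lemma leaves_singleton: "binary_tree t \<Longrightarrow> leaves t = {a} \<Longrightarrow> t = Leaf a"
  by (metis Leaf_in_vertices insertI1 leaves_proper_vertex btree.set(1) less_irrefl)

lemma card_leaves_node:
  "binary_tree (node l r) \<Longrightarrow> card (leaves (node l r)) = card (leaves l) + card (leaves r)"
  by (simp add: card_Un_disjoint)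

lemma card_leaves_pos [simp]: "0 < card (leaves t)"
  by (simp add: card_gt_0_iff)

lemma card_leaves_ge_1 [simp]: "Suc 0 \<le> card (leaves t)"
  by (simp add: Suc_le_eq)

lemma card_leaves_ge2: "binary_tree t \<Longrightarrow> 2 \<le> card (leaves t) \<longleftrightarrow> children t \<noteq> {}"
proof (cases t)
  case (node l r)
  moreover assume "binary_tree t"
  ultimately show ?thesis
    using card_leaves_node[of l r] add_mono[OF card_leaves_ge_1[of l] card_leaves_ge_1[of r]]
    by (simp del: card_leaves_ge_1)
qed simp

lemma binary_tree_not_own_child:
  assumes "binary_tree (node l r)" shows "l \<noteq> node l r" "r \<noteq> node l r"
proof -
  have "leaves l \<noteq> leaves l \<union> leaves r" "leaves r \<noteq> leaves l \<union> leaves r"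
    using assms leaves_nonempty[of l] leaves_nonempty[of r] by (simp_all, blast+)
  then show "l \<noteq> node l r" "r \<noteq> node l r"
    by (metis UN_insert UN_empty btree.set(2) set_uprod_simps sup_bot.right_neutral)+
qed

text \<open>Keeps the numbers of classes finite, as \<open>card\<close> is 0 on infinite sets.
  Induction over proper subsets works because both subtrees of a node have strictly fewer
  leaves.\<close>

lemma finite_binary_trees:
  assumes "finite X"
  shows "finite {t. binary_tree t \<and> leaves t = X}"
  using assms
proof (induction X rule: finite_psubset_induct)
  case (psubset X)
  let ?F = "\<Union>Y\<in>{Y. Y \<subset> X}. {t. binary_tree t \<and> leaves t = Y}"
  have "finite {Y. Y \<subset> X}"
    by (rule finite_subset[of _ "Pow X"]) (use psubset.hyps in auto)
  then have "finite ?F" using psubset.IH by auto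
  have "{t. binary_tree t \<and> leaves t = X} \<subseteq> Leaf ` X \<union> (\<lambda>(l, r). node l r) ` (?F \<times> ?F)"
  proof
    fix t assume t: "t \<in> {t. binary_tree t \<and> leaves t = X}"
    show "t \<in> Leaf ` X \<union> (\<lambda>(l, r). node l r) ` (?F \<times> ?F)"
    proof (cases t)
      case (node l r)
      then have "leaves l \<subset> X" "leaves r \<subset> X"
        using t leaves_proper_vertex[of t l] leaves_proper_vertex[of t r]
        by (auto simp: binary_tree_not_own_child)
      then have "(l, r) \<in> ?F \<times> ?F" using t node by auto
      then show ?thesis using node by force
    qed (use t in auto)
  qed
  then show ?case
    by (rule finite_subset) (use \<open>finite ?F\<close> psubset.hyps in auto)
qed

lemma vertices_map_btree: "vertices (map_btree h t) = map_btree h ` vertices t"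
  by (induction t rule: btree_induct) auto

lemma leaves_map_btree: "leaves (map_btree h t) = h ` leaves t"
  by (rule btree.set_map)

lemma children_map_btree: "children (map_btree h t) = map_btree h ` children t"
  by (cases t) auto

lemma map_btree_cong: "(\<And>a. a \<in> leaves t \<Longrightarrow> h a = g a) \<Longrightarrow> map_btree h t = map_btree g t"
  by (rule btree.map_cong0)

lemma map_btree_id_on: "(\<And>a. a \<in> leaves t \<Longrightarrow> h a = a) \<Longrightarrow> map_btree h t = t"
  using map_btree_cong[of t h id] by (simp add: btree.map_id)

lemma map_btree_comp: "map_btree h (map_btree g t) = map_btree (\<lambda>a. h (g a)) t"
  by (simp add: btree.map_comp comp_def)

lemma binary_map_btree: "binary_tree t \<Longrightarrow> inj_on h (leaves t) \<Longrightarrow> binary_tree (map_btree h t)"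
proof (induction t rule: btree_induct)
  case (node l r)
  then have "inj_on h (leaves l)" "inj_on h (leaves r)"
    by (auto intro: inj_on_subset)
  moreover have "h ` leaves l \<inter> h ` leaves r = {}"
    using node.prems inj_on_image_Int[of h "leaves (node l r)" "leaves l" "leaves r"] by auto
  ultimately show ?case using node by (simp add: leaves_map_btree)
qed simp

section \<open>Substitution and contraction\<close>

text \<open>The bind of the tree monad; it models grafting, and \<open>bindt_contract\<close> and
  \<open>contract_bindt\<close> show in which sense it is inverse to
  \<open>contract\<close>.\<close>

primrec bindt :: "('a \<Rightarrow> 'b btree) \<Rightarrow> 'a btree \<Rightarrow> 'b btree" where
  "bindt s (Leaf a) = s a"
| "bindt s (Node p) = Node (map_uprod (bindt s) p)"

lemma leaves_bindt: "leaves (bindt s t) = (\<Union>a\<in>leaves t. leaves (s a))"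
  by (induction t rule: btree_induct) auto

lemma vertices_bindt:
  "vertices (bindt s t) = bindt s ` vertices t \<union> (\<Union>a\<in>leaves t. vertices (s a))"
  by (induction t rule: btree_induct) auto

lemma map_bindt: "map_btree h (bindt s t) = bindt (\<lambda>a. map_btree h (s a)) t"
  by (induction t rule: btree_induct) auto

lemma bindt_map: "bindt s (map_btree h t) = bindt (\<lambda>a. s (h a)) t"
  by (induction t rule: btree_induct) auto

lemma bindt_cong: "(\<And>a. a \<in> leaves t \<Longrightarrow> s a = s' a) \<Longrightarrow> bindt s t = bindt s' t"
  by (induction t rule: btree_induct) auto

definition disjoint_trees :: "'i set \<Rightarrow> ('i \<Rightarrow> 'a btree) \<Rightarrow> bool" where
  "disjoint_trees J s \<longleftrightarrow> (\<forall>j\<in>J. binary_tree (s j)) \<and> disjoint_family_on (\<lambda>j. leaves (s j)) J"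

lemma disjoint_trees_subset: "disjoint_trees J s \<Longrightarrow> K \<subseteq> J \<Longrightarrow> disjoint_trees K s"
  unfolding disjoint_trees_def by (meson disjoint_family_on_mono subsetD)

lemma disjoint_treesD:
  "disjoint_trees J s \<Longrightarrow> i \<in> J \<Longrightarrow> j \<in> J \<Longrightarrow> a \<in> leaves (s i) \<Longrightarrow> a \<in> leaves (s j) \<Longrightarrow> i = j"
  by (auto simp: disjoint_trees_def disjoint_family_on_def)

text \<open>A tree has at least one leaf, and that leaf occurs in only one tree of the family, so it
  reveals the index.\<close>

lemma disjoint_trees_UN_subset:
  assumes "disjoint_trees J s" "A \<subseteq> J" "B \<subseteq> J"
    "(\<Union>a\<in>A. leaves (s a)) \<subseteq> (\<Union>a\<in>B. leaves (s a))"
  shows "A \<subseteq> B"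
proof
  fix i assume i: "i \<in> A"
  obtain a where "a \<in> leaves (s i)" using leaves_nonempty[of "s i"] by blast
  moreover from this obtain j where "j \<in> B" "a \<in> leaves (s j)" using assms(4) i by blast
  ultimately show "i \<in> B" using disjoint_treesD[OF assms(1), of i j a] i assms(2,3) by auto
qed

lemma binary_bindt: "binary_tree t \<Longrightarrow> disjoint_trees (leaves t) s \<Longrightarrow> binary_tree (bindt s t)"
proof (induction t rule: btree_induct)
  case (node l r)
  then have "disjoint_trees (leaves l) s" "disjoint_trees (leaves r) s"
    by (auto intro: disjoint_trees_subset)
  moreover have "leaves (bindt s l) \<inter> leaves (bindt s r) = {}"
  proof (rule ccontr)
    assume "\<not> ?thesis"
    then obtain a i j where "i \<in> leaves l" "j \<in> leaves r" "a \<in> leaves (s i)" "a \<in> leaves (s j)"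
      by (auto simp: leaves_bindt)
    then show False
      using disjoint_treesD[OF node.prems(2), of i j a] node.prems(1) by auto
  qed
  ultimately show ?case using node by simp
qed (simp add: disjoint_trees_def)

text \<open>\<open>contract\<close> names a new leaf by the leaf set of the vertex it replaces, so
  looking up that vertex by its leaf set restores the tree, whatever \<open>U\<close> is.\<close>

lemma bindt_contract: "(\<And>v. v \<in> vertices t \<Longrightarrow> g (leaves v) = v) \<Longrightarrow> bindt g (contract U t) = t"
proof (induction t rule: btree_induct)
  case (Leaf a)
  then show ?case using Leaf[of "Leaf a"] by simp
next
  case (node l r)
  show ?case using node node.prems[of "node l r"] by auto
qed

text \<open>\<open>U\<close> has to catch the grafted trees at their roots and no skeleton vertex
  above them. A grafted single leaf may be absent from \<open>U\<close>, since
  \<open>contract\<close> renames \<open>Leaf a\<close> to \<open>Leaf {a}\<close> in any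
  case.\<close>

lemma contract_bindt:
  assumes "\<And>j. j \<in> leaves t \<Longrightarrow> s j \<in> U \<or> (\<exists>a. s j = Leaf a)"
    "\<And>u. u \<in> vertices t \<Longrightarrow> children u \<noteq> {} \<Longrightarrow> bindt s u \<notin> U"
  shows "contract U (bindt s t) = map_btree (\<lambda>j. leaves (s j)) t"
  using assms
proof (induction t rule: btree_induct)
  case (Leaf j)
  then show ?case by (cases "s j") auto
next
  case (node l r)
  then show ?case using node.prems(2)[of "node l r"] by auto
qed

text \<open>Contracting the grafted trees recovers the skeleton with leaf \<open>j\<close> renamed
  to \<open>leaves (s j)\<close>; disjointness makes this renaming injective.\<close>

lemma bindt_inject:
  assumes "binary_tree t" "binary_tree t'" "disjoint_trees (leaves t) s" "disjoint_trees (leaves t') s"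
    "bindt s t = bindt s t'" "leaves t = leaves t'"
  shows "t = t'"
proof -
  define U where "U = s ` leaves t"
  have *: "contract U (bindt s v) = map_btree (\<lambda>j. leaves (s j)) v"
    if v: "binary_tree v" "leaves v = leaves t" "disjoint_trees (leaves v) s" for v
  proof (rule contract_bindt)
    fix u assume u: "u \<in> vertices v" "children u \<noteq> {}"
    \<comment> \<open>Otherwise the leaf set of \<open>bindt s u\<close> would be that of a single
      graft, so \<open>u\<close> would have only one leaf.\<close>
    show "bindt s u \<notin> U"
    proof
      assume "bindt s u \<in> U"
      then obtain j where j: "j \<in> leaves v" "bindt s u = s j" using v by (auto simp: U_def)
      then have "leaves (bindt s u) = leaves (s j)" by simp
      then have "leaves u \<subseteq> {j}"
        using j u leaves_vertex[OF u(1)]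
        by (intro disjoint_trees_UN_subset[OF v(3), of "leaves u" "{j}"]) (simp_all flip: leaves_bindt)
      then have "leaves u = {j}" using leaves_nonempty[of u] by blast
      then show False using u(2) leaves_singleton[of u j] binary_vertex[OF v(1) u(1)] by auto
    qed
  qed (use v in \<open>auto simp: U_def\<close>)
  have "map_btree (\<lambda>j. leaves (s j)) t = map_btree (\<lambda>j. leaves (s j)) t'"
    using *[of t] *[of t'] assms by simp
  moreover have "inj_on (\<lambda>j. leaves (s j)) (leaves t)"
    by (rule inj_onI) (metis assms(3) disjoint_treesD ex_in_conv leaves_nonempty)
  ultimately show ?thesis
    using btree.inj_map_strong[of t t' "\<lambda>j. leaves (s j)" "\<lambda>j. leaves (s j)"] assms(6)
    by (auto dest: inj_onD)
qed

text \<open>The vertices that survive as leaves of \<open>contract U t\<close>: the topmost members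
  of \<open>U\<close> and the leaves below none of them.\<close>

definition contracted :: "'a btree set \<Rightarrow> 'a btree \<Rightarrow> 'a btree set" where
  "contracted U t = {v \<in> vertices t. (v \<in> U \<or> children v = {}) \<and>
    (\<forall>w\<in>vertices t. w \<in> U \<longrightarrow> children w \<noteq> {} \<longrightarrow> v \<in> vertices w \<longrightarrow> w = v)}"

lemma contracted_node:
  assumes "binary_tree (node l r)"
  shows "contracted U (node l r) =
    (if node l r \<in> U then {node l r} else contracted U l \<union> contracted U r)"
proof (cases "node l r \<in> U")
  case True
  have "v = node l r" if v: "v \<in> contracted U (node l r)" for v
  proof -
    have "node l r \<in> U \<longrightarrow> children (node l r) \<noteq> {} \<longrightarrow> v \<in> vertices (node l r) \<longrightarrow> node l r = v"
      using v self_in_vertices[of "node l r"] unfolding contracted_def by blast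
    moreover have "v \<in> vertices (node l r)" using v unfolding contracted_def by blast
    ultimately show ?thesis using True by (auto simp del: vertices_node)
  qed
  moreover have "w = node l r" if "w \<in> vertices (node l r)" "node l r \<in> vertices w" for w
    using vertices_antisym[OF assms that] .
  then have "node l r \<in> contracted U (node l r)"
    using True self_in_vertices[of "node l r"] unfolding contracted_def by blast
  ultimately show ?thesis using True by auto
next
  case False
  have sep: "v \<notin> vertices w" if "v \<in> vertices l" "w \<in> vertices r" for v w
    using that vertices_disjoint[of l r v] vertices_trans[of v w r] assms by auto
  have sep': "v \<notin> vertices w" if "v \<in> vertices r" "w \<in> vertices l" for v w
    using that vertices_disjoint[of l r v] vertices_trans[of v w l] assms by auto
  have "v \<in> contracted U (node l r) \<longleftrightarrow> v \<in> contracted U l \<union> contracted U r" for v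
  proof (cases "v = node l r")
    case True
    then have "v \<notin> vertices l" "v \<notin> vertices r"
      using binary_tree_not_own_child[OF assms] vertices_antisym[OF assms, of l]
        vertices_antisym[OF assms, of r] by auto
    then show ?thesis using True False by (simp add: contracted_def)
  next
    case neq: False
    then have "v \<in> contracted U (node l r) \<longleftrightarrow> v \<in> vertices l \<union> vertices r \<and> (v \<in> U \<or> children v = {}) \<and>
      (\<forall>w\<in>vertices l \<union> vertices r. w \<in> U \<longrightarrow> children w \<noteq> {} \<longrightarrow> v \<in> vertices w \<longrightarrow> w = v)"
      using False unfolding contracted_def by simp
    also have "\<dots> \<longleftrightarrow> v \<in> contracted U l \<union> contracted U r"
      using sep sep' unfolding contracted_def by blast
    finally show ?thesis .
  qed
  then show ?thesis using False by auto
qed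

lemma leaves_contract: "binary_tree t \<Longrightarrow> leaves (contract U t) = leaves ` contracted U t"
proof (induction t rule: btree_induct)
  case (Leaf a)
  have "contracted U (Leaf a) = {Leaf a}" by (auto simp: contracted_def)
  then show ?case by simp
next
  case (node l r)
  have "contract U (node l r) = (if node l r \<in> U then Leaf (leaves (node l r)) else node (contract U l) (contract U r))"
    by simp
  then show ?case using node by (simp add: contracted_node image_Un del: contract.simps)
qed

lemma contract_leaf_subset: "A \<in> leaves (contract U t) \<Longrightarrow> A \<subseteq> leaves t \<and> A \<noteq> {}"
  by (induction t rule: btree_induct) (auto split: if_splits)

lemma binary_contract: "binary_tree t \<Longrightarrow> binary_tree (contract U t)"
proof (induction t rule: btree_induct)
  case (node l r)
  have "leaves (contract U l) \<inter> leaves (contract U r) = {}"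
  proof (rule ccontr)
    assume "\<not> ?thesis"
    then obtain A where "A \<in> leaves (contract U l)" "A \<in> leaves (contract U r)" by auto
    then show False
      using contract_leaf_subset[of A U l] contract_leaf_subset[of A U r] node.prems by auto
  qed
  then show ?case using node by simp
qed simp

section \<open>Isomorphisms of trees\<close>

definition parents :: "'a btree \<Rightarrow> 'a btree \<Rightarrow> 'a btree set" where
  "parents t u = {w \<in> vertices t. u \<in> children w}"

definition neighbours :: "'a btree \<Rightarrow> 'a btree \<Rightarrow> 'a btree set" where
  "neighbours t u = {v \<in> vertices t. adjacent t u v}"

lemma child_not_self: "binary_tree u \<Longrightarrow> v \<in> children u \<Longrightarrow> u \<notin> vertices v"
  using vertices_antisym[of u v] child_vertex[of v u u] binary_tree_not_own_child
  by (cases u rule: btree_exhaust) auto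

lemma leaves_child:
  assumes "binary_tree u" "v \<in> children u" shows "leaves v \<subset> leaves u"
  using leaves_proper_vertex[OF assms(1) child_vertex[OF assms(2)]] child_not_self[OF assms] by (cases "v = u") auto

lemma siblings_disjoint:
  "binary_tree w \<Longrightarrow> u \<in> children w \<Longrightarrow> v \<in> children w \<Longrightarrow> u \<noteq> v \<Longrightarrow> leaves u \<inter> leaves v = {}"
  by (cases w rule: btree_exhaust) auto

text \<open>If \<open>w\<close> were not above \<open>v\<close>, laminarity would put it strictly
  below \<open>v\<close>, hence under some child of \<open>v\<close>; siblings share no leaves, so
  that child is \<open>u\<close>, and \<open>w\<close> would lie both above and below
  \<open>u\<close>.\<close>

lemma parent_least:
  assumes t: "binary_tree t" and v: "v \<in> vertices t" "u \<in> children v"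
    and w: "w \<in> vertices t" "u \<in> vertices w" "u \<noteq> w"
  shows "v \<in> vertices w"
proof (rule ccontr)
  assume *: "v \<notin> vertices w"
  have "leaves u \<subseteq> leaves v \<inter> leaves w"
    using v w leaves_vertex child_vertex[OF v(2), of v] by auto
  then have "w \<in> vertices v"
    using vertices_laminar[OF t v(1) w(1)] * leaves_nonempty[of u] by blast
  moreover have "w \<noteq> v" using * by auto
  ultimately obtain c where c: "c \<in> children v" "w \<in> vertices c"
    by (subst (asm) vertices_children) auto
  have "binary_tree v" "binary_tree u" using binary_vertex[OF t] v child_vertex by auto
  have "leaves u \<subseteq> leaves c" using c w leaves_vertex by blast
  then have "u = c"
    using siblings_disjoint[OF \<open>binary_tree v\<close> v(2) c(1)] leaves_nonempty[of u] by blast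
  then show False using c(2) w(2,3) vertices_antisym[OF \<open>binary_tree u\<close>] by auto
qed

lemma parents_child:
  assumes t: "binary_tree t" and v: "v \<in> vertices t" "u \<in> children v"
  shows "parents t u = {v}"
proof -
  have "w = v" if w: "w \<in> vertices t" "u \<in> children w" for w
  proof -
    have "binary_tree v" "binary_tree w" using binary_vertex[OF t] v w by auto
    have "v \<in> vertices w"
      using parent_least[OF t v w(1)] child_vertex[OF w(2), of w] child_not_self[OF \<open>binary_tree w\<close> w(2)] by auto
    moreover have "w \<in> vertices v"
      using parent_least[OF t w v(1)] child_vertex[OF v(2), of v] child_not_self[OF \<open>binary_tree v\<close> v(2)] by auto
    ultimately show "w = v" using vertices_antisym[OF \<open>binary_tree v\<close>] by auto
  qed
  then show ?thesis unfolding parents_def using v by blast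
qed

lemma parents_root: "binary_tree t \<Longrightarrow> parents t t = {}"
  using child_not_self[OF binary_vertex] by (fastforce simp: parents_def)

lemma neighbours_eq:
  assumes "binary_tree t" "u \<in> vertices t"
  shows "neighbours t u = children u \<union> parents t u" "children u \<inter> parents t u = {}"
proof -
  show "neighbours t u = children u \<union> parents t u"
    using assms child_vertex by (auto simp: neighbours_def adjacent_def edges_def parents_def)
  have "\<not> (v \<in> children u \<and> u \<in> children v)" if "v \<in> vertices t" for v
    using child_not_self[of u v] binary_vertex[OF assms] child_vertex[of u v v] by auto
  then show "children u \<inter> parents t u = {}" by (auto simp: parents_def)
qed

lemma finite_children [simp]: "finite (children u)"
  by (cases u rule: btree_exhaust) auto

text \<open>Zero or two children, plus one parent unless at the root: the parity of the degree
  identifies the root inside the bare graph, so a graph isomorphism cannot move it.\<close>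

lemma even_degree_iff_root:
  assumes t: "binary_tree t" and u: "u \<in> vertices t"
  shows "even (card (neighbours t u)) \<longleftrightarrow> u = t"
proof -
  have "binary_tree u" using binary_vertex[OF assms] .
  then have "even (card (children u))"
  proof (cases u rule: btree_exhaust)
    case (node l r)
    then have "l \<noteq> r" using \<open>binary_tree u\<close> by auto
    then show ?thesis using node by simp
  qed simp
  moreover have "card (parents t u) = (if u = t then 0 else 1)"
    using parents_root[OF t] parent_exists[OF u] parents_child[OF t] by auto
  moreover have "finite (parents t u)" by (simp add: parents_def)
  ultimately show ?thesis
    using neighbours_eq[OF assms] by (simp add: card_Un_disjoint)
qed

lemma graph_iso_neighbours:
  assumes "graph_iso f t t'" "u \<in> vertices t"
  shows "neighbours t' (f u) = f ` neighbours t u"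
  using assms unfolding graph_iso_def neighbours_def bij_betw_def by (auto 4 4 simp: image_iff)

lemma graph_iso_root:
  assumes "graph_iso f t t'" "binary_tree t" "binary_tree t'"
  shows "f t = t'"
proof -
  have bij: "bij_betw f (vertices t) (vertices t')" using assms(1) by (simp add: graph_iso_def)
  have "inj_on f (neighbours t t)"
    using bij by (auto simp: bij_betw_def neighbours_def intro: inj_on_subset)
  then have "card (neighbours t' (f t)) = card (neighbours t t)"
    using graph_iso_neighbours[OF assms(1), of t] by (simp add: card_image)
  then show ?thesis
    using even_degree_iff_root[OF assms(2), of t] even_degree_iff_root[OF assms(3), of "f t"]
      bij_betwE[OF bij] by auto
qed

text \<open>By induction from the root downwards: once the image of the parent is known, the
  children are the remaining neighbours.\<close>

lemma graph_iso_children: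
  assumes iso: "graph_iso f t t'" and t: "binary_tree t" "binary_tree t'" and "u \<in> vertices t"
  shows "children (f u) = f ` children u"
proof -
  have bij: "inj_on f (vertices t)" "f ` vertices t = vertices t'"
    using iso by (auto simp: graph_iso_def bij_betw_def)
  show ?thesis using assms(4)
  proof induction
    case 1
    have "f t = t'" using graph_iso_root[OF iso t] .
    then show ?case
      using graph_iso_neighbours[OF iso, of t] neighbours_eq[OF t(1), of t] neighbours_eq[OF t(2), of t']
        parents_root[OF t(1)] parents_root[OF t(2)] by simp
  next
    case (2 u v)
    have v: "v \<in> vertices t" using 2 child_vertex by blast
    have fu: "f u \<in> vertices t'" "f v \<in> vertices t'" using 2 v bij by auto
    have par: "parents t v = {u}" "parents t' (f v) = {f u}"
      using parents_child[OF t(1)] parents_child[OF t(2)] 2 fu by auto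
    have "children (f v) = neighbours t' (f v) - {f u}"
      using neighbours_eq[OF t(2) fu(2)] par by auto
    also have "\<dots> = f ` neighbours t v - f ` {u}"
      using graph_iso_neighbours[OF iso v] by simp
    also have "\<dots> = f ` (neighbours t v - {u})"
      using bij(1) 2(1) by (intro inj_on_image_set_diff[symmetric, of f "vertices t"])
        (auto simp: neighbours_def)
    also have "neighbours t v - {u} = children v"
      using neighbours_eq[OF t(1) v] par by auto
    finally show ?case .
  qed
qed

text \<open>A map that respects children is determined, bottom up, by its values on the
  leaves.\<close>

lemma graph_iso_imp_map_btree:
  assumes iso: "graph_iso f t t'" and t: "binary_tree t" "binary_tree t'"
  obtains h where "inj_on h (leaves t)" "t' = map_btree h t" "\<forall>u\<in>vertices t. f u = map_btree h u"
proof -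
  have "\<exists>b. f (Leaf a) = Leaf b" if "a \<in> leaves t" for a
    using graph_iso_children[OF iso t, of "Leaf a"] that by (simp flip: children_empty_iff)
  then obtain h where h: "\<And>a. a \<in> leaves t \<Longrightarrow> f (Leaf a) = Leaf (h a)" by metis
  have inj: "inj_on h (leaves t)"
  proof (rule inj_onI)
    fix a b assume *: "a \<in> leaves t" "b \<in> leaves t" "h a = h b"
    then have "f (Leaf a) = f (Leaf b)" by (simp add: h)
    moreover have "inj_on f (vertices t)" using iso by (auto simp: graph_iso_def bij_betw_def)
    ultimately show "a = b" using * by (auto dest: inj_onD)
  qed
  have f: "f u = map_btree h u" if "u \<in> vertices t" for u
    using that
  proof (induction u rule: btree_induct)
    case (node l r)
    have lr: "l \<in> vertices t" "r \<in> vertices t"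
      using vertices_trans[OF _ node.prems] by auto
    have "children (f (node l r)) = {f l, f r}"
      using graph_iso_children[OF iso t node.prems] by simp
    then have "f (node l r) = node (f l) (f r)"
      by (cases "f (node l r)" rule: btree_exhaust) (auto simp: doubleton_eq_iff)
    then show ?case using node.IH lr by simp
  qed (use h in auto)
  show ?thesis using that[OF inj] f[of t] f graph_iso_root[OF iso t] by auto
qed

lemma inj_on_map_btree:
  assumes "binary_tree t" "inj_on h (leaves t)"
  shows "inj_on (map_btree h) (vertices t)"
proof (rule inj_onI)
  fix u v assume *: "u \<in> vertices t" "v \<in> vertices t" "map_btree h u = map_btree h v"
  then have "h ` leaves u = h ` leaves v" by (metis leaves_map_btree)
  then have "leaves u = leaves v"
    using inj_on_image_eq_iff[OF assms(2), of "leaves u" "leaves v"] leaves_vertex[OF *(1)]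
      leaves_vertex[OF *(2)] by simp
  then show "u = v" using vertex_eqI[OF assms(1)] * by auto
qed

lemma graph_iso_map_btree:
  assumes "binary_tree t" "inj_on h (leaves t)"
  shows "graph_iso (map_btree h) t (map_btree h t)"
proof -
  note inj = inj_on_map_btree[OF assms]
  have edge: "(map_btree h u, map_btree h v) \<in> edges (map_btree h t) \<longleftrightarrow> (u, v) \<in> edges t"
    if "u \<in> vertices t" "v \<in> vertices t" for u v
    using that inj_on_image_mem_iff[OF inj, of v "children u"] child_vertex
    by (auto simp: edges_def vertices_map_btree children_map_btree)
  then show ?thesis
    using inj by (auto simp: graph_iso_def bij_betw_def vertices_map_btree adjacent_def)
qed

section \<open>Diagonal form of tanglegrams\<close>

type_synonym 'a tpair = "'a btree \<times> 'a btree"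

definition tpair :: "'a tpair \<Rightarrow> bool" where
  "tpair P \<longleftrightarrow> binary_tree (fst P) \<and> binary_tree (snd P) \<and> leaves (snd P) = leaves (fst P)"

definition pleaves :: "'a tpair \<Rightarrow> 'a set" where
  "pleaves P = leaves (fst P)"

definition pmap :: "('a \<Rightarrow> 'b) \<Rightarrow> 'a tpair \<Rightarrow> 'b tpair" where
  "pmap h = map_prod (map_btree h) (map_btree h)"

definition piso :: "'a tpair \<Rightarrow> 'b tpair \<Rightarrow> bool" where
  "piso P Q \<longleftrightarrow> (\<exists>h. inj_on h (pleaves P) \<and> Q = pmap h P)"

definition mate :: "('a \<times> 'a) set \<Rightarrow> 'a \<Rightarrow> 'a" where
  "mate M b = (THE a. (a, b) \<in> M)"

fun diagonal :: "'a tanglegram \<Rightarrow> 'a tpair" where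
  "diagonal (L, R, M) = (L, map_btree (mate M) R)"

lemma
  assumes "tanglegram (L, R, M)"
  shows matching_mate: "M = (\<lambda>b. (mate M b, b)) ` leaves R"
    and bij_mate: "bij_betw (mate M) (leaves R) (leaves L)"
proof -
  have M: "M \<subseteq> leaves L \<times> leaves R" "\<And>a. a \<in> leaves L \<Longrightarrow> \<exists>!b. (a, b) \<in> M"
    "\<And>b. b \<in> leaves R \<Longrightarrow> \<exists>!a. (a, b) \<in> M"
    using assms by auto
  have 1: "(mate M b, b) \<in> M" if "b \<in> leaves R" for b
    unfolding mate_def using theI'[OF M(3)[OF that]] .
  have 2: "mate M b = a" if "(a, b) \<in> M" for a b
    unfolding mate_def using that M by (intro the_equality) blast+
  show *: "M = (\<lambda>b. (mate M b, b)) ` leaves R"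
    using 1 2 M(1) by force
  have "inj_on (mate M) (leaves R)"
    using 1 M(1,2) by (intro inj_onI) (metis mem_Sigma_iff subsetD)
  moreover have "mate M ` leaves R = leaves L"
    using 1 2 M(1,2) by (force simp: image_iff)
  ultimately show "bij_betw (mate M) (leaves R) (leaves L)" by (simp add: bij_betw_def)
qed

lemma tpair_diagonal:
  assumes "tanglegram T" shows "tpair (diagonal T)"
proof -
  obtain L R M where T: "T = (L, R, M)" by (cases T)
  then show ?thesis
    using assms bij_mate[of L R M] by (simp add: tpair_def leaves_map_btree binary_map_btree bij_betw_def)
qed

lemma tsize_diagonal: "tsize T = card (pleaves (diagonal T))"
  by (cases T) (simp add: pleaves_def)

text \<open>Respecting the matching means that the leaf maps \<open>h\<close> on the left and
  \<open>k\<close> on the right satisfy \<open>mate M' (k b) = h (mate M b)\<close>. Thus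
  \<open>h\<close> determines \<open>k\<close>, and after relabelling the right trees one map serves
  both sides.\<close>

lemma isomorphic_iff:
  assumes "tanglegram S" "tanglegram T"
  shows "isomorphic S T \<longleftrightarrow> piso (diagonal S) (diagonal T)"
proof -
  obtain L R M L' R' M' where ST: "S = (L, R, M)" "T = (L', R', M')" by (cases S, cases T)
  note S = assms(1)[unfolded ST] and T = assms(2)[unfolded ST]
  have bin: "binary_tree L" "binary_tree R" "binary_tree L'" "binary_tree R'" using S T by auto
  note m = bij_mate[OF S] and m' = bij_mate[OF T] and M = matching_mate[OF S] and M' = matching_mate[OF T]
  show ?thesis
  proof
    assume "isomorphic S T"
    then obtain f g where fg: "graph_iso f L L'" "graph_iso g R R'"
      "map_prod f g ` matching_edges M = matching_edges M'" using ST by auto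
    obtain h where h: "inj_on h (leaves L)" "L' = map_btree h L" "\<forall>u\<in>vertices L. f u = map_btree h u"
      by (rule graph_iso_imp_map_btree[OF fg(1) bin(1,3)])
    obtain k where k: "inj_on k (leaves R)" "R' = map_btree k R" "\<forall>u\<in>vertices R. g u = map_btree k u"
      by (rule graph_iso_imp_map_btree[OF fg(2) bin(2,4)])
    have "mate M' (k b) = h (mate M b)" if b: "b \<in> leaves R" for b
    proof -
      have a: "mate M b \<in> leaves L" using b m by (auto simp: bij_betw_def)
      have "(mate M b, b) \<in> M" using b by (subst M) simp
      then have "map_prod f g (Leaf (mate M b), Leaf b) \<in> matching_edges M'"
        unfolding fg(3)[symmetric] by (intro imageI) (force simp: matching_edges_def)
      then have "(Leaf (h (mate M b)), Leaf (k b)) \<in> matching_edges M'"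
        using bspec[OF h(3), of "Leaf (mate M b)"] bspec[OF k(3), of "Leaf b"] a b by simp
      then have "(h (mate M b), k b) \<in> M'" unfolding matching_edges_def by auto
      then show ?thesis by (subst (asm) M') auto
    qed
    then have "map_btree (mate M') R' = map_btree h (map_btree (mate M) R)"
      unfolding k(2) map_btree_comp by (intro map_btree_cong) simp
    then show "piso (diagonal S) (diagonal T)"
      using h ST by (auto simp: piso_def pmap_def pleaves_def)
  next
    assume "piso (diagonal S) (diagonal T)"
    then obtain h where h: "inj_on h (leaves L)" "L' = map_btree h L"
      "map_btree (mate M') R' = map_btree h (map_btree (mate M) R)"
      using ST by (auto simp: piso_def pmap_def pleaves_def)
    \<comment> \<open>The inverse of \<open>mate M'\<close> carries \<open>h\<close> over to the
      right leaves, which yields the only possible \<open>k\<close>.\<close>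
    define e where "e = inv_into (leaves R') (mate M')"
    define k where "k b = e (h (mate M b))" for b
    have e: "bij_betw e (leaves L') (leaves R')" unfolding e_def by (rule bij_betw_inv_into[OF m'])
    have hL: "bij_betw h (leaves L) (leaves L')" using h by (simp add: bij_betw_def leaves_map_btree)
    have bk: "bij_betw k (leaves R) (leaves R')"
      using bij_betw_trans[OF bij_betw_trans[OF m hL] e] by (simp add: k_def[abs_def] comp_def)
    have ek: "mate M' (k b) = h (mate M b)" if "b \<in> leaves R" for b
      using that m hL m' bij_betw_inv_into_right[OF m'] by (auto simp: k_def e_def bij_betw_def)
    have "R' = map_btree e (map_btree (mate M') R')"
      unfolding map_btree_comp
      by (rule map_btree_id_on[symmetric]) (simp add: e_def bij_betw_inv_into_left[OF m'])
    also have "\<dots> = map_btree k R"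
      unfolding h(3) map_btree_comp k_def ..
    finally have R': "R' = map_btree k R" .
    have "map_prod (map_btree h) (map_btree k) ` matching_edges M
        = (\<lambda>b. (Leaf (mate M' (k b)), Leaf (k b))) ` leaves R"
      by (subst M) (simp add: matching_edges_def image_image ek cong: image_cong)
    also have "\<dots> = (\<lambda>b. (Leaf (mate M' b), Leaf b)) ` k ` leaves R" by (simp add: image_image)
    also have "\<dots> = matching_edges M'"
      using bk by (subst (2) M') (simp add: matching_edges_def image_image bij_betw_def)
    finally show "isomorphic S T"
      using graph_iso_map_btree[OF bin(1) h(1)] graph_iso_map_btree[OF bin(2), of k] bk h(2) R'
      by (auto simp: ST bij_betw_def)
  qed
qed

section \<open>Planar layouts and convex leaf orders\<close>

text \<open>A real-valued rank rather than a list, so that the heights of the leaves in a drawing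
  can be used directly.\<close>

definition convex_order :: "('a \<Rightarrow> real) \<Rightarrow> 'a btree \<Rightarrow> bool" where
  "convex_order r t \<longleftrightarrow> inj_on r (leaves t) \<and>
     (\<forall>u\<in>vertices t. \<forall>a\<in>leaves u. \<forall>b\<in>leaves u. \<forall>c\<in>leaves t. r a < r c \<longrightarrow> r c < r b \<longrightarrow> c \<in> leaves u)"

lemma convex_orderI:
  assumes "inj_on r (leaves t)"
    "\<And>u a b c. u \<in> vertices t \<Longrightarrow> a \<in> leaves u \<Longrightarrow> b \<in> leaves u \<Longrightarrow> c \<in> leaves t \<Longrightarrow>
      r a < r c \<Longrightarrow> r c < r b \<Longrightarrow> c \<in> leaves u"
  shows "convex_order r t"
  using assms unfolding convex_order_def by blast

lemma convex_order_inj: "convex_order r t \<Longrightarrow> inj_on r (leaves t)"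
  by (simp add: convex_order_def)

lemma convex_orderD:
  "convex_order r t \<Longrightarrow> u \<in> vertices t \<Longrightarrow> a \<in> leaves u \<Longrightarrow> b \<in> leaves u \<Longrightarrow> c \<in> leaves t \<Longrightarrow>
    r a < r c \<Longrightarrow> r c < r b \<Longrightarrow> c \<in> leaves u"
  unfolding convex_order_def by blast

section \<open>From drawings to interval orders\<close>

lemma edgesD:
  assumes "(u, v) \<in> edges t"
  shows "u \<in> vertices t" "v \<in> vertices t" "v \<in> children u" "v \<in> vertices u"
  using assms child_vertex[of v u] by (auto simp: edges_def)

lemma edges_mono: "u \<in> vertices t \<Longrightarrow> edges u \<subseteq> edges t"
  using vertices_trans by (auto simp: edges_def)

lemma
  assumes "plane_embedding t p c"
  shows embedding_inj: "inj_on p (vertices t)"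
    and embedding_arc: "(u, v) \<in> edges t \<Longrightarrow> arc (c (u, v))"
    and embedding_ends: "(u, v) \<in> edges t \<Longrightarrow> pathstart (c (u, v)) = p u"
      "(u, v) \<in> edges t \<Longrightarrow> pathfinish (c (u, v)) = p v"
    and embedding_vertex: "(u, v) \<in> edges t \<Longrightarrow> w \<in> vertices t \<Longrightarrow> p w \<in> path_image (c (u, v)) \<Longrightarrow> w \<in> {u, v}"
    and embedding_edge: "(u, v) \<in> edges t \<Longrightarrow> (u', v') \<in> edges t \<Longrightarrow> (u, v) \<noteq> (u', v') \<Longrightarrow>
        path_image (c (u, v)) \<inter> path_image (c (u', v')) \<subseteq> p ` ({u, v} \<inter> {u', v'})"
  using assms unfolding plane_embedding_def by blast+

lemma plane_embedding_vertex:
  assumes "plane_embedding t p c" "u \<in> vertices t"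
  shows "plane_embedding u p c"
proof -
  have "edges u \<subseteq> edges t" "vertices u \<subseteq> vertices t"
    using edges_mono assms(2) vertices_trans by auto
  then show ?thesis
    using assms(1) inj_on_subset[of p "vertices t" "vertices u"] unfolding plane_embedding_def by blast
qed

text \<open>The drawn path from the root to the leaf \<open>x\<close>, kept as a point set so that
  disjointness can be argued edge by edge.\<close>

definition spine ::
    "'a btree \<Rightarrow> 'a \<Rightarrow> ('a btree \<Rightarrow> complex) \<Rightarrow> ('a btree \<times> 'a btree \<Rightarrow> real \<Rightarrow> complex) \<Rightarrow> complex set" where
  "spine t x p c = p ` {w \<in> vertices t. x \<in> leaves w} \<union>
     (\<Union>(u, v)\<in>{(u, v) \<in> edges t. x \<in> leaves v}. path_image (c (u, v)))"

lemma spine_mono: "u \<in> vertices t \<Longrightarrow> spine u x p c \<subseteq> spine t x p c"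
  using edges_mono[of u t] vertices_trans[of _ u t] unfolding spine_def by blast

lemma spine_subset_drawing: "spine t x p c \<subseteq> drawing t p c"
  unfolding spine_def drawing_def by blast

lemma spine_path:
  assumes "plane_embedding t p c" "x \<in> leaves t"
  shows "\<exists>g. path g \<and> pathstart g = p (Leaf x) \<and> pathfinish g = p t \<and> path_image g \<subseteq> spine t x p c"
  using assms
proof (induction t rule: btree_induct)
  case (Leaf a)
  show ?case
    by (rule exI[of _ "\<lambda>_. p (Leaf x)"])
      (use Leaf in \<open>auto simp: spine_def path_def pathstart_def pathfinish_def path_image_def\<close>)
next
  case (node l r)
  have step: ?case if v: "v \<in> children (node l r)" "x \<in> leaves v"
    "\<exists>g. path g \<and> pathstart g = p (Leaf x) \<and> pathfinish g = p v \<and> path_image g \<subseteq> spine v x p c" for v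
  proof -
    obtain g where g: "path g" "pathstart g = p (Leaf x)" "pathfinish g = p v" "path_image g \<subseteq> spine v x p c"
      using v(3) by blast
    let ?e = "reversepath (c (node l r, v))"
    have e: "(node l r, v) \<in> edges (node l r)"
      using v(1) by (simp add: edges_def)
    note * = embedding_ends[OF node.prems(1) e] arc_imp_path[OF embedding_arc[OF node.prems(1) e]]
    have "path_image ?e \<subseteq> spine (node l r) x p c"
      using e v(2) unfolding spine_def by auto
    moreover have "path_image g \<subseteq> spine (node l r) x p c"
      by (rule order_trans[OF g(4) spine_mono[OF child_vertex[OF v(1) self_in_vertices]]])
    ultimately have "path_image (g +++ ?e) \<subseteq> spine (node l r) x p c"
      by (rule subset_path_image_join[rotated])
    then show ?thesis
      using g * by (intro exI[of _ "g +++ ?e"]) auto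
  qed
  show ?case
  proof (cases "x \<in> leaves l")
    case True
    then show ?thesis
      using step[of l] node.IH(1) plane_embedding_vertex[OF node.prems(1), of l] by auto
  next
    case False
    then have "x \<in> leaves r" using node.prems(2) by simp
    then show ?thesis
      using step[of r] node.IH(2) plane_embedding_vertex[OF node.prems(1), of r] by auto
  qed
qed

text \<open>All vertices on the way to \<open>x\<close> have \<open>x\<close> below them and no
  vertex of \<open>u\<close> does, so an edge of the spine and an edge of \<open>u\<close> are
  distinct and have no common endpoint; a plane embedding then keeps them apart.\<close>

lemma spine_disjoint_drawing:
  assumes "plane_embedding t p c" "u \<in> vertices t" "x \<notin> leaves u"
  shows "spine t x p c \<inter> drawing u p c = {}"
proof -
  note emb = embedding_inj[OF assms(1)] embedding_vertex[OF assms(1)] embedding_edge[OF assms(1)]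
  have V: "w \<in> vertices t \<and> x \<notin> leaves w" if "w \<in> vertices u" for w
    using that vertices_trans[OF _ assms(2)] leaves_vertex assms(3) by blast
  have E: "(y, y') \<in> edges t \<and> y \<in> vertices u \<and> y' \<in> vertices u" if "(y, y') \<in> edges u" for y y'
    using that edges_mono[OF assms(2)] edgesD by blast
  have X: "w \<in> vertices t \<and> w' \<in> vertices t \<and> x \<in> leaves w" if "(w, w') \<in> edges t" "x \<in> leaves w'" for w w'
    using edgesD[OF that(1)] leaves_vertex[of w' w] that(2) by blast
  have False if z: "z \<in> spine t x p c" "z \<in> drawing u p c" for z
  proof -
    consider (vv) w y where "w \<in> vertices t" "x \<in> leaves w" "z = p w" "y \<in> vertices u" "z = p y"
      | (ve) w y y' where "w \<in> vertices t" "x \<in> leaves w" "z = p w" "(y, y') \<in> edges u" "z \<in> path_image (c (y, y'))"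
      | (ev) w w' y where "(w, w') \<in> edges t" "x \<in> leaves w'" "z \<in> path_image (c (w, w'))" "y \<in> vertices u" "z = p y"
      | (ee) w w' y y' where "(w, w') \<in> edges t" "x \<in> leaves w'" "z \<in> path_image (c (w, w'))"
          "(y, y') \<in> edges u" "z \<in> path_image (c (y, y'))"
      using z unfolding spine_def drawing_def by (auto split: prod.splits; blast)
    then show False
    proof cases
      case vv
      then show False using V[of y] emb(1) by (metis inj_onD)
    next
      case ve
      then show False using V[of w] E[of y y'] emb(2)[of y y' w] by blast
    next
      case ev
      then show False using V[of y] X[of w w'] emb(2)[of w w' y] by blast
    next
      case ee
      then have "(w, w') \<noteq> (y, y')" using V[of y'] E[of y y'] by blast
      then have "z \<in> p ` ({w, w'} \<inter> {y, y'})" using emb(3)[of w w' y y'] ee E[of y y'] by blast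
      then show False using ee V[of y] V[of y'] E[of y y'] X[of w w'] by blast
    qed
  qed
  then show ?thesis by blast
qed

text \<open>The Fashoda meet theorem, carried over from \<open>real^2\<close> to the complex plane
  through the coordinate map \<open>\<phi>\<close>.\<close>

lemma complex_fashoda:
  fixes f g :: "real \<Rightarrow> complex"
  assumes "path f" "path g"
    and box: "\<And>z. z \<in> path_image f \<union> path_image g \<Longrightarrow> A \<le> Re z \<and> Re z \<le> A' \<and> B \<le> Im z \<and> Im z \<le> B'"
    and ends: "Re (pathstart f) = A" "Re (pathfinish f) = A'" "Im (pathstart g) = B" "Im (pathfinish g) = B'"
  obtains z where "z \<in> path_image f" "z \<in> path_image g"
proof -
  define \<phi> :: "complex \<Rightarrow> real^2" where "\<phi> z = (\<chi> i. if i = 1 then Re z else Im z)" for z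
  have \<phi>: "\<phi> z $ 1 = Re z" "\<phi> z $ 2 = Im z" for z by (simp_all add: \<phi>_def)
  have cont: "continuous_on S \<phi>" for S
    unfolding \<phi>_def
  proof (rule continuous_on_vec_lambda)
    show "continuous_on S (\<lambda>z. if i = 1 then Re z else Im z)" for i :: 2
      by (cases "i = 1") (simp_all add: continuous_on_Re continuous_on_Im)
  qed
  have \<phi>_box: "\<phi> z \<in> cbox (\<phi> (Complex A B)) (\<phi> (Complex A' B'))" if "z \<in> path_image f \<union> path_image g" for z
    using box[OF that] by (simp add: mem_box_cart forall_2 \<phi>)
  obtain z where z: "z \<in> path_image (\<phi> \<circ> f)" "z \<in> path_image (\<phi> \<circ> g)"
  proof (rule fashoda[of "\<phi> \<circ> f" "\<phi> \<circ> g" "\<phi> (Complex A B)" "\<phi> (Complex A' B')"])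
    show "path (\<phi> \<circ> f)" "path (\<phi> \<circ> g)"
      using assms(1,2) cont by (auto intro: path_continuous_image)
    show "path_image (\<phi> \<circ> f) \<subseteq> cbox (\<phi> (Complex A B)) (\<phi> (Complex A' B'))"
      "path_image (\<phi> \<circ> g) \<subseteq> cbox (\<phi> (Complex A B)) (\<phi> (Complex A' B'))"
      using \<phi>_box by (auto simp: path_image_compose)
  qed (use ends in \<open>auto simp: \<phi> pathstart_compose pathfinish_compose\<close>)
  have "z1 = z2" if "\<phi> z1 = \<phi> z2" for z1 z2
    using that \<phi> by (metis complex_eqI)
  then show ?thesis using z that by (auto simp: path_image_compose)
qed

text \<open>Here the root convention is used: as the root is the leftmost point, the path from it to
  \<open>x\<close> spans the whole width of the rectangle and cannot evade the path that joins
  \<open>a\<close> and \<open>b\<close> below \<open>u\<close>. Inside the drawing the two are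
  disjoint, and on the line of the leaves only \<open>x\<close> could be a meeting point, but it
  lies strictly between the two prolongations.\<close>

lemma layout_not_separated:
  assumes t: "binary_tree t" "plane_embedding t p c"
    and left: "\<forall>z\<in>drawing t p c. Re z \<le> 0 \<and> (Re z = 0 \<longleftrightarrow> z \<in> p ` Leaf ` leaves t) \<and>
      (z \<noteq> p t \<longrightarrow> Re (p t) < Re z)"
    and u: "u \<in> vertices t" "a \<in> leaves u" "b \<in> leaves u" and x: "x \<in> leaves t" "x \<notin> leaves u"
    and order: "Im (p (Leaf a)) < Im (p (Leaf x))" "Im (p (Leaf x)) < Im (p (Leaf b))"
  shows False
proof -
  have u_emb: "plane_embedding u p c" using plane_embedding_vertex[OF t(2) u(1)] .
  have ab: "a \<in> leaves t" "b \<in> leaves t" using leaves_vertex[OF u(1)] u by auto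
  have draw_u: "drawing u p c \<subseteq> drawing t p c"
    using edges_mono[OF u(1)] vertices_trans[OF _ u(1)] unfolding drawing_def by blast
  have root: "p t \<in> drawing t p c" by (simp add: drawing_def)
  have leaf: "Re (p (Leaf y)) = 0" if "y \<in> leaves t" for y
    using that left unfolding drawing_def by (metis Leaf_in_vertices UnI1 imageI)
  obtain f where f: "path f" "pathstart f = p (Leaf x)" "pathfinish f = p t" "path_image f \<subseteq> spine t x p c"
    using spine_path[OF t(2) x(1)] by blast
  obtain ga where ga: "path ga" "pathstart ga = p (Leaf a)" "pathfinish ga = p u" "path_image ga \<subseteq> spine u a p c"
    using spine_path[OF u_emb u(2)] by blast
  obtain gb where gb: "path gb" "pathstart gb = p (Leaf b)" "pathfinish gb = p u" "path_image gb \<subseteq> spine u b p c"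
    using spine_path[OF u_emb u(3)] by blast
  define g0 where "g0 = ga +++ reversepath gb"
  have g0: "path g0" "pathstart g0 = p (Leaf a)" "pathfinish g0 = p (Leaf b)"
    using ga gb by (auto simp: g0_def)
  have g0_draw: "path_image g0 \<subseteq> drawing u p c"
    unfolding g0_def using ga(4) gb(4) spine_subset_drawing[of u a p c] spine_subset_drawing[of u b p c]
    by (intro subset_path_image_join) auto
  have f_draw: "path_image f \<subseteq> drawing t p c" using f(4) spine_subset_drawing[of t] by blast
  \<comment> \<open>Compactness yields a height \<open>B\<close> for a rectangle that contains both
    paths.\<close>
  have "compact (path_image f \<union> path_image g0)"
    using f(1) g0(1) by (intro compact_Un compact_path_image)
  then obtain B where B: "\<And>z. z \<in> path_image f \<union> path_image g0 \<Longrightarrow> norm z \<le> B"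
    using compact_imp_bounded bounded_iff by metis
  have imB: "- B \<le> Im z" "Im z \<le> B" if "z \<in> path_image f \<union> path_image g0" for z
    using B[OF that] abs_Im_le_cmod[of z] by linarith+
  have pa: "p (Leaf a) \<in> path_image g0" "p (Leaf b) \<in> path_image g0"
    using g0 pathstart_in_path_image[of g0] pathfinish_in_path_image[of g0] by auto
  \<comment> \<open>Prolonged along the line of the leaves, the path through \<open>u\<close> crosses the whole rectangle bottom up,
    while the path from the root to \<open>x\<close> crosses it from left to right.\<close>
  define g where "g = linepath (Complex 0 (- B)) (p (Leaf a)) +++ g0 +++ linepath (p (Leaf b)) (Complex 0 B)"
  have g: "path g" "pathstart g = Complex 0 (- B)" "pathfinish g = Complex 0 B"
    using g0 by (auto simp: g_def)
  have g_cases: "z \<in> path_image g0 \<or> Re z = 0 \<and> - B \<le> Im z \<and> Im z \<le> B \<and>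
      (Im z \<le> Im (p (Leaf a)) \<or> Im (p (Leaf b)) \<le> Im z)" if z: "z \<in> path_image g" for z
  proof -
    consider "z \<in> path_image g0" | "z \<in> closed_segment (Complex 0 (- B)) (p (Leaf a))"
      | "z \<in> closed_segment (p (Leaf b)) (Complex 0 B)"
      using z g0 by (auto simp: g_def path_image_join)
    then show ?thesis
    proof cases
      case 2
      have "p (Leaf a) = Complex 0 (Im (p (Leaf a)))" using leaf[OF ab(1)] by (simp add: complex_eq_iff)
      then have "Re z = 0 \<and> - B \<le> Im z \<and> Im z \<le> Im (p (Leaf a))"
        using 2 imB[of "p (Leaf a)"] pa closed_segment_same_Re[of "Complex 0 (- B)" "p (Leaf a)"]
        by (auto simp: closed_segment_eq_real_ivl leaf[OF ab(1)])
      then show ?thesis using imB[of "p (Leaf a)"] pa by auto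
    next
      case 3
      have "Re z = 0 \<and> Im (p (Leaf b)) \<le> Im z \<and> Im z \<le> B"
        using 3 imB[of "p (Leaf b)"] pa closed_segment_same_Re[of "p (Leaf b)" "Complex 0 B"]
        by (auto simp: closed_segment_eq_real_ivl leaf[OF ab(2)])
      then show ?thesis using imB[of "p (Leaf b)"] pa by auto
    qed auto
  qed
  have Re_t: "Re (p t) \<le> Re z" "Re z \<le> 0" if "z \<in> drawing t p c" for z
    using left that by (cases "z = p t"; force)+
  obtain z where z: "z \<in> path_image (reversepath f)" "z \<in> path_image g"
  proof (rule complex_fashoda[of "reversepath f" g "Re (p t)" 0 "- B" B])
    fix z assume "z \<in> path_image (reversepath f) \<union> path_image g"
    then consider "z \<in> path_image f" | "z \<in> path_image g0" | "Re z = 0 \<and> - B \<le> Im z \<and> Im z \<le> B"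
      using g_cases by auto
    then show "Re (p t) \<le> Re z \<and> Re z \<le> 0 \<and> - B \<le> Im z \<and> Im z \<le> B"
      using Re_t[of z] imB[of z] f_draw g0_draw draw_u Re_t[OF root] by cases auto
  qed (use f g leaf[OF x(1)] in auto)
  have zs: "z \<in> spine t x p c" using z(1) f(4) by auto
  have "z \<notin> path_image g0"
    using spine_disjoint_drawing[OF t(2) u(1) x(2)] zs g0_draw by blast
  then have *: "Re z = 0" "Im z \<le> Im (p (Leaf a)) \<or> Im (p (Leaf b)) \<le> Im z"
    using g_cases[OF z(2)] by auto
  then obtain y where y: "y \<in> leaves t" "z = p (Leaf y)"
    using zs spine_subset_drawing[of t] left by blast
  \<comment> \<open>Seen as a subtree of its own, a leaf other than \<open>x\<close> is disjoint
    from the spine of \<open>x\<close>.\<close>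
  have "y = x"
  proof (rule ccontr)
    assume "y \<noteq> x"
    moreover have "z \<in> drawing (Leaf y) p c" using y by (simp add: drawing_def)
    ultimately show False
      using spine_disjoint_drawing[OF t(2), of "Leaf y" x] y(1) zs by auto
  qed
  then show False using * y order by auto
qed

lemma layout_convex_order:
  assumes t: "binary_tree t" "plane_embedding t p c"
    and left: "\<forall>z\<in>drawing t p c. Re z \<le> 0 \<and> (Re z = 0 \<longleftrightarrow> z \<in> p ` Leaf ` leaves t) \<and>
      (z \<noteq> p t \<longrightarrow> Re (p t) < Re z)"
  shows "convex_order (\<lambda>a. Im (p (Leaf a))) t"
proof (rule convex_orderI)
  have leaf: "Re (p (Leaf y)) = 0" if "y \<in> leaves t" for y
    using that left unfolding drawing_def by (metis Leaf_in_vertices UnI1 imageI)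
  show "inj_on (\<lambda>a. Im (p (Leaf a))) (leaves t)"
  proof (rule inj_onI)
    fix a b assume *: "a \<in> leaves t" "b \<in> leaves t" "Im (p (Leaf a)) = Im (p (Leaf b))"
    then have "p (Leaf a) = p (Leaf b)" using leaf by (simp add: complex_eq_iff)
    then show "a = b" using embedding_inj[OF t(2)] * by (auto dest: inj_onD)
  qed
qed (use layout_not_separated[OF t left] in blast)

section \<open>From interval orders to straight-line drawings\<close>

definition lo :: "('a \<Rightarrow> real) \<Rightarrow> 'a btree \<Rightarrow> real" where
  "lo r u = Min (r ` leaves u)"

definition hi :: "('a \<Rightarrow> real) \<Rightarrow> 'a btree \<Rightarrow> real" where
  "hi r u = Max (r ` leaves u)"

lemma lo_hi_Leaf [simp]: "lo r (Leaf a) = r a" "hi r (Leaf a) = r a"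
  by (simp_all add: lo_def hi_def)

lemma lo_le: "a \<in> leaves u \<Longrightarrow> lo r u \<le> r a" and hi_ge: "a \<in> leaves u \<Longrightarrow> r a \<le> hi r u"
  by (simp_all add: lo_def hi_def)

lemma lo_attained: "\<exists>a\<in>leaves u. r a = lo r u" and hi_attained: "\<exists>a\<in>leaves u. r a = hi r u"
proof -
  have "lo r u \<in> r ` leaves u" "hi r u \<in> r ` leaves u"
    unfolding lo_def hi_def by (auto intro!: Min_in Max_in)
  then show "\<exists>a\<in>leaves u. r a = lo r u" "\<exists>a\<in>leaves u. r a = hi r u"
    by (metis imageE)+
qed

lemma lo_le_hi: "lo r u \<le> hi r u"
  using lo_attained[of u r] hi_ge[of _ u r] by force

lemma lo_vertex: "u \<in> vertices v \<Longrightarrow> lo r v \<le> lo r u" and hi_vertex: "u \<in> vertices v \<Longrightarrow> hi r u \<le> hi r v"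
  using lo_attained[of u r] hi_attained[of u r] leaves_vertex[of u v] lo_le[of _ v r] hi_ge[of _ v r]
  by (metis subsetD)+

lemma lo_node: "lo r (node x y) = min (lo r x) (lo r y)" and hi_node: "hi r (node x y) = max (hi r x) (hi r y)"
  by (simp_all add: lo_def hi_def image_Un Min_Un Max_Un)

text \<open>The extreme leaves of \<open>v\<close> are attained and the leaves of \<open>v\<close>
  form an interval, so no leaf of \<open>u\<close> can fall outside. Nesting of intervals thus
  reproduces descent in the tree, and the drawing can be checked with interval ends alone.\<close>

lemma vertices_interval_le:
  assumes t: "binary_tree t" "convex_order r t" and uv: "u \<in> vertices t" "v \<in> vertices t"
    and le: "lo r v \<le> lo r u" "hi r u \<le> hi r v"
  shows "u \<in> vertices v"
proof (rule vertices_leaves_le[OF t(1) uv], rule subsetI)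
  fix x assume x: "x \<in> leaves u"
  obtain a b where ab: "a \<in> leaves v" "r a = lo r v" "b \<in> leaves v" "r b = hi r v"
    using lo_attained[of v r] hi_attained[of v r] by blast
  have in_t: "x \<in> leaves t" "a \<in> leaves t" "b \<in> leaves t"
    using x ab leaves_vertex uv by blast+
  have "r a \<le> r x" "r x \<le> r b" using lo_le[OF x, of r] hi_ge[OF x, of r] le ab by auto
  then consider "r x = r a" | "r x = r b" | "r a < r x" "r x < r b" by linarith
  then show "x \<in> leaves v"
  proof cases
    case 3
    then show ?thesis using convex_orderD[OF t(2) uv(2) ab(1,3) in_t(1)] by simp
  qed (use inj_onD[OF convex_order_inj[OF t(2)]] in_t ab in metis)+
qed

lemma singleton_interval:
  assumes t: "binary_tree t" "convex_order r t" and u: "u \<in> vertices t" "lo r u = hi r u"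
  obtains a where "u = Leaf a" "a \<in> leaves t"
proof -
  obtain a where a: "a \<in> leaves u" by (meson ex_in_conv leaves_nonempty)
  then have "a \<in> leaves t" using leaves_vertex u by blast
  moreover have "u \<in> vertices (Leaf a)"
    using vertices_interval_le[OF t u(1), of "Leaf a"] \<open>a \<in> leaves t\<close> lo_le[OF a, of r] hi_ge[OF a, of r] u(2)
    by auto
  ultimately show ?thesis using that by auto
qed

text \<open>
  The vertex whose leaves occupy the interval [s, t] is put at the point with coordinates s and t
  along the diagonals, so that the parent and its two children form a right angle.
\<close>

definition spot :: "('a \<Rightarrow> real) \<Rightarrow> 'a btree \<Rightarrow> complex" where
  "spot r u = Complex (lo r u - hi r u) (lo r u + hi r u)"

definition straight :: "('a \<Rightarrow> real) \<Rightarrow> 'a btree \<times> 'a btree \<Rightarrow> real \<Rightarrow> complex" where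
  "straight r e = linepath (spot r (fst e)) (spot r (snd e))"

text \<open>Together with \<open>coord_hi\<close> the inverse of the coordinates used in
  \<open>spot\<close>, up to scale a rotation by 45 degrees. It lets every point of an edge be read
  as an interval.\<close>

definition coord_lo :: "complex \<Rightarrow> real" where "coord_lo z = (Re z + Im z) / 2"
definition coord_hi :: "complex \<Rightarrow> real" where "coord_hi z = (Im z - Re z) / 2"

lemma coord_spot [simp]: "coord_lo (spot r u) = lo r u" "coord_hi (spot r u) = hi r u"
  by (simp_all add: coord_lo_def coord_hi_def spot_def)

lemma coord_eqI: "coord_lo z = coord_lo w \<Longrightarrow> coord_hi z = coord_hi w \<Longrightarrow> z = w"
  by (auto simp: coord_lo_def coord_hi_def complex_eq_iff field_simps)

lemma Re_coord: "Re z = coord_lo z - coord_hi z"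
  by (simp add: coord_lo_def coord_hi_def field_simps)

text \<open>Both interval ends move linearly along an edge, so each of its points stands for an
  interval between that of the child and that of the parent.\<close>

lemma coord_segment:
  assumes "z \<in> path_image (straight r (u, v))" "v \<in> vertices u"
  shows "lo r u \<le> coord_lo z" "coord_lo z \<le> lo r v" "hi r v \<le> coord_hi z" "coord_hi z \<le> hi r u"
proof -
  obtain s where s: "0 \<le> s" "s \<le> 1" "z = (1 - s) *\<^sub>R spot r u + s *\<^sub>R spot r v"
    using assms(1) by (auto simp: straight_def in_segment)
  have z: "coord_lo z = (1 - s) * lo r u + s * lo r v" "coord_hi z = (1 - s) * hi r u + s * hi r v"
    unfolding s(3) by (simp_all add: coord_lo_def coord_hi_def spot_def field_simps)
  have "coord_lo z = lo r u + s * (lo r v - lo r u)" "coord_lo z = lo r v - (1 - s) * (lo r v - lo r u)"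
    "coord_hi z = hi r v + (1 - s) * (hi r u - hi r v)" "coord_hi z = hi r u - s * (hi r u - hi r v)"
    unfolding z by (simp_all add: algebra_simps)
  moreover have "0 \<le> s * (lo r v - lo r u)" "0 \<le> (1 - s) * (lo r v - lo r u)"
    "0 \<le> s * (hi r u - hi r v)" "0 \<le> (1 - s) * (hi r u - hi r v)"
    using s lo_vertex[OF assms(2), of r] hi_vertex[OF assms(2), of r] by simp_all
  ultimately show "lo r u \<le> coord_lo z" "coord_lo z \<le> lo r v" "hi r v \<le> coord_hi z" "coord_hi z \<le> hi r u"
    by linarith+
qed

lemma inj_spot:
  assumes "binary_tree t" "convex_order r t"
  shows "inj_on (spot r) (vertices t)"
proof (rule inj_onI)
  fix u v assume *: "u \<in> vertices t" "v \<in> vertices t" "spot r u = spot r v"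
  then have "lo r u = lo r v" "hi r u = hi r v" by (metis coord_spot)+
  then show "u = v"
    using vertices_interval_le[OF assms *(1,2)] vertices_interval_le[OF assms *(2,1)]
      vertices_antisym[OF binary_vertex[OF assms(1) *(2)]] by simp
qed

text \<open>A point shared by two edges stands for an interval that contains those of both lower
  ends and is contained in those of both upper ends. Hence each lower end is below the other upper
  end, which by \<open>parent_least\<close> leaves only consecutive edges and siblings.\<close>

lemma straight_embedding:
  assumes t: "binary_tree t" "convex_order r t"
  shows "plane_embedding t (spot r) (straight r)"
proof -
  have neq: "u \<noteq> v" if "(u, v) \<in> edges t" for u v
    using child_not_self[OF binary_vertex[OF t(1)]] edgesD[OF that] by auto
  have 1: "arc (straight r (u, v)) \<and> pathstart (straight r (u, v)) = spot r u \<and> pathfinish (straight r (u, v)) = spot r v"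
    if "(u, v) \<in> edges t" for u v
  proof -
    have "spot r u \<noteq> spot r v"
      using inj_onD[OF inj_spot[OF t] _ edgesD(1,2)[OF that]] neq[OF that] by blast
    then show ?thesis by (simp add: straight_def arc_linepath)
  qed
  have 2: "w \<in> {u, v}" if e: "(u, v) \<in> edges t" and w: "w \<in> vertices t" "spot r w \<in> path_image (straight r (u, v))" for u v w
  proof -
    note uv = edgesD[OF e] and c = coord_segment[OF w(2) edgesD(4)[OF e]]
    have "w \<in> vertices u" "v \<in> vertices w"
      using vertices_interval_le[OF t] uv w c by auto
    then show ?thesis
      using parent_least[OF t(1) uv(1,3) w(1)] vertices_antisym[OF binary_vertex[OF t(1) uv(1)]] by auto
  qed
  have 3: "z \<in> spot r ` ({u, v} \<inter> {u', v'})"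
    if e: "(u, v) \<in> edges t" "(u', v') \<in> edges t" "(u, v) \<noteq> (u', v')"
      and z: "z \<in> path_image (straight r (u, v))" "z \<in> path_image (straight r (u', v'))" for u v u' v' z
  proof -
    note uv = edgesD[OF e(1)] and uv' = edgesD[OF e(2)]
    note c = coord_segment[OF z(1) uv(4)] and c' = coord_segment[OF z(2) uv'(4)]
    have v: "v \<in> vertices u'" using vertices_interval_le[OF t uv(2) uv'(1)] c c' by linarith
    have v': "v' \<in> vertices u" using vertices_interval_le[OF t uv'(2) uv(1)] c c' by linarith
    consider "v = u'" | "v' = u" | "v \<noteq> u'" "v' \<noteq> u" by blast
    then show ?thesis
    proof cases
      case 1
      then have "z = spot r v" using c c' by (intro coord_eqI) auto
      then show ?thesis using 1 by auto
    next
      case 2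
      then have "z = spot r v'" using c c' by (intro coord_eqI) auto
      then show ?thesis using 2 by auto
    next
      case 3
      have "u \<in> vertices u'" "u' \<in> vertices u"
        using parent_least[OF t(1) uv(1,3) uv'(1) v] parent_least[OF t(1) uv'(1,3) uv(1) v'] 3 by auto
      then have u: "u' = u" using vertices_antisym[OF binary_vertex[OF t(1) uv(1)]] by auto
      obtain x y where xy: "u = node x y" using uv(3) by (cases u rule: btree_exhaust) auto
      \<comment> \<open>Each end of the parent's interval is an end of one of the two siblings,
        which pins both coordinates of \<open>z\<close> to those of \<open>u\<close>.\<close>
      have "{v, v'} = {x, y}" using uv(3) uv'(3) e(3) u xy by auto
      then have "lo r u = min (lo r v) (lo r v')" "hi r u = max (hi r v) (hi r v')"
        using xy lo_node[of r x y] hi_node[of r x y] by (auto simp: doubleton_eq_iff min.commute max.commute)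
      then have "z = spot r u" using c c' by (intro coord_eqI) auto
      then show ?thesis using u by auto
    qed
  qed
  have disj: "path_image (straight r (u, v)) \<inter> path_image (straight r (u', v')) \<subseteq> spot r ` ({u, v} \<inter> {u', v'})"
    if "(u, v) \<in> edges t" "(u', v') \<in> edges t" "(u, v) \<noteq> (u', v')" for u v u' v'
    using 3[OF that] by blast
  show ?thesis
    unfolding plane_embedding_def using inj_spot[OF t] 1 2 disj by blast
qed

text \<open>\<open>Re\<close> is minus the length of the interval: it vanishes only for the
  one-point intervals of the leaves and is least at the root, whose interval contains all
  others.\<close>

lemma straight_left:
  assumes t: "binary_tree t" "convex_order r t" and z: "z \<in> drawing t (spot r) (straight r)"
  shows "Re z \<le> 0" "Re z = 0 \<longleftrightarrow> z \<in> spot r ` Leaf ` leaves t" "z \<noteq> spot r t \<Longrightarrow> Re (spot r t) < Re z"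
proof -
  have leaf: "Re z = 0" if "z \<in> spot r ` Leaf ` leaves t"
    using that by (auto simp: spot_def)
  have in_vertex: "z \<in> spot r ` Leaf ` leaves t" if "v \<in> vertices t" "z = spot r v" "Re z = 0" for v
  proof -
    have "lo r v = hi r v" using that by (simp add: spot_def)
    then show ?thesis using singleton_interval[OF t that(1)] that(2) by blast
  qed
  have *: "lo r t \<le> coord_lo z \<and> coord_hi z \<le> hi r t \<and> Re z \<le> 0 \<and> (Re z = 0 \<longrightarrow> z \<in> spot r ` Leaf ` leaves t)"
  proof -
    consider v where "v \<in> vertices t" "z = spot r v" | u v where "(u, v) \<in> edges t" "z \<in> path_image (straight r (u, v))"
      using z unfolding drawing_def by auto
    then show ?thesis
    proof cases
      case 1
      then show ?thesis
        using lo_vertex[OF 1(1), of r] hi_vertex[OF 1(1), of r] lo_le_hi[of r v] in_vertex[OF 1] by (simp add: Re_coord)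
    next
      case (2 u v)
      note uv = edgesD[OF 2(1)] and c = coord_segment[OF 2(2) edgesD(4)[OF 2(1)]]
      have "z = spot r v" if "Re z = 0"
        using that c lo_le_hi[of r v] unfolding Re_coord by (intro coord_eqI) simp_all
      moreover have "lo r t \<le> coord_lo z" "coord_hi z \<le> hi r t" "Re z \<le> 0"
        using c lo_vertex[OF uv(1), of r] hi_vertex[OF uv(1), of r] lo_le_hi[of r v]
        unfolding Re_coord by linarith+
      ultimately show ?thesis using in_vertex[OF uv(2)] by blast
    qed
  qed
  then show "Re z \<le> 0" "Re z = 0 \<longleftrightarrow> z \<in> spot r ` Leaf ` leaves t" using leaf by auto
  assume "z \<noteq> spot r t"
  then have "coord_lo z \<noteq> lo r t \<or> coord_hi z \<noteq> hi r t" using coord_eqI[of z "spot r t"] by auto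
  then show "Re (spot r t) < Re z" using * by (auto simp: Re_coord)
qed

text \<open>The reflection in the line \<open>Re z = 1/2\<close>: it exchanges the lines of the left
  and the right leaves and keeps heights, so the right tree is covered by the lemmas on the left
  one.\<close>

definition mirror :: "complex \<Rightarrow> complex" where
  "mirror z = 1 - cnj z"

lemma mirror_simps [simp]: "Re (mirror z) = 1 - Re z" "Im (mirror z) = Im z" "mirror (mirror z) = z"
  by (simp_all add: mirror_def)

lemma mirror_eq_iff [simp]: "mirror z = mirror w \<longleftrightarrow> z = w"
  by (auto simp: mirror_def)

lemma mirror_image_iff: "mirror z \<in> mirror ` A \<longleftrightarrow> z \<in> A"
  by auto

lemma drawing_mirror: "drawing t (mirror \<circ> p) (\<lambda>e. mirror \<circ> c e) = mirror ` drawing t p c"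
  by (auto simp: drawing_def path_image_compose image_Un image_UN image_comp)

lemma plane_embedding_mirror:
  assumes "plane_embedding t p c"
  shows "plane_embedding t (mirror \<circ> p) (\<lambda>e. mirror \<circ> c e)"
proof -
  have arc: "arc (mirror \<circ> g)" if "arc g" for g
  proof -
    have "continuous_on (path_image g) mirror"
      unfolding mirror_def by (intro continuous_intros)
    then show ?thesis
      using that path_continuous_image[of g mirror] by (auto simp: arc_def inj_on_def)
  qed
  have 1: "mirror ` A \<inter> mirror ` B \<subseteq> mirror ` p ` C" if "A \<inter> B \<subseteq> p ` C" for A B C
    using that by auto
  have 2: "inj_on (mirror \<circ> p) (vertices t)"
    using embedding_inj[OF assms] by (auto simp: inj_on_def)
  have 3: "path_image (mirror \<circ> c (u, v)) \<inter> path_image (mirror \<circ> c (u', v')) \<subseteq> (mirror \<circ> p) ` ({u, v} \<inter> {u', v'})"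
    if "(u, v) \<in> edges t" "(u', v') \<in> edges t" "(u, v) \<noteq> (u', v')" for u v u' v'
    using 1[OF embedding_edge[OF assms that]] by (simp only: path_image_compose image_comp)
  have 4: "w \<in> {u, v}" if "(u, v) \<in> edges t" "w \<in> vertices t" "(mirror \<circ> p) w \<in> path_image (mirror \<circ> c (u, v))" for u v w
    using embedding_vertex[OF assms that(1,2)] that(3) by (simp add: path_image_compose mirror_image_iff)
  have 5: "arc (mirror \<circ> c (u, v)) \<and> pathstart (mirror \<circ> c (u, v)) = (mirror \<circ> p) u \<and>
      pathfinish (mirror \<circ> c (u, v)) = (mirror \<circ> p) v" if "(u, v) \<in> edges t" for u v
    using arc[OF embedding_arc[OF assms that]] embedding_ends[OF assms that]
    by (simp add: pathstart_compose pathfinish_compose)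
  show ?thesis
    unfolding plane_embedding_def using 2 3 4 5 by blast
qed

section \<open>Planarity as a common interval order of both trees\<close>

definition pplanar :: "'a tpair \<Rightarrow> bool" where
  "pplanar P \<longleftrightarrow> (\<exists>r. convex_order r (fst P) \<and> convex_order r (snd P))"

lemma convex_order_map_btree:
  assumes "binary_tree t" "inj_on h (leaves t)"
  shows "convex_order r (map_btree h t) \<longleftrightarrow> convex_order (\<lambda>a. r (h a)) t"
proof
  assume c: "convex_order r (map_btree h t)"
  show "convex_order (\<lambda>a. r (h a)) t"
  proof (rule convex_orderI)
    show "inj_on (\<lambda>a. r (h a)) (leaves t)"
      using convex_order_inj[OF c] assms(2) comp_inj_on[of h "leaves t" r] by (simp add: leaves_map_btree comp_def)
  next
    fix u a b x assume *: "u \<in> vertices t" "a \<in> leaves u" "b \<in> leaves u" "x \<in> leaves t" "r (h a) < r (h x)" "r (h x) < r (h b)"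
    then have "h x \<in> leaves (map_btree h u)"
      using convex_orderD[OF c, of "map_btree h u" "h a" "h b" "h x"] by (simp add: leaves_map_btree vertices_map_btree)
    then show "x \<in> leaves u"
      using inj_on_image_mem_iff[OF assms(2) *(4) leaves_vertex[OF *(1)]] by (simp add: leaves_map_btree)
  qed
next
  assume c: "convex_order (\<lambda>a. r (h a)) t"
  show "convex_order r (map_btree h t)"
  proof (rule convex_orderI)
    show "inj_on r (leaves (map_btree h t))"
      using convex_order_inj[OF c] by (auto simp: leaves_map_btree inj_on_def)
  next
    fix u a b x assume *: "u \<in> vertices (map_btree h t)" "a \<in> leaves u" "b \<in> leaves u"
      "x \<in> leaves (map_btree h t)" "r a < r x" "r x < r b"
    then obtain u' a' b' x' where "u' \<in> vertices t" "u = map_btree h u'" "a' \<in> leaves u'" "a = h a'"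
      "b' \<in> leaves u'" "b = h b'" "x' \<in> leaves t" "x = h x'"
      by (auto simp: vertices_map_btree leaves_map_btree)
    then show "x \<in> leaves u"
      using convex_orderD[OF c, of u' a' b' x'] * by (simp add: leaves_map_btree)
  qed
qed

text \<open>Lets the heights on the right line be replaced by those of the matched left leaves,
  which agree with them in order but not in value.\<close>

lemma convex_order_cong:
  assumes "convex_order r t" "inj_on s (leaves t)"
    "\<And>a b. a \<in> leaves t \<Longrightarrow> b \<in> leaves t \<Longrightarrow> s a < s b \<Longrightarrow> r a < r b"
  shows "convex_order s t"
proof (rule convex_orderI)
  fix u a b x assume *: "u \<in> vertices t" "a \<in> leaves u" "b \<in> leaves u" "x \<in> leaves t" "s a < s x" "s x < s b"
  then have "a \<in> leaves t" "b \<in> leaves t" using leaves_vertex by blast+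
  then show "x \<in> leaves u"
    using convex_orderD[OF assms(1) *(1-4)] assms(3) * by blast
qed (rule assms(2))

lemma segments_cross:
  fixes y z y' z' :: real
  assumes "y < y'" "z' \<le> z"
  shows "closed_segment (Complex 0 y) (Complex 1 z) \<inter> closed_segment (Complex 0 y') (Complex 1 z') \<noteq> {}"
proof -
  \<comment> \<open>The heights \<open>(1 - s) * y + s * z\<close> and
    \<open>(1 - s) * y' + s * z'\<close> agree exactly when \<open>s * d = y' - y\<close>. For
    \<open>z = z'\<close> this gives \<open>s = 1\<close>, a common right end.\<close>
  define d where "d = (y' - y) + (z - z')"
  define s where "s = (y' - y) / d"
  have d: "0 < d" using assms by (simp add: d_def)
  have s: "0 \<le> s" "s \<le> 1" using assms d by (auto simp: s_def field_simps d_def)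
  have "s * d = y' - y" using d by (simp add: s_def)
  then have "(1 - s) * y + s * z = (1 - s) * y' + s * z'"
    unfolding d_def by (simp add: algebra_simps)
  then have "(1 - s) *\<^sub>R Complex 0 y + s *\<^sub>R Complex 1 z = (1 - s) *\<^sub>R Complex 0 y' + s *\<^sub>R Complex 1 z'"
    by (simp add: complex_eq_iff)
  then show ?thesis
    using s unfolding closed_segment_def by blast
qed

text \<open>Without crossings the matched leaves appear in the same order on both lines, so the left
  heights serve as an interval order for both trees. Conversely, drawing both trees from one order
  puts matched leaves at equal height, and all matching edges are horizontal.\<close>

lemma planar_iff:
  assumes "tanglegram T"
  shows "planar T \<longleftrightarrow> pplanar (diagonal T)"
proof -
  obtain L R M where T: "T = (L, R, M)" by (cases T)
  note tang = assms[unfolded T]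
  have bin: "binary_tree L" "binary_tree R" using tang by auto
  note m = bij_mate[OF tang] and M = matching_mate[OF tang]
  have inj: "inj_on (mate M) (leaves R)" and img: "mate M ` leaves R = leaves L"
    using m by (auto simp: bij_betw_def)
  note conv_R = convex_order_map_btree[OF bin(2) inj]
  show ?thesis
  proof
    assume "planar T"
    then obtain p c q d where lay: "layout (L, R, M) p c q d" and cf: "crossing_free (L, R, M) p q"
      unfolding planar_def T by blast
    have emb: "plane_embedding L p c" "plane_embedding R q d" using lay by auto
    have left: "\<forall>z\<in>drawing L p c. Re z \<le> 0 \<and> (Re z = 0 \<longleftrightarrow> z \<in> p ` Leaf ` leaves L) \<and>
        (z \<noteq> p L \<longrightarrow> Re (p L) < Re z)" using lay by simp
    have right: "\<forall>z\<in>drawing R q d. Re z \<ge> 1 \<and> (Re z = 1 \<longleftrightarrow> z \<in> q ` Leaf ` leaves R) \<and>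
        (z \<noteq> q R \<longrightarrow> Re z < Re (q R))" using lay by simp
    define y where "y a = Im (p (Leaf a))" for a
    define x where "x b = Im (q (Leaf b))" for b
    have cL: "convex_order y L"
      unfolding y_def by (rule layout_convex_order[OF bin(1) emb(1) left])
    have cR: "convex_order x R"
    proof -
      have "\<forall>z\<in>drawing R (mirror \<circ> q) (\<lambda>e. mirror \<circ> d e). Re z \<le> 0 \<and>
          (Re z = 0 \<longleftrightarrow> z \<in> (mirror \<circ> q) ` Leaf ` leaves R) \<and>
          (z \<noteq> (mirror \<circ> q) R \<longrightarrow> Re ((mirror \<circ> q) R) < Re z)"
        using right unfolding drawing_mirror image_comp[symmetric] by (auto simp: mirror_image_iff)
      from layout_convex_order[OF bin(2) plane_embedding_mirror[OF emb(2)] this]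
      show ?thesis unfolding x_def by simp
    qed
    have p: "p (Leaf a) = Complex 0 (y a)" if "a \<in> leaves L" for a
    proof -
      have "p (Leaf a) \<in> drawing L p c" using that by (simp add: drawing_def)
      then have "Re (p (Leaf a)) = 0" using left that by blast
      then show ?thesis by (simp add: y_def complex_eq_iff)
    qed
    have q: "q (Leaf b) = Complex 1 (x b)" if "b \<in> leaves R" for b
    proof -
      have "q (Leaf b) \<in> drawing R q d" using that by (simp add: drawing_def)
      then have "Re (q (Leaf b)) = 1" using right that by blast
      then show ?thesis by (simp add: x_def complex_eq_iff)
    qed
    have "x a < x b" if ab: "a \<in> leaves R" "b \<in> leaves R" "y (mate M a) < y (mate M b)" for a b
    proof (rule ccontr)
      assume "\<not> x a < x b"
      then have "closed_segment (p (Leaf (mate M a))) (q (Leaf a)) \<inter>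
          closed_segment (p (Leaf (mate M b))) (q (Leaf b)) \<noteq> {}"
        using segments_cross[OF ab(3), of "x b" "x a"] q[OF ab(1)] q[OF ab(2)]
          p[OF imageI[OF ab(1), of "mate M", unfolded img]] p[OF imageI[OF ab(2), of "mate M", unfolded img]]
        by simp
      moreover have "(mate M a, a) \<in> M" "(mate M b, b) \<in> M" "a \<noteq> b"
        using ab M by blast+
      ultimately show False using cf by fastforce
    qed
    moreover have "inj_on (\<lambda>b. y (mate M b)) (leaves R)"
      using comp_inj_on[OF inj, of y] convex_order_inj[OF cL] img by (simp add: comp_def)
    ultimately have "convex_order (\<lambda>b. y (mate M b)) R"
      by (intro convex_order_cong[OF cR]) auto
    then show "pplanar (diagonal T)"
      using cL conv_R unfolding pplanar_def T by auto
  next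
    assume "pplanar (diagonal T)"
    then obtain r where r: "convex_order r L" "convex_order (\<lambda>b. r (mate M b)) R"
      using conv_R unfolding pplanar_def T by auto
    define s where "s b = r (mate M b)" for b
    have s: "convex_order s R" using r(2) by (simp add: s_def[abs_def])
    define q where "q = mirror \<circ> spot s"
    define d where "d = (\<lambda>e. mirror \<circ> straight s e)"
    have "layout (L, R, M) (spot r) (straight r) q d"
    proof -
      have "Re z \<ge> 1 \<and> (Re z = 1 \<longleftrightarrow> z \<in> q ` Leaf ` leaves R) \<and> (z \<noteq> q R \<longrightarrow> Re z < Re (q R))"
        if z: "z \<in> drawing R q d" for z
      proof -
        obtain w where w: "z = mirror w" "w \<in> drawing R (spot s) (straight s)"
          using z unfolding q_def d_def drawing_mirror by blast
        then show ?thesis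
          using straight_left[OF bin(2) s w(2)] unfolding q_def image_comp[symmetric] by (auto simp: mirror_image_iff)
      qed
      then show ?thesis
        using straight_embedding[OF bin(1) r(1)] plane_embedding_mirror[OF straight_embedding[OF bin(2) s]]
          straight_left[OF bin(1) r(1)] by (simp add: q_def d_def)
    qed
    moreover have "crossing_free (L, R, M) (spot r) q"
    proof -
      \<comment> \<open>A leaf is the interval from \<open>s b\<close> to \<open>s b\<close>, so
        \<open>spot\<close> puts it at height \<open>s b + s b\<close> on either side.\<close>
      have seg: "Im z = 2 * s b" if z: "z \<in> closed_segment (spot r (Leaf (mate M b))) (q (Leaf b))" for z b
      proof -
        obtain u where "z = (1 - u) *\<^sub>R spot r (Leaf (mate M b)) + u *\<^sub>R q (Leaf b)"
          using z unfolding in_segment by blast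
        then have "Im z = (1 - u) * (2 * s b) + u * (2 * s b)" by (simp add: q_def spot_def s_def)
        then show ?thesis by (simp add: algebra_simps)
      qed
      have "closed_segment (spot r (Leaf (mate M b))) (q (Leaf b)) \<inter>
          closed_segment (spot r (Leaf (mate M b'))) (q (Leaf b')) = {}"
        if b: "b \<in> leaves R" "b' \<in> leaves R" "b \<noteq> b'" for b b'
      proof -
        have "s b \<noteq> s b'" using inj_onD[OF convex_order_inj[OF s] _ b(1,2)] b(3) by blast
        then show ?thesis using seg[of _ b] seg[of _ b'] by force
      qed
      moreover have mem: "b \<in> leaves R \<and> a = mate M b" if "(a, b) \<in> M" for a b
        using that by (subst (asm) M) auto
      ultimately have cf: "closed_segment (spot r (Leaf a)) (q (Leaf b)) \<inter>
          closed_segment (spot r (Leaf a')) (q (Leaf b')) = {}"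
        if "(a, b) \<in> M" "(a', b') \<in> M" "(a, b) \<noteq> (a', b')" for a b a' b'
        using mem[OF that(1)] mem[OF that(2)] that(3) by auto
      show ?thesis
        unfolding crossing_free.simps by (intro ballI case_prodI2 impI) (rule cf; simp)
    qed
    ultimately show "planar T" unfolding planar_def T by blast
  qed
qed

section \<open>Common clusters, blocks and composition\<close>

definition clusters :: "'a btree \<Rightarrow> 'a set set" where
  "clusters t = leaves ` vertices t"

definition common :: "'a tpair \<Rightarrow> 'a set set" where
  "common P = clusters (fst P) \<inter> clusters (snd P)"

definition blocks :: "'a tpair \<Rightarrow> 'a set set" where
  "blocks P = {A \<in> common P. A \<noteq> pleaves P \<and> (\<forall>B\<in>common P. B \<noteq> pleaves P \<longrightarrow> A \<subseteq> B \<longrightarrow> B = A)}"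

definition pirred :: "'a tpair \<Rightarrow> bool" where
  "pirred P \<longleftrightarrow> (\<forall>A\<in>common P. A \<noteq> pleaves P \<longrightarrow> card A \<le> 1)"

definition psize :: "'a tpair \<Rightarrow> nat" where
  "psize P = card (pleaves P)"

text \<open>A pair with a single leaf has no proper common cluster, hence no blocks, whereas
  contraction leaves it at size 1.\<close>

definition irrsize :: "'a tpair \<Rightarrow> nat" where
  "irrsize P = (if psize P = 1 then 1 else card (blocks P))"

lemma tpairD:
  assumes "tpair P"
  shows "binary_tree (fst P)" "binary_tree (snd P)" "leaves (fst P) = pleaves P" "leaves (snd P) = pleaves P"
  using assms by (auto simp: tpair_def pleaves_def)

lemma finite_pleaves [simp]: "finite (pleaves P)" and pleaves_nonempty [simp]: "pleaves P \<noteq> {}"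
  by (simp_all add: pleaves_def)

lemma psize_pos [simp]: "0 < psize P"
  by (simp add: psize_def card_gt_0_iff)

lemma singleton_not_pleaves: "2 \<le> psize P \<Longrightarrow> {x} \<noteq> pleaves P"
  unfolding psize_def by (metis card_1_singleton_iff not_less_eq_eq numeral_2_eq_2 order_refl One_nat_def)

lemma finite_common [simp]: "finite (common P)"
  by (simp add: common_def clusters_def)

lemma commonD:
  assumes "A \<in> common P" shows "A \<subseteq> pleaves P" "A \<noteq> {}" "finite A"
proof -
  obtain u where u: "u \<in> vertices (fst P)" "A = leaves u"
    using assms by (auto simp: common_def clusters_def)
  then show "A \<subseteq> pleaves P" "A \<noteq> {}" "finite A"
    using leaves_vertex[OF u(1)] by (auto simp: pleaves_def)
qed

lemma singleton_common: "tpair P \<Longrightarrow> x \<in> pleaves P \<Longrightarrow> {x} \<in> common P"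
  using tpairD[of P] image_eqI[of "{x}" leaves "Leaf x"] by (auto simp: common_def clusters_def)

lemma block_above:
  assumes "A \<in> common P" "A \<noteq> pleaves P" shows "\<exists>B\<in>blocks P. A \<subseteq> B"
proof -
  have "finite {B \<in> common P. B \<noteq> pleaves P}" by simp
  from finite_has_maximal2[OF this, of A] assms
  show ?thesis by (auto simp: blocks_def)
qed

lemma blocksD:
  assumes "A \<in> blocks P"
  shows "A \<in> common P" "A \<noteq> pleaves P" "\<And>B. B \<in> common P \<Longrightarrow> B \<noteq> pleaves P \<Longrightarrow> A \<subseteq> B \<Longrightarrow> B = A"
  using assms by (auto simp: blocks_def)

lemma blocks_disjoint:
  assumes "tpair P" "A \<in> blocks P" "B \<in> blocks P" "A \<noteq> B" shows "A \<inter> B = {}"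
proof -
  obtain u v where uv: "u \<in> vertices (fst P)" "v \<in> vertices (fst P)" "A = leaves u" "B = leaves v"
    using blocksD(1)[OF assms(2)] blocksD(1)[OF assms(3)] by (auto simp: common_def clusters_def)
  have "\<not> A \<subseteq> B" "\<not> B \<subseteq> A"
    using blocksD[OF assms(2)] blocksD[OF assms(3)] assms(4) by metis+
  then show ?thesis
    using vertices_laminar[OF tpairD(1)[OF assms(1)] uv(1,2)] uv leaves_vertex[of u v] leaves_vertex[of v u] by auto
qed

lemma blocks_cover:
  assumes "tpair P" "2 \<le> psize P" shows "\<Union>(blocks P) = pleaves P"
proof
  show "\<Union>(blocks P) \<subseteq> pleaves P"
    using blocksD(1) commonD(1) by blast
  show "pleaves P \<subseteq> \<Union>(blocks P)"
  proof
    fix x assume x: "x \<in> pleaves P"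
    have "{x} \<noteq> pleaves P" using singleton_not_pleaves[OF assms(2)] .
    then show "x \<in> \<Union>(blocks P)"
      using block_above[OF singleton_common[OF assms(1) x]] by auto
  qed
qed

lemma card_blocks:
  assumes "tpair P" "2 \<le> psize P" shows "2 \<le> card (blocks P)"
proof (rule ccontr)
  assume "\<not> ?thesis"
  moreover have "finite (blocks P)" by (simp add: blocks_def)
  moreover have "blocks P \<noteq> {}" using blocks_cover[OF assms] pleaves_nonempty[of P] by (metis Union_empty)
  ultimately have "card (blocks P) = 1"
    by (metis One_nat_def Suc_1 card_gt_0_iff le_antisym not_less_eq_eq Suc_leI)
  then obtain A where "blocks P = {A}" by (meson card_1_singletonE)
  then show False using blocks_cover[OF assms] blocksD(2)[of A P] by auto
qed

text \<open>\<open>U\<close> is prescribed at internal vertices only, because subtanglegrams have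
  internal roots while a block may be a singleton. In that case \<open>contract\<close> keeps the
  leaf and names it by its block anyway.\<close>

lemma leaves_contract_blocks:
  assumes P: "tpair P" "2 \<le> psize P" and t: "binary_tree t" "leaves t = pleaves P" "blocks P \<subseteq> clusters t"
    and U: "\<And>v. v \<in> vertices t \<Longrightarrow> children v \<noteq> {} \<Longrightarrow> v \<in> U \<longleftrightarrow> leaves v \<in> blocks P"
  shows "leaves (contract U t) = blocks P"
  unfolding leaves_contract[OF t(1)]
proof (intro equalityI subsetI)
  fix A assume "A \<in> leaves ` contracted U t"
  then obtain v where v: "A = leaves v" "v \<in> vertices t" "v \<in> U \<or> children v = {}"
    "\<And>w. w \<in> vertices t \<Longrightarrow> w \<in> U \<Longrightarrow> children w \<noteq> {} \<Longrightarrow> v \<in> vertices w \<Longrightarrow> w = v"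
    unfolding contracted_def by blast
  show "A \<in> blocks P"
  proof (cases "children v = {}")
    case True
    then obtain a where a: "v = Leaf a" by (auto simp: children_empty_iff)
    then have "a \<in> pleaves P" using v(2) t(2) by simp
    moreover have "{a} \<noteq> pleaves P" using singleton_not_pleaves[OF P(2)] .
    ultimately obtain B where B: "B \<in> blocks P" "a \<in> B"
      using block_above[OF singleton_common[OF P(1)]] by blast
    then obtain w where w: "w \<in> vertices t" "B = leaves w" using t(3) by (auto simp: clusters_def)
    have "v \<in> vertices w" using a B w by simp
    then have "w = v"
      using v(4)[OF w(1)] U[OF w(1)] B w children_empty_iff[of w] a by (cases "children w = {}") auto
    then show ?thesis using B w v by simp
  qed (use U v in auto)
next
  fix A assume A: "A \<in> blocks P"
  then obtain v where v: "v \<in> vertices t" "A = leaves v" using t(3) by (auto simp: clusters_def)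
  have "w = v" if w: "w \<in> vertices t" "w \<in> U" "children w \<noteq> {}" "v \<in> vertices w" for w
  proof -
    have "leaves w \<in> blocks P" using U w by blast
    then have "leaves w = leaves v"
      using blocksD[OF A] blocksD(1,2)[of "leaves w" P] leaves_vertex[OF w(4)] v(2) by simp
    then show ?thesis using vertex_eqI[OF t(1) w(1) v(1)] by simp
  qed
  moreover have "v \<in> U \<or> children v = {}" using U v A by auto
  ultimately have "v \<in> contracted U t" using v(1) unfolding contracted_def by blast
  then show "A \<in> leaves ` contracted U t" using v(2) by blast
qed

section \<open>Grafting into a skeleton and decomposition along the blocks\<close>

definition graft :: "'i tpair \<Rightarrow> ('i \<Rightarrow> 'a tpair) \<Rightarrow> 'a tpair" where
  "graft I S = (bindt (\<lambda>j. fst (S j)) (fst I), bindt (\<lambda>j. snd (S j)) (snd I))"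

definition disjoint_pairs :: "'i set \<Rightarrow> ('i \<Rightarrow> 'a tpair) \<Rightarrow> bool" where
  "disjoint_pairs J S \<longleftrightarrow> (\<forall>j\<in>J. tpair (S j)) \<and> disjoint_family_on (\<lambda>j. pleaves (S j)) J"

lemma disjoint_pairs_trees:
  assumes "disjoint_pairs J S"
  shows "disjoint_trees J (\<lambda>j. fst (S j))" "disjoint_trees J (\<lambda>j. snd (S j))"
  using assms by (auto simp: disjoint_pairs_def disjoint_trees_def tpair_def pleaves_def disjoint_family_on_def)

lemma disjoint_pairsD:
  "disjoint_pairs J S \<Longrightarrow> i \<in> J \<Longrightarrow> j \<in> J \<Longrightarrow> a \<in> pleaves (S i) \<Longrightarrow> a \<in> pleaves (S j) \<Longrightarrow> i = j"
  "disjoint_pairs J S \<Longrightarrow> i \<in> J \<Longrightarrow> tpair (S i)"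
  by (auto simp: disjoint_pairs_def disjoint_family_on_def)

lemma clusters_bindt:
  "clusters (bindt s t) = (\<lambda>A. \<Union>j\<in>A. leaves (s j)) ` clusters t \<union> (\<Union>j\<in>leaves t. clusters (s j))"
  by (simp add: clusters_def vertices_bindt leaves_bindt image_Un image_UN image_image)

locale composition =
  fixes I :: "'i tpair" and S :: "'i \<Rightarrow> 'a tpair"
  assumes I: "tpair I" and S: "disjoint_pairs (pleaves I) S"
begin

definition merge :: "'i set \<Rightarrow> 'a set" where
  "merge A = (\<Union>j\<in>A. pleaves (S j))"

lemma leaves_S: "j \<in> pleaves I \<Longrightarrow> leaves (fst (S j)) = pleaves (S j)" "j \<in> pleaves I \<Longrightarrow> leaves (snd (S j)) = pleaves (S j)"
  using tpairD disjoint_pairsD(2)[OF S] by blast+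

lemma merge_subset_iff: "A \<subseteq> pleaves I \<Longrightarrow> B \<subseteq> pleaves I \<Longrightarrow> merge A \<subseteq> merge B \<longleftrightarrow> A \<subseteq> B"
  using disjoint_trees_UN_subset[OF disjoint_pairs_trees(1)[OF S], of A B]
  by (auto simp: merge_def pleaves_def)

lemma merge_eq_iff: "A \<subseteq> pleaves I \<Longrightarrow> B \<subseteq> pleaves I \<Longrightarrow> merge A = merge B \<longleftrightarrow> A = B"
  using merge_subset_iff[of A B] merge_subset_iff[of B A] by auto

lemma pleaves_graft: "pleaves (graft I S) = merge (pleaves I)"
  by (simp add: pleaves_def graft_def leaves_bindt merge_def)

lemma tpair_graft: "tpair (graft I S)"
  using disjoint_pairs_trees[OF S] I leaves_S
  by (auto simp: tpair_def graft_def leaves_bindt pleaves_def intro!: binary_bindt)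

lemma clusters_subset: "A \<in> clusters (fst I) \<Longrightarrow> A \<subseteq> pleaves I" "A \<in> clusters (snd I) \<Longrightarrow> A \<subseteq> pleaves I"
  using leaves_vertex tpairD[OF I] by (auto simp: clusters_def; blast)+

lemma clusters_graft:
  "clusters (fst (graft I S)) = merge ` clusters (fst I) \<union> (\<Union>j\<in>pleaves I. clusters (fst (S j)))"
  "clusters (snd (graft I S)) = merge ` clusters (snd I) \<union> (\<Union>j\<in>pleaves I. clusters (snd (S j)))"
proof -
  have "(\<Union>j\<in>A. leaves (fst (S j))) = merge A" "(\<Union>j\<in>A. leaves (snd (S j))) = merge A" if "A \<subseteq> pleaves I" for A
    using that leaves_S by (auto simp: merge_def; blast)+
  then show "clusters (fst (graft I S)) = merge ` clusters (fst I) \<union> (\<Union>j\<in>pleaves I. clusters (fst (S j)))"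
    "clusters (snd (graft I S)) = merge ` clusters (snd I) \<union> (\<Union>j\<in>pleaves I. clusters (snd (S j)))"
    using clusters_subset tpairD[OF I] by (simp_all add: graft_def clusters_bindt cong: image_cong_simp)
qed

lemma merge_common: "A \<in> common I \<Longrightarrow> merge A \<in> common (graft I S)"
  by (auto simp: common_def clusters_graft)

lemma pleaves_S_common:
  assumes "j \<in> pleaves I" shows "pleaves (S j) \<in> common (graft I S)"
  using merge_common[OF singleton_common[OF I assms]] by (simp add: merge_def)

lemma clusters_S_subset:
  assumes "j \<in> pleaves I" "B \<in> clusters (fst (S j)) \<union> clusters (snd (S j))" shows "B \<subseteq> pleaves (S j)"
  using assms leaves_S[OF assms(1)] leaves_vertex by (auto simp: clusters_def; blast)

text \<open>In each tree a cluster of the graft either lies in one part or is merged from a cluster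
  of the skeleton. If it lies in no part, both trees give a merged cluster, and injectivity of
  \<open>merge\<close> shows that these stem from the same set.\<close>

lemma common_graft_cases:
  assumes "B \<in> common (graft I S)"
  obtains A where "A \<in> common I" "B = merge A" | j where "j \<in> pleaves I" "B \<subseteq> pleaves (S j)"
proof (cases "\<exists>j\<in>pleaves I. B \<subseteq> pleaves (S j)")
  case False
  then have "B \<notin> (\<Union>j\<in>pleaves I. clusters (fst (S j)))" "B \<notin> (\<Union>j\<in>pleaves I. clusters (snd (S j)))"
    using clusters_S_subset by blast+
  then obtain A A' where A: "A \<in> clusters (fst I)" "A' \<in> clusters (snd I)" "B = merge A" "B = merge A'"
    using assms by (auto simp: common_def clusters_graft)
  then have "A = A'" using merge_eq_iff clusters_subset by metis
  then show ?thesis using that(1)[of A] A by (simp add: common_def)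
qed (use that(2) in auto)

text \<open>Irreducibility leaves no proper common cluster that spreads over several parts; two
  leaves in the skeleton ensure that each part is itself proper.\<close>

lemma blocks_graft:
  assumes "pirred I" "2 \<le> psize I"
  shows "blocks (graft I S) = (\<lambda>j. pleaves (S j)) ` pleaves I"
proof -
  have ne: "pleaves (S j) \<noteq> pleaves (graft I S)" if "j \<in> pleaves I" for j
  proof
    assume "pleaves (S j) = pleaves (graft I S)"
    then have "merge {j} = merge (pleaves I)" by (simp add: pleaves_graft merge_def)
    then have "{j} = pleaves I" using merge_eq_iff that by (metis empty_subsetI insert_subset order_refl)
    then show False using singleton_not_pleaves[OF assms(2)] by blast
  qed
  have sub: "\<exists>j\<in>pleaves I. B \<subseteq> pleaves (S j)" if B: "B \<in> common (graft I S)" "B \<noteq> pleaves (graft I S)" for B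
    using B(1)
  proof (cases rule: common_graft_cases)
    case (1 A)
    then have "A \<noteq> pleaves I" using B(2) by (auto simp: pleaves_graft)
    then have "card A \<le> 1" using assms(1) 1 by (auto simp: pirred_def)
    then have "card A = 1" using commonD[OF 1(1)] by (metis card_gt_0_iff le_antisym Suc_leI One_nat_def)
    then obtain j where "A = {j}" by (meson card_1_singletonE)
    then show ?thesis using commonD(1)[OF 1(1)] 1 by (auto simp: merge_def)
  qed auto
  have S_mono: "i = j" if "i \<in> pleaves I" "j \<in> pleaves I" "pleaves (S i) \<subseteq> pleaves (S j)" for i j
    using merge_subset_iff[of "{i}" "{j}"] that by (simp add: merge_def)
  show ?thesis
  proof (intro equalityI subsetI)
    fix B assume B: "B \<in> blocks (graft I S)"
    then obtain j where "j \<in> pleaves I" "B \<subseteq> pleaves (S j)" using sub[OF blocksD(1,2)[OF B]] by auto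
    then show "B \<in> (\<lambda>j. pleaves (S j)) ` pleaves I"
      using blocksD(3)[OF B pleaves_S_common ne] by auto
  next
    fix B assume "B \<in> (\<lambda>j. pleaves (S j)) ` pleaves I"
    then obtain j where j: "j \<in> pleaves I" "B = pleaves (S j)" by auto
    have "C = B" if C: "C \<in> common (graft I S)" "C \<noteq> pleaves (graft I S)" "B \<subseteq> C" for C
    proof -
      obtain i where "i \<in> pleaves I" "C \<subseteq> pleaves (S i)" using sub C by blast
      then show ?thesis using S_mono[of j i] j C(3) by auto
    qed
    then show "B \<in> blocks (graft I S)"
      using pleaves_S_common[OF j(1)] ne[OF j(1)] j(2) by (auto simp: blocks_def)
  qed
qed

lemma inj_pleaves_S: "inj_on (\<lambda>j. pleaves (S j)) (pleaves I)"
  using merge_eq_iff[of "{_}" "{_}"] by (auto simp: inj_on_def merge_def)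

lemma irrsize_graft:
  assumes "pirred I" "2 \<le> psize I"
  shows "irrsize (graft I S) = psize I"
proof -
  have "psize (graft I S) \<noteq> 1"
  proof
    assume "psize (graft I S) = 1"
    then obtain x where x: "pleaves (graft I S) = {x}" by (auto simp: psize_def card_1_singleton_iff)
    have "pleaves (S j) = {x}" if "j \<in> pleaves I" for j
    proof -
      have "pleaves (S j) \<subseteq> {x}" using x that by (auto simp: pleaves_graft merge_def)
      then show ?thesis using pleaves_nonempty[of "S j"] by blast
    qed
    then have "i = j" if "i \<in> pleaves I" "j \<in> pleaves I" for i j
      using inj_onD[OF inj_pleaves_S] that by auto
    then have "card (pleaves I) \<le> 1" by (auto simp: card_le_Suc0_iff_eq)
    then show False using assms(2) by (simp add: psize_def)
  qed
  then show ?thesis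
    using blocks_graft[OF assms] inj_pleaves_S by (simp add: irrsize_def card_image psize_def)
qed

lemma psize_graft: "psize (graft I S) = (\<Sum>j\<in>pleaves I. psize (S j))"
proof -
  have "disjoint_family_on (\<lambda>j. pleaves (S j)) (pleaves I)"
    using S unfolding disjoint_pairs_def by blast
  from card_UN_disjoint'[OF this] show ?thesis
    by (simp add: psize_def pleaves_graft merge_def)
qed

end

text \<open>Contracting the blocks yields the skeleton, and the leaf named \<open>A\<close> receives
  the pair of subtrees spanned by \<open>A\<close>. A proper common cluster of the skeleton merges
  to one of \<open>P\<close> that contains a block, and maximality of that block reduces it to a
  single leaf.\<close>

lemma decomposition:
  assumes P: "tpair P" "2 \<le> psize P"
  obtains I :: "'a set tpair" and S :: "'a set \<Rightarrow> 'a tpair" where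
    "tpair I" "pirred I" "pleaves I = blocks P" "disjoint_pairs (blocks P) S" "graft I S = P"
    "\<And>A. A \<in> blocks P \<Longrightarrow> pleaves (S A) = A"
proof -
  define g where "g t A = (THE v. v \<in> vertices t \<and> leaves v = A)" for t :: "'a btree" and A
  have g: "g t (leaves v) = v" if "binary_tree t" "v \<in> vertices t" for t v
    unfolding g_def by (rule the_equality) (use that in \<open>auto intro: vertex_eqI\<close>)
  note tp = tpairD[OF P(1)]
  define U where "U t = {v \<in> vertices t. leaves v \<in> blocks P}" for t
  have sub: "blocks P \<subseteq> clusters (fst P)" "blocks P \<subseteq> clusters (snd P)"
    by (auto simp: blocks_def common_def)
  have gv: "g t A \<in> vertices t" "leaves (g t A) = A"
    if t: "binary_tree t" "A \<in> clusters t" for t A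
    using t(2) g[OF t(1)] by (auto simp: clusters_def)
  define I where "I = (contract (U (fst P)) (fst P), contract (U (snd P)) (snd P))"
  define S where "S A = (g (fst P) A, g (snd P) A)" for A
  have leaves_I: "leaves (contract (U t) t) = blocks P" if "t = fst P \<or> t = snd P" for t
    using that tp sub by (intro leaves_contract_blocks[OF P]) (auto simp: U_def)
  have tI: "tpair I" "pleaves I = blocks P"
    using leaves_I tp by (auto simp: I_def tpair_def pleaves_def binary_contract)
  have S_leaves: "pleaves (S A) = A" "tpair (S A)" if "A \<in> blocks P" for A
    using gv[of "fst P" A] gv[of "snd P" A] that sub tp
      binary_vertex[of "fst P" "g (fst P) A"] binary_vertex[of "snd P" "g (snd P) A"]
    by (auto simp: S_def pleaves_def tpair_def)
  then have disj: "disjoint_pairs (blocks P) S"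
    using blocks_disjoint[OF P(1)] by (auto simp: disjoint_pairs_def disjoint_family_on_def)
  have graft: "graft I S = P"
    using bindt_contract[of "fst P" "g (fst P)" "U (fst P)"] bindt_contract[of "snd P" "g (snd P)" "U (snd P)"] g tp
    by (simp add: graft_def I_def S_def)
  interpret composition I S using tI disj by unfold_locales simp_all
  have "pirred I"
    unfolding pirred_def
  proof (intro ballI impI)
    fix A assume A: "A \<in> common I" "A \<noteq> pleaves I"
    obtain C where C: "C \<in> A" using commonD(2)[OF A(1)] by blast
    have sub: "A \<subseteq> pleaves I" "C \<in> blocks P" using commonD(1)[OF A(1)] C tI by auto
    have "merge A \<noteq> pleaves P" using merge_eq_iff[OF sub(1)] A(2) pleaves_graft graft by auto
    moreover have "C \<subseteq> merge A" using C S_leaves(1)[OF sub(2)] by (auto simp: merge_def)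
    ultimately have "merge A = merge {C}"
      using blocksD(3)[OF sub(2)] merge_common[OF A(1)] S_leaves(1)[OF sub(2)] by (simp add: graft merge_def)
    then have "A = {C}" using merge_eq_iff[of A "{C}"] sub tI by auto
    then show "card A \<le> 1" by simp
  qed
  then show ?thesis using that tI disj graft S_leaves by auto
qed

section \<open>Interval orders and planarity under grafting\<close>

lemma convex_order_bindt_part:
  assumes "convex_order r (bindt s t)" "j \<in> leaves t"
  shows "convex_order r (s j)"
proof -
  have V: "vertices (s j) \<subseteq> vertices (bindt s t)" "leaves (s j) \<subseteq> leaves (bindt s t)"
    using assms(2) by (auto simp: vertices_bindt leaves_bindt)
  show ?thesis
    using assms(1) inj_on_subset[OF _ V(2)] V unfolding convex_order_def by (meson subsetD)
qed

text \<open>One leaf \<open>e j\<close> is picked from each grafted tree; a skeleton vertex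
  \<open>u\<close> inherits the interval property from \<open>bindt s u\<close>.\<close>

lemma convex_order_bindt_skeleton:
  assumes r: "convex_order r (bindt s t)" and s: "disjoint_trees (leaves t) s"
    and e: "\<And>j. j \<in> leaves t \<Longrightarrow> e j \<in> leaves (s j)"
  shows "convex_order (\<lambda>j. r (e j)) t"
proof (rule convex_orderI)
  have in_bindt: "e j \<in> leaves (bindt s t)" if "j \<in> leaves t" for j
    using that e by (auto simp: leaves_bindt)
  show "inj_on (\<lambda>j. r (e j)) (leaves t)"
  proof (rule inj_onI)
    fix i j assume ij: "i \<in> leaves t" "j \<in> leaves t" "r (e i) = r (e j)"
    then have "e i = e j" using inj_onD[OF convex_order_inj[OF r]] in_bindt by blast
    then show "i = j" using disjoint_treesD[OF s ij(1,2)] e ij by metis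
  qed
  fix u a b c assume *: "u \<in> vertices t" "a \<in> leaves u" "b \<in> leaves u" "c \<in> leaves t"
    "r (e a) < r (e c)" "r (e c) < r (e b)"
  have u: "a \<in> leaves t" "b \<in> leaves t" "leaves u \<subseteq> leaves t" using leaves_vertex[OF *(1)] * by auto
  have "e c \<in> leaves (bindt s u)"
  proof (rule convex_orderD[OF r, of _ "e a" "e b"])
    show "bindt s u \<in> vertices (bindt s t)" using *(1) by (simp add: vertices_bindt)
    show "e a \<in> leaves (bindt s u)" "e b \<in> leaves (bindt s u)"
      using e[OF u(1)] e[OF u(2)] * by (auto simp: leaves_bindt)
  qed (use * in_bindt in auto)
  then obtain d where "d \<in> leaves u" "e c \<in> leaves (s d)" by (auto simp: leaves_bindt)
  then show "c \<in> leaves u"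
    using disjoint_treesD[OF s _ *(4) _ e[OF *(4)]] u by blast
qed

text \<open>The conditions on \<open>r\<close> describe the lexicographic order, first by
  \<open>\<rho>\<close> on the skeleton, then by \<open>q j\<close> within a part, without fixing
  its numerical form. Vertices from the skeleton collect whole parts, all others stay inside one
  part.\<close>

lemma convex_order_bindt:
  assumes \<rho>: "convex_order \<rho> t" and q: "\<And>j. j \<in> leaves t \<Longrightarrow> convex_order (q j) (s j)"
    and r: "\<And>i j x y. i \<in> leaves t \<Longrightarrow> j \<in> leaves t \<Longrightarrow> x \<in> leaves (s i) \<Longrightarrow> y \<in> leaves (s j) \<Longrightarrow>
        r x \<le> r y \<Longrightarrow> i = j \<and> q i x \<le> q i y \<or> \<rho> i < \<rho> j"
      "\<And>j x y. j \<in> leaves t \<Longrightarrow> x \<in> leaves (s j) \<Longrightarrow> y \<in> leaves (s j) \<Longrightarrow> r x < r y \<Longrightarrow> q j x < q j y"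
  shows "convex_order r (bindt s t)"
proof (rule convex_orderI)
  show "inj_on r (leaves (bindt s t))"
  proof (rule inj_onI)
    fix x y assume xy: "x \<in> leaves (bindt s t)" "y \<in> leaves (bindt s t)" "r x = r y"
    then obtain i j where ij: "i \<in> leaves t" "x \<in> leaves (s i)" "j \<in> leaves t" "y \<in> leaves (s j)"
      by (auto simp: leaves_bindt)
    have "i = j" "q i x = q i y"
      using r(1)[OF ij(1,3,2,4)] r(1)[OF ij(3,1,4,2)] xy(3) by auto
    then show "x = y" using inj_onD[OF convex_order_inj[OF q[OF ij(1)]]] ij by blast
  qed
  fix w x y z assume *: "w \<in> vertices (bindt s t)" "x \<in> leaves w" "y \<in> leaves w" "z \<in> leaves (bindt s t)"
    "r x < r z" "r z < r y"
  obtain l where l: "l \<in> leaves t" "z \<in> leaves (s l)" using *(4) by (auto simp: leaves_bindt)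
  show "z \<in> leaves w"
  proof (cases "w \<in> bindt s ` vertices t")
    case True
    then obtain u where u: "u \<in> vertices t" "w = bindt s u" by blast
    then obtain i j where ij: "i \<in> leaves u" "x \<in> leaves (s i)" "j \<in> leaves u" "y \<in> leaves (s j)"
      using * by (auto simp: leaves_bindt)
    have ijt: "i \<in> leaves t" "j \<in> leaves t" using leaves_vertex[OF u(1)] ij by auto
    have "i = l \<or> \<rho> i < \<rho> l" "l = j \<or> \<rho> l < \<rho> j"
      using r(1)[OF ijt(1) l(1) ij(2) l(2)] r(1)[OF l(1) ijt(2) l(2) ij(4)] * by auto
    then have "l \<in> leaves u" using convex_orderD[OF \<rho> u(1) ij(1,3) l(1)] ij by blast
    then show ?thesis using l u by (auto simp: leaves_bindt)
  next
    case False
    then obtain j where j: "j \<in> leaves t" "w \<in> vertices (s j)" using *(1) by (auto simp: vertices_bindt)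
    have xy: "x \<in> leaves (s j)" "y \<in> leaves (s j)" using leaves_vertex[OF j(2)] * by auto
    have "j = l \<or> \<rho> j < \<rho> l" "l = j \<or> \<rho> l < \<rho> j"
      using r(1)[OF j(1) l(1) xy(1) l(2)] r(1)[OF l(1) j(1) l(2) xy(2)] * by auto
    then have "l = j" by auto
    then show ?thesis
      using convex_orderD[OF q[OF j(1)] j(2) *(2,3)] r(2)[OF j(1)] xy l * by blast
  qed
qed

context composition
begin

definition part :: "'a \<Rightarrow> 'i" where
  "part x = (THE j. j \<in> pleaves I \<and> x \<in> pleaves (S j))"

lemma part_eq: "j \<in> pleaves I \<Longrightarrow> x \<in> pleaves (S j) \<Longrightarrow> part x = j"
  unfolding part_def using disjoint_pairsD(1)[OF S] by (intro the_equality) auto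

lemma pplanar_graft: "pplanar (graft I S) \<longleftrightarrow> pplanar I \<and> (\<forall>j\<in>pleaves I. pplanar (S j))"
proof
  assume "pplanar (graft I S)"
  then obtain r where r: "convex_order r (bindt (\<lambda>j. fst (S j)) (fst I))" "convex_order r (bindt (\<lambda>j. snd (S j)) (snd I))"
    by (auto simp: pplanar_def graft_def)
  define e where "e j = (SOME x. x \<in> pleaves (S j))" for j
  have e: "e j \<in> pleaves (S j)" for j
    unfolding e_def using pleaves_nonempty[of "S j"] by (simp add: some_in_eq)
  have "convex_order (\<lambda>j. r (e j)) (fst I)"
    by (rule convex_order_bindt_skeleton[OF r(1)])
      (use disjoint_pairs_trees[OF S] tpairD[OF I] e leaves_S in simp_all)
  moreover have "convex_order (\<lambda>j. r (e j)) (snd I)"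
    by (rule convex_order_bindt_skeleton[OF r(2)])
      (use disjoint_pairs_trees[OF S] tpairD[OF I] e leaves_S in simp_all)
  moreover have "convex_order r (fst (S j))" "convex_order r (snd (S j))" if "j \<in> pleaves I" for j
    using convex_order_bindt_part[OF r(1)] convex_order_bindt_part[OF r(2)] tpairD[OF I] that by auto
  ultimately show "pplanar I \<and> (\<forall>j\<in>pleaves I. pplanar (S j))"
    by (auto simp: pplanar_def)
next
  assume *: "pplanar I \<and> (\<forall>j\<in>pleaves I. pplanar (S j))"
  obtain \<rho> where \<rho>: "convex_order \<rho> (fst I)" "convex_order \<rho> (snd I)"
    using * by (auto simp: pplanar_def)
  obtain q where q: "\<And>j. j \<in> pleaves I \<Longrightarrow> convex_order (q j) (fst (S j)) \<and> convex_order (q j) (snd (S j))"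
    using * unfolding pplanar_def by metis
  \<comment> \<open>Integer ranks replace \<open>\<rho>\<close> so that distinct parts are at least
    1 apart, which leaves room for the inner orders.\<close>
  define rank where "rank j = real (card {i \<in> pleaves I. \<rho> i < \<rho> j})" for j
  \<comment> \<open>the values of \<open>arctan\<close> lie in an interval of length \<open>pi\<close>, so this is the lexicographic order\<close>
  define r where "r x = pi * rank (part x) + arctan (q (part x) x)" for x
  have rank: "rank i + 1 \<le> rank j" if "i \<in> pleaves I" "j \<in> pleaves I" "\<rho> i < \<rho> j" for i j
  proof -
    have "{k \<in> pleaves I. \<rho> k < \<rho> i} \<subset> {k \<in> pleaves I. \<rho> k < \<rho> j}" using that by auto
    then have "card {k \<in> pleaves I. \<rho> k < \<rho> i} < card {k \<in> pleaves I. \<rho> k < \<rho> j}"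
      by (intro psubset_card_mono) auto
    then show ?thesis by (simp add: rank_def)
  qed
  have less: "r x < r y" if "i \<in> pleaves I" "j \<in> pleaves I" "x \<in> pleaves (S i)" "y \<in> pleaves (S j)" "\<rho> i < \<rho> j" for i j x y
  proof -
    have "pi * (rank i + 1) \<le> pi * rank j" using rank[OF that(1,2,5)] by simp
    then show ?thesis
      using part_eq[OF that(1,3)] part_eq[OF that(2,4)] arctan_bounded[of "q i x"] arctan_bounded[of "q j y"]
      by (simp add: r_def algebra_simps)
  qed
  have inj: "\<rho> i = \<rho> j \<Longrightarrow> i = j" if "i \<in> pleaves I" "j \<in> pleaves I" for i j
    using convex_order_inj[OF \<rho>(1)] that tpairD(3)[OF I] by (auto dest: inj_onD)
  have r1: "i = j \<and> q i x \<le> q i y \<or> \<rho> i < \<rho> j"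
    if ij: "i \<in> pleaves I" "j \<in> pleaves I" "x \<in> pleaves (S i)" "y \<in> pleaves (S j)" "r x \<le> r y" for i j x y
  proof -
    consider "\<rho> i < \<rho> j" | "\<rho> j < \<rho> i" | "i = j" using inj[OF ij(1,2)] by linarith
    then show ?thesis
    proof cases
      case 2
      then show ?thesis using less[OF ij(2,1,4,3)] ij(5) by simp
    next
      case 3
      then show ?thesis using part_eq[OF ij(1,3)] part_eq[OF ij(2,4)] ij(5)
        by (simp add: r_def arctan_le_iff)
    qed simp
  qed
  have r2: "q j x < q j y" if "j \<in> pleaves I" "x \<in> pleaves (S j)" "y \<in> pleaves (S j)" "r x < r y" for j x y
    using that part_eq[OF that(1,2)] part_eq[OF that(1,3)] by (simp add: r_def arctan_less_iff)
  have "convex_order r (bindt (\<lambda>j. fst (S j)) (fst I))"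
    by (rule convex_order_bindt[OF \<rho>(1), where q = q]) (use q r1 r2 leaves_S tpairD(3)[OF I] in auto)
  moreover have "convex_order r (bindt (\<lambda>j. snd (S j)) (snd I))"
    by (rule convex_order_bindt[OF \<rho>(2), where q = q]) (use q r1 r2 leaves_S tpairD(4)[OF I] in auto)
  ultimately show "pplanar (graft I S)" by (auto simp: pplanar_def graft_def)
qed

end

section \<open>Isomorphisms of pairs\<close>

lemma pmap_simps [simp]: "fst (pmap h P) = map_btree h (fst P)" "snd (pmap h P) = map_btree h (snd P)"
  by (simp_all add: pmap_def)

lemma pleaves_pmap: "pleaves (pmap h P) = h ` pleaves P"
  by (simp add: pleaves_def leaves_map_btree)

lemma tpair_pmap: "tpair P \<Longrightarrow> inj_on h (pleaves P) \<Longrightarrow> tpair (pmap h P)"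
  by (auto simp: tpair_def pleaves_def leaves_map_btree binary_map_btree)

lemma psize_pmap: "inj_on h (pleaves P) \<Longrightarrow> psize (pmap h P) = psize P"
  by (simp add: psize_def pleaves_pmap card_image)

lemma pmap_comp: "pmap h (pmap g P) = pmap (\<lambda>a. h (g a)) P"
  by (simp add: pmap_def prod_eq_iff map_btree_comp)

lemma pmap_cong: "tpair P \<Longrightarrow> (\<And>a. a \<in> pleaves P \<Longrightarrow> h a = g a) \<Longrightarrow> pmap h P = pmap g P"
  by (auto simp: pmap_def prod_eq_iff tpair_def pleaves_def intro!: map_btree_cong)

lemma pmap_id_on: "tpair P \<Longrightarrow> (\<And>a. a \<in> pleaves P \<Longrightarrow> h a = a) \<Longrightarrow> pmap h P = P"
  by (auto simp: pmap_def prod_eq_iff tpair_def pleaves_def intro!: map_btree_id_on)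

lemma piso_trans: "piso P Q \<Longrightarrow> piso Q R \<Longrightarrow> piso P R"
  unfolding piso_def by (metis (no_types, lifting) comp_inj_on comp_def inj_on_cong pmap_comp pleaves_pmap)

lemma piso_sym: assumes "tpair P" "piso P Q" shows "piso Q P"
proof -
  obtain h where h: "inj_on h (pleaves P)" "Q = pmap h P" using assms(2) by (auto simp: piso_def)
  have "pmap (inv_into (pleaves P) h) Q = P"
    unfolding h(2) pmap_comp using h(1) by (intro pmap_id_on[OF assms(1)]) simp
  moreover have "inj_on (inv_into (pleaves P) h) (pleaves Q)"
    unfolding h(2) pleaves_pmap by (rule inj_on_inv_into) simp
  ultimately show ?thesis unfolding piso_def by metis
qed

lemma piso_tpair: "tpair P \<Longrightarrow> piso P Q \<Longrightarrow> tpair Q"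
  by (auto simp: piso_def tpair_pmap)

lemma piso_psize: "piso P Q \<Longrightarrow> psize Q = psize P"
  by (auto simp: piso_def psize_pmap)

lemma clusters_map_btree: "clusters (map_btree h t) = (`) h ` clusters t"
  by (simp add: clusters_def vertices_map_btree image_image leaves_map_btree)

lemma common_pmap:
  assumes "tpair P" "inj_on h (pleaves P)"
  shows "common (pmap h P) = (`) h ` common P"
proof -
  have "clusters (fst P) \<subseteq> Pow (pleaves P)" "clusters (snd P) \<subseteq> Pow (pleaves P)"
    using tpairD[OF assms(1)] leaves_vertex by (auto simp: clusters_def; blast)+
  then show ?thesis
    using inj_on_image_Int[OF inj_on_image_Pow[OF assms(2)]] by (simp add: common_def clusters_map_btree)
qed

lemma blocks_pmap:
  assumes "tpair P" "inj_on h (pleaves P)"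
  shows "blocks (pmap h P) = (`) h ` blocks P"
proof -
  have eq: "h ` A = h ` pleaves P \<longleftrightarrow> A = pleaves P" if "A \<in> common P" for A
    using inj_on_image_eq_iff[OF assms(2) commonD(1)[OF that]] by simp
  have eq2: "h ` A = h ` B \<longleftrightarrow> A = B" if "A \<in> common P" "B \<in> common P" for A B
    using inj_on_image_eq_iff[OF assms(2)] commonD(1) that by metis
  have le: "h ` A \<subseteq> h ` B \<longleftrightarrow> A \<subseteq> B" if "A \<in> common P" "B \<in> common P" for A B
    using inj_on_image_subset_iff[OF assms(2)] commonD(1) that by metis
  have "h ` A \<in> blocks (pmap h P) \<longleftrightarrow> A \<in> blocks P" if "A \<in> common P" for A
    using that by (auto simp: blocks_def common_pmap[OF assms] pleaves_pmap eq eq2 le)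
  moreover have "blocks (pmap h P) \<subseteq> (`) h ` common P" "blocks P \<subseteq> common P"
    by (auto simp: blocks_def common_pmap[OF assms])
  ultimately show ?thesis by blast
qed

lemma
  assumes "tpair P" "piso P Q"
  shows piso_irrsize: "irrsize Q = irrsize P"
    and piso_pirred: "pirred Q \<longleftrightarrow> pirred P"
    and piso_pplanar: "pplanar Q \<longleftrightarrow> pplanar P"
proof -
  obtain h where h: "inj_on h (pleaves P)" "Q = pmap h P" using assms(2) by (auto simp: piso_def)
  have "inj_on ((`) h) (blocks P)"
    by (rule inj_on_subset[OF inj_on_image_Pow[OF h(1)]]) (use blocksD(1) commonD(1) in blast)
  then show "irrsize Q = irrsize P"
    by (simp add: irrsize_def h psize_pmap blocks_pmap[OF assms(1)] card_image)
  have "h ` A = h ` pleaves P \<longleftrightarrow> A = pleaves P" "card (h ` A) = card A" if "A \<in> common P" for A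
    using inj_on_image_eq_iff[OF h(1) commonD(1)[OF that]] card_image[OF inj_on_subset[OF h(1) commonD(1)[OF that]]] by auto
  then show "pirred Q \<longleftrightarrow> pirred P"
    by (auto simp: pirred_def h(2) common_pmap[OF assms(1) h(1)] pleaves_pmap)
  note conv = convex_order_map_btree[OF tpairD(1)[OF assms(1)], of h] convex_order_map_btree[OF tpairD(2)[OF assms(1)], of h]
  show "pplanar Q \<longleftrightarrow> pplanar P"
  proof
    assume "pplanar Q"
    then show "pplanar P"
      using conv h tpairD[OF assms(1)] by (auto simp: pplanar_def)
  next
    assume "pplanar P"
    then obtain r where r: "convex_order r (fst P)" "convex_order r (snd P)" by (auto simp: pplanar_def)
    define s where "s a = r (inv_into (pleaves P) h a)" for a
    have s: "s (h a) = r a" if "a \<in> pleaves P" for a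
      using that h(1) by (simp add: s_def)
    have "inj_on (\<lambda>a. s (h a)) (pleaves P)"
      using convex_order_inj[OF r(1)] s tpairD(3)[OF assms(1)] by (simp add: inj_on_def)
    then have "convex_order (\<lambda>a. s (h a)) (fst P)" "convex_order (\<lambda>a. s (h a)) (snd P)"
      using convex_order_cong[OF r(1), of "\<lambda>a. s (h a)"] convex_order_cong[OF r(2), of "\<lambda>a. s (h a)"]
        s tpairD[OF assms(1)] by simp_all
    then show "pplanar Q"
      using conv h tpairD[OF assms(1)] by (auto simp: pplanar_def)
  qed
qed

text \<open>The isomorphisms of the parts are glued along \<open>part\<close>; the result is
  injective because distinct parts are sent into disjoint parts of the target.\<close>

lemma piso_graft:
  assumes "composition I S" "composition I' S'" and h: "inj_on h (pleaves I)" "I' = pmap h I"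
    and S: "\<And>j. j \<in> pleaves I \<Longrightarrow> piso (S j) (S' (h j))"
  shows "piso (graft I S) (graft I' S')"
proof -
  interpret A: composition I S by fact
  interpret B: composition I' S' by fact
  have hI: "h j \<in> pleaves I'" if "j \<in> pleaves I" for j using that h by (simp add: pleaves_pmap)
  obtain g where g: "\<And>j. j \<in> pleaves I \<Longrightarrow> inj_on (g j) (pleaves (S j)) \<and> S' (h j) = pmap (g j) (S j)"
    using S unfolding piso_def by metis
  define G where "G x = g (A.part x) x" for x
  have G: "G x = g j x" if "j \<in> pleaves I" "x \<in> pleaves (S j)" for j x
    using A.part_eq[OF that] by (simp add: G_def)
  have SG: "S' (h j) = pmap G (S j)" if "j \<in> pleaves I" for j
    using g[OF that] G[OF that] pmap_cong[OF disjoint_pairsD(2)[OF A.S that], of G "g j"] by simp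
  have "inj_on G (pleaves (graft I S))"
  proof (rule inj_onI)
    fix x y assume xy: "x \<in> pleaves (graft I S)" "y \<in> pleaves (graft I S)" "G x = G y"
    then obtain i j where ij: "i \<in> pleaves I" "x \<in> pleaves (S i)" "j \<in> pleaves I" "y \<in> pleaves (S j)"
      by (auto simp: A.pleaves_graft A.merge_def)
    have "G x \<in> pleaves (S' (h i))" "G y \<in> pleaves (S' (h j))"
      using ij SG by (simp_all add: pleaves_pmap)
    then have "h i = h j" using disjoint_pairsD(1)[OF B.S hI hI] ij xy(3) by metis
    then have "i = j" using h(1) ij by (auto dest: inj_onD)
    then show "x = y" using g[OF ij(1)] G ij xy(3) by (auto dest: inj_onD)
  qed
  moreover have "graft I' S' = pmap G (graft I S)"
    using SG tpairD[OF A.I] unfolding graft_def pmap_def h(2)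
    by (auto simp: bindt_map map_bindt pmap_def intro!: bindt_cong)
  ultimately show ?thesis by (auto simp: piso_def)
qed

text \<open>Isomorphisms preserve blocks, and over irreducible skeletons the blocks are exactly the
  parts. So whole parts are sent to whole parts, which defines \<open>h\<close>; that
  \<open>h\<close> takes one skeleton to the other then follows from
  \<open>bindt_inject\<close>.\<close>

lemma piso_graftD:
  assumes "composition I S" "composition I' S'" and irr: "pirred I" "pirred I'" "2 \<le> psize I" "2 \<le> psize I'"
    and iso: "piso (graft I S) (graft I' S')"
  obtains h where "inj_on h (pleaves I)" "I' = pmap h I" "\<And>j. j \<in> pleaves I \<Longrightarrow> piso (S j) (S' (h j))"
proof -
  interpret A: composition I S by fact
  interpret B: composition I' S' by fact
  obtain G where G: "inj_on G (pleaves (graft I S))" "graft I' S' = pmap G (graft I S)"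
    using iso by (auto simp: piso_def)
  have "(\<lambda>j. pleaves (S' j)) ` pleaves I' = (`) G ` (\<lambda>j. pleaves (S j)) ` pleaves I"
    using blocks_pmap[OF A.tpair_graft G(1)] A.blocks_graft[OF irr(1,3)] B.blocks_graft[OF irr(2,4)] G(2) by simp
  then have bl: "(\<lambda>j. pleaves (S' j)) ` pleaves I' = (\<lambda>j. G ` pleaves (S j)) ` pleaves I"
    by (simp add: image_image)
  then have "\<exists>k\<in>pleaves I'. pleaves (S' k) = G ` pleaves (S j)" if "j \<in> pleaves I" for j
    using that by (metis (no_types, lifting) imageE imageI)
  then obtain h where h: "\<And>j. j \<in> pleaves I \<Longrightarrow> h j \<in> pleaves I' \<and> pleaves (S' (h j)) = G ` pleaves (S j)"
    by metis
  have sub: "pleaves (S j) \<subseteq> pleaves (graft I S)" if "j \<in> pleaves I" for j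
    using that by (auto simp: A.pleaves_graft A.merge_def)
  have inj: "inj_on h (pleaves I)"
  proof (rule inj_onI)
    fix i j assume ij: "i \<in> pleaves I" "j \<in> pleaves I" "h i = h j"
    then have "G ` pleaves (S i) = G ` pleaves (S j)" using h by metis
    then have "pleaves (S i) = pleaves (S j)"
      using inj_on_image_eq_iff[OF G(1) sub sub] ij by blast
    then show "i = j" using inj_onD[OF A.inj_pleaves_S] ij by blast
  qed
  have img: "h ` pleaves I = pleaves I'"
  proof (intro equalityI subsetI)
    fix k assume k: "k \<in> pleaves I'"
    then obtain j where j: "j \<in> pleaves I" "pleaves (S' k) = G ` pleaves (S j)" using bl by (metis (no_types, lifting) imageE imageI)
    then have "k = h j" using h[OF j(1)] inj_onD[OF B.inj_pleaves_S, of k "h j"] k by auto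
    then show "k \<in> h ` pleaves I" using j by blast
  qed (use h in auto)
  \<comment> \<open>Stated for one tree with its grafts, to be used for the left and the right
    components alike. Two grafts are identified by having equal leaf sets inside the same
    tree.\<close>
  have tree: "t' = map_btree h t \<and> (\<forall>j\<in>pleaves I. s' (h j) = map_btree G (s j))"
    if t: "binary_tree t" "binary_tree t'" "leaves t = pleaves I" "leaves t' = pleaves I'"
      and s: "\<And>j. j \<in> pleaves I \<Longrightarrow> leaves (s j) = pleaves (S j)" "\<And>j. j \<in> pleaves I' \<Longrightarrow> leaves (s' j) = pleaves (S' j)"
        "disjoint_trees (pleaves I') s'"
      and eq: "bindt s' t' = map_btree G (bindt s t)" for t t' s s'
  proof -
    have bin: "binary_tree (bindt s' t')" using binary_bindt[OF t(2)] s(3) t(4) by simp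
    have part: "s' (h j) = map_btree G (s j)" if j: "j \<in> pleaves I" for j
    proof (rule vertex_eqI[OF bin])
      show "s' (h j) \<in> vertices (bindt s' t')" using h[OF j] t(4) self_in_vertices[of "s' (h j)"] unfolding vertices_bindt by blast
      show "map_btree G (s j) \<in> vertices (bindt s' t')"
        unfolding eq vertices_map_btree vertices_bindt
        using j t(3) self_in_vertices[of "s j"] by blast
      show "leaves (s' (h j)) = leaves (map_btree G (s j))"
        using h[OF j] s(1)[OF j] s(2) by (simp add: leaves_map_btree)
    qed
    have "bindt s' t' = bindt s' (map_btree h t)"
      unfolding eq map_bindt bindt_map using part t(3) by (intro bindt_cong) auto
    then have "t' = map_btree h t"
      using t s inj img by (intro bindt_inject[of t' _ s']) (auto simp: leaves_map_btree binary_map_btree)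
    then show ?thesis using part by simp
  qed
  have "fst I' = map_btree h (fst I) \<and> (\<forall>j\<in>pleaves I. fst (S' (h j)) = map_btree G (fst (S j)))"
    using tpairD[OF A.I] tpairD[OF B.I] A.leaves_S B.leaves_S disjoint_pairs_trees[OF B.S] G(2)
    by (intro tree) (auto simp: graft_def pmap_def)
  moreover have "snd I' = map_btree h (snd I) \<and> (\<forall>j\<in>pleaves I. snd (S' (h j)) = map_btree G (snd (S j)))"
    using tpairD[OF A.I] tpairD[OF B.I] A.leaves_S B.leaves_S disjoint_pairs_trees[OF B.S] G(2)
    by (intro tree) (auto simp: graft_def pmap_def)
  ultimately have "I' = pmap h I" "\<And>j. j \<in> pleaves I \<Longrightarrow> S' (h j) = pmap G (S j)"
    by (auto simp: prod_eq_iff)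
  moreover from this have "piso (S j) (S' (h j))" if "j \<in> pleaves I" for j
    using that inj_on_subset[OF G(1) sub[OF that]] by (auto simp: piso_def)
  ultimately show ?thesis using that inj by blast
qed

section \<open>Irreducible planar pairs are asymmetric\<close>

definition separated :: "('a \<Rightarrow> real) \<Rightarrow> 'a set \<Rightarrow> 'a set \<Rightarrow> bool" where
  "separated r A B \<longleftrightarrow> (\<forall>a\<in>A. \<forall>b\<in>B. r a < r b) \<or> (\<forall>a\<in>A. \<forall>b\<in>B. r b < r a)"

text \<open>If \<open>A\<close> precedes \<open>B\<close> and \<open>C\<close> precedes
  \<open>D\<close>, then a point of \<open>A \<inter> D\<close> and a point of
  \<open>B \<inter> C\<close> would be ordered one way by the first fact and the other way by the
  second. For opposite orders the other two intersections clash.\<close>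

lemma separated_grid:
  assumes "separated r A B" "separated r C D"
  shows "A \<inter> C = {} \<or> A \<inter> D = {} \<or> B \<inter> C = {} \<or> B \<inter> D = {}"
  using assms unfolding separated_def by (metis disjoint_iff less_asym)

text \<open>Disjoint intervals cannot interleave: two comparisons in opposite directions would
  enclose a point of one interval between points of the other.\<close>

lemma convex_order_separated:
  assumes r: "convex_order r t" and v: "binary_tree t" "node x y \<in> vertices t"
  shows "separated r (leaves x) (leaves y)"
proof -
  have sub: "leaves x \<subseteq> leaves t" "leaves y \<subseteq> leaves t" using leaves_vertex[OF v(2)] by auto
  have xy: "x \<in> vertices t" "y \<in> vertices t"
    using child_vertex[of x "node x y" t] child_vertex[of y "node x y" t] v(2) by simp_all
  have disj: "leaves x \<inter> leaves y = {}" using binary_vertex[OF v] by simp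
  have neq: "r a \<noteq> r b" if "a \<in> leaves x" "b \<in> leaves y" for a b
    using inj_onD[OF convex_order_inj[OF r], of a b] that sub disj by auto
  have key: "r a < r b" if "a0 \<in> leaves u" "b0 \<in> leaves v" "r a0 < r b0" "a \<in> leaves u" "b \<in> leaves v"
    "u = x \<and> v = y \<or> u = y \<and> v = x" for a0 b0 a b u v
  proof (rule ccontr)
    have uv: "u \<in> vertices t" "v \<in> vertices t" "leaves u \<inter> leaves v = {}" "leaves u \<subseteq> leaves t" "leaves v \<subseteq> leaves t"
      using that(6) xy sub disj by auto
    have neq': "r c \<noteq> r d" if "c \<in> leaves u" "d \<in> leaves v" for c d
      using neq that \<open>u = x \<and> v = y \<or> u = y \<and> v = x\<close> by metis
    assume "\<not> r a < r b"
    then have "r b < r a" using neq'[OF that(4,5)] by linarith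
    then have "\<not> r a0 < r b" using convex_orderD[OF r uv(1) that(1,4), of b] that(5) uv by blast
    then have "r b < r a0" using neq'[OF that(1,5)] by linarith
    then have "a0 \<in> leaves v" using convex_orderD[OF r uv(2) that(5,2), of a0] that uv by blast
    then show False using that(1) uv by blast
  qed
  obtain a0 b0 where "a0 \<in> leaves x" "b0 \<in> leaves y" using leaves_nonempty[of x] leaves_nonempty[of y] by blast
  then consider "r a0 < r b0" | "r b0 < r a0" using neq by (meson linorder_neqE)
  then show ?thesis
    using key[of a0 x b0 y] key[of b0 y a0 x] \<open>a0 \<in> leaves x\<close> \<open>b0 \<in> leaves y\<close> unfolding separated_def
    by cases blast+
qed

lemma map_node_cases:
  assumes "map_btree h (node x y) = node x y"
  obtains "map_btree h x = x" "map_btree h y = y" | "map_btree h x = y" "map_btree h y = x"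
  using assms by auto

text \<open>A set fixed by \<open>h\<close> that meets the leaves of \<open>x\<close> or
  \<open>y\<close> meets both, as \<open>h\<close> exchanges the two. So all four intersections are
  nonempty, against \<open>separated_grid\<close>.\<close>

lemma swapped_children_contradiction:
  assumes bin: "binary_tree L" "binary_tree R" and r: "convex_order r L" "convex_order r R"
    and xy: "node x y \<in> vertices L" "map_btree h x = y" "map_btree h y = x"
    and cd: "node c d \<in> vertices R" "map_btree h c = c" "map_btree h d = d"
    and meet: "leaves (node x y) \<inter> leaves c \<noteq> {}" "leaves (node x y) \<inter> leaves d \<noteq> {}"
  shows False
proof -
  have h: "h ` leaves x = leaves y" "h ` leaves y = leaves x" "h ` leaves c = leaves c" "h ` leaves d = leaves d"
    using xy cd by (metis leaves_map_btree)+
  have "leaves x \<inter> E \<noteq> {} \<and> leaves y \<inter> E \<noteq> {}" if E: "h ` E = E" "leaves (node x y) \<inter> E \<noteq> {}" for E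
  proof -
    obtain p where "p \<in> E" "p \<in> leaves x \<or> p \<in> leaves y" using E(2) by auto
    then have "h p \<in> E" "p \<in> leaves x \<and> h p \<in> leaves y \<or> p \<in> leaves y \<and> h p \<in> leaves x"
      using E(1) h by blast+
    then show ?thesis using \<open>p \<in> E\<close> by blast
  qed
  from this[OF h(3) meet(1)] this[OF h(4) meet(2)] show False
    using separated_grid[OF convex_order_separated[OF r(1) bin(1) xy(1)] convex_order_separated[OF r(2) bin(2) cd(1)]]
    by blast
qed

text \<open>The new case is the root of \<open>L\<close>. There the children of \<open>R\<close> are
  either fixed, with the usual contradiction, or swapped too. In the latter case all four leaf sets
  contain half of the leaves, so the empty intersection given by \<open>separated_grid\<close>
  forces \<open>leaves x\<close> to equal \<open>leaves c\<close> or \<open>leaves d\<close>: a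
  proper common cluster of size \<open>card X / 2\<close>, which exceeds 1 because
  \<open>2 < card X\<close>.\<close>

lemma children_fixed_step:
  assumes bin: "binary_tree L" "binary_tree R" and X: "leaves L = X" "leaves R = X" "2 < card X"
    and r: "convex_order r L" "convex_order r R" and h: "inj_on h X" "map_btree h R = R"
    and irr: "\<And>A. A \<in> clusters L \<Longrightarrow> A \<in> clusters R \<Longrightarrow> A \<noteq> X \<Longrightarrow> card A \<le> 1"
    and v: "v \<in> vertices L" "map_btree h v = v"
    and IH: "\<And>w. w \<in> vertices R \<Longrightarrow> card (leaves v) < card (leaves w) \<Longrightarrow> \<forall>c\<in>children w. map_btree h c = c"
  shows "\<forall>c\<in>children v. map_btree h c = c"
proof (cases v rule: btree_exhaust)
  case (node x y)
  show ?thesis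
  proof (rule ccontr)
    assume "\<not> ?thesis"
    then have swap: "map_btree h x = y" "map_btree h y = x"
      using v(2) unfolding node by (auto elim: map_node_cases)
    have xy: "node x y \<in> vertices L" using v(1) node by simp
    have bin_v: "binary_tree v" using binary_vertex[OF bin(1) v(1)] .
    have finX: "finite X" using X by auto
    note contra = swapped_children_contradiction[OF bin r xy swap]
    show False
    proof (cases "leaves v = X")
      case False
      \<comment> \<open>A member with fewest leaves is the least vertex above \<open>v\<close>; its
        children are not in \<open>W\<close>, so the leaves of \<open>v\<close> are spread over
        both.\<close>
      define W where "W = {w \<in> vertices R. leaves v \<subseteq> leaves w}"
      have "R \<in> W" using leaves_vertex[OF v(1)] X by (simp add: W_def)
      then obtain w where w: "w \<in> W" "\<And>w'. w' \<in> W \<Longrightarrow> card (leaves w) \<le> card (leaves w')"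
        using ex_has_least_nat[of "\<lambda>w. w \<in> W" R "\<lambda>w. card (leaves w)"] by blast
      have w': "w \<in> vertices R" "leaves v \<subseteq> leaves w" using w by (auto simp: W_def)
      have "leaves w \<noteq> leaves v"
      proof
        assume "leaves w = leaves v"
        then have "leaves v \<in> clusters L" "leaves v \<in> clusters R"
          using v(1) w'(1) by (auto simp: clusters_def)
        then show False using irr False card_leaves_ge2[OF bin_v] node by fastforce
      qed
      then have card: "card (leaves v) < card (leaves w)"
        using w' by (intro psubset_card_mono) auto
      have bin_w: "binary_tree w" using binary_vertex[OF bin(2) w'(1)] .
      obtain c d where cd: "w = node c d"
        using card by (cases w rule: btree_exhaust) auto
      have fixed: "map_btree h c = c" "map_btree h d = d" using IH[OF w'(1) card] cd by auto
      have "c \<in> vertices R" "d \<in> vertices R"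
        using child_vertex[of c w R] child_vertex[of d w R] w'(1) cd by simp_all
      moreover have "card (leaves c) < card (leaves w)" "card (leaves d) < card (leaves w)"
        using leaves_child[OF bin_w] cd by (auto intro!: psubset_card_mono)
      ultimately have "c \<notin> W" "d \<notin> W" using w(2) by (meson not_le)+
      then have "\<not> leaves v \<subseteq> leaves c" "\<not> leaves v \<subseteq> leaves d"
        using \<open>c \<in> vertices R\<close> \<open>d \<in> vertices R\<close> by (auto simp: W_def)
      then have "leaves v \<inter> leaves c \<noteq> {}" "leaves v \<inter> leaves d \<noteq> {}"
        using w'(2) unfolding cd by auto
      then show False using contra[of c d] w'(1) cd fixed node by simp
    next
      case True
      have "R \<noteq> Leaf a" for a
      proof
        assume "R = Leaf a"
        then have "X = {a}" using X(2) by (metis btree.set(1))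
        then show False using X(3) by simp
      qed
      then obtain c d where cd: "R = node c d" by (cases R rule: btree_exhaust) auto
      have verts: "c \<in> vertices R" "d \<in> vertices R" using cd by auto
      show False
        using h(2) unfolding cd
      proof (cases rule: map_node_cases)
        case 1
        have "leaves v \<inter> leaves c \<noteq> {}" "leaves v \<inter> leaves d \<noteq> {}"
          using True X(2) leaves_vertex[OF verts(1)] leaves_vertex[OF verts(2)]
            leaves_nonempty[of c] leaves_nonempty[of d] by blast+
        then show False using contra[of c d] 1 cd node by simp
      next
        case 2
        have inj: "inj_on h (leaves u)" if "leaves u \<subseteq> X" for u using inj_on_subset[OF h(1) that] .
        have "leaves x \<union> leaves y = X" "leaves c \<union> leaves d = X" using True node X cd by auto
        note un = this
        have disj: "leaves x \<inter> leaves y = {}" "leaves c \<inter> leaves d = {}" using bin_v bin(2) node cd by auto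
        have "card (leaves y) = card (leaves x)" "card (leaves d) = card (leaves c)"
          using inj[of x] inj[of c] un swap 2 by (metis card_image leaves_map_btree Un_upper1)+
        moreover have "card (leaves x) + card (leaves y) = card X" "card (leaves c) + card (leaves d) = card X"
          using un disj by (metis card_Un_disjoint finite_leaves)+
        ultimately have cards: "card (leaves x) = card (leaves c)" "card (leaves x) = card (leaves d)" "2 * card (leaves x) = card X"
          by auto
        have "leaves x = leaves c \<or> leaves x = leaves d"
        proof -
          consider "leaves x \<inter> leaves c = {}" | "leaves x \<inter> leaves d = {}" | "leaves y \<inter> leaves c = {}" | "leaves y \<inter> leaves d = {}"
            using separated_grid[OF convex_order_separated[OF r(1) bin(1) xy] convex_order_separated[OF r(2) bin(2), of c d]] cd by auto
          then show ?thesis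
          proof cases
            case 1
            then have "leaves x \<subseteq> leaves d" using un by blast
            from card_subset_eq[OF finite_leaves this] show ?thesis using cards by metis
          next
            case 2
            then have "leaves x \<subseteq> leaves c" using un by blast
            from card_subset_eq[OF finite_leaves this] show ?thesis using cards by metis
          next
            case 3
            then have "leaves c \<subseteq> leaves x" using un by blast
            from card_subset_eq[OF finite_leaves this] show ?thesis using cards by metis
          next
            case 4
            then have "leaves d \<subseteq> leaves x" using un by blast
            from card_subset_eq[OF finite_leaves this] show ?thesis using cards by metis
          qed
        qed
        then have "leaves x \<in> clusters R"
        proof
          assume "leaves x = leaves c"
          then show ?thesis unfolding clusters_def using verts(1) by (rule image_eqI)
        next
          assume "leaves x = leaves d"
          then show ?thesis unfolding clusters_def using verts(2) by (rule image_eqI)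
        qed
        moreover have "leaves x \<in> clusters L"
          unfolding clusters_def by (rule imageI, rule child_vertex[OF _ xy]) simp
        moreover have "leaves x \<noteq> X" using cards X(3) by auto
        ultimately show False using irr[of "leaves x"] cards(3) X(3) by linarith
      qed
    qed
  qed
qed simp

text \<open>Induction from large to small vertices of both trees at once, since fixing the children
  of a vertex in one tree relies on larger vertices of the other. A vertex is itself fixed as a
  child of its parent, the roots by assumption.\<close>

lemma automorphism_trivial:
  assumes P: "tpair P" "pplanar P" "pirred P" "2 < psize P" and h: "inj_on h (pleaves P)" "pmap h P = P"
    and x: "x \<in> pleaves P"
  shows "h x = x"
proof -
  obtain L R where LR: "P = (L, R)" by (cases P)
  define X where "X = pleaves P"
  obtain r where r: "convex_order r L" "convex_order r R" using P(2) LR by (auto simp: pplanar_def)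
  have bin: "binary_tree L" "binary_tree R" and X: "leaves L = X" "leaves R = X"
    using tpairD[OF P(1)] by (auto simp: LR X_def)
  have card: "2 < card X" using P(4) by (simp add: psize_def X_def)
  have inj: "inj_on h X" using h(1) by (simp add: X_def)
  have hLR: "map_btree h L = L" "map_btree h R = R" using h(2) by (simp_all add: LR pmap_def)
  have irr: "card A \<le> 1" if "A \<in> clusters L" "A \<in> clusters R" "A \<noteq> X" for A
    using P(3) that by (simp add: pirred_def common_def LR X_def)
  have fixed: "map_btree h v = v \<and> (\<forall>c\<in>children v. map_btree h c = c)"
    if "v \<in> vertices L \<or> v \<in> vertices R" for v
    using that
  proof (induction "card X - card (leaves v)" arbitrary: v rule: less_induct)
    case less
    have IH: "map_btree h w = w \<and> (\<forall>c\<in>children w. map_btree h c = c)"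
      if "card (leaves v) < card (leaves w)" "w \<in> vertices L \<or> w \<in> vertices R" for w
    proof -
      have "leaves w \<subseteq> X" using that(2) leaves_vertex X by blast
      then have "card (leaves w) \<le> card X" using X finite_leaves card_mono by metis
      then show ?thesis using less.hyps[of w] that by simp
    qed
    have self: "map_btree h v = v" if t: "v \<in> vertices t" "binary_tree t" "t = L \<or> t = R" for t
    proof (cases "v = t")
      case False
      then obtain u where u: "u \<in> vertices t" "v \<in> children u" using parent_exists t(1) by blast
      then have "card (leaves v) < card (leaves u)"
        using leaves_child[OF binary_vertex[OF t(2) u(1)] u(2)] by (intro psubset_card_mono) auto
      then show ?thesis using IH u t(3) by blast
    qed (use hLR t(3) in auto)
    from less.prems show ?case
    proof
      assume v: "v \<in> vertices L"
      then show ?thesis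
        using self[OF v bin(1)] children_fixed_step[OF bin X card r inj hLR(2) irr v] IH by blast
    next
      assume v: "v \<in> vertices R"
      then show ?thesis
        using self[OF v bin(2)] children_fixed_step[OF bin(2,1) X(2,1) card r(2,1) inj hLR(1) irr v] IH by blast
    qed
  qed
  have "map_btree h (Leaf x) = Leaf x" using fixed[of "Leaf x"] x X by (simp add: X_def)
  then show ?thesis by simp
qed

section \<open>Irreducibility and contraction in diagonal form\<close>

text \<open>As \<open>mate M\<close> is a bijection, the conditions on \<open>w\<close> (neither
  root nor leaf) carry over from \<open>u\<close>; what remains concerns the common leaf set
  alone.\<close>

lemma proper_subs_iff:
  assumes T: "tanglegram (L, R, M)"
  shows "(u, w) \<in> proper_subs (L, R, M) \<longleftrightarrow> u \<in> vertices L \<and> w \<in> vertices R \<and>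
    leaves u = mate M ` leaves w \<and> 2 \<le> card (leaves u) \<and> leaves u \<noteq> leaves L"
proof (cases "u \<in> vertices L \<and> w \<in> vertices R")
  case True
  then have uw: "u \<in> vertices L" "w \<in> vertices R" by auto
  have bin: "binary_tree L" "binary_tree R" "binary_tree u" "binary_tree w"
    using T binary_vertex uw by auto
  note m = bij_mate[OF T]
  have inj: "inj_on (mate M) (leaves R)" and img: "mate M ` leaves R = leaves L"
    using m by (auto simp: bij_betw_def)
  have sub: "leaves w \<subseteq> leaves R" "leaves u \<subseteq> leaves L" using leaves_vertex uw by auto
  have memM: "(a, b) \<in> M \<longleftrightarrow> b \<in> leaves R \<and> a = mate M b" for a b
    by (subst matching_mate[OF T]) auto
  have "M `` leaves u = {b \<in> leaves R. mate M b \<in> leaves u}" by (auto simp: memM)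
  moreover have "{b \<in> leaves R. mate M b \<in> leaves u} = leaves w \<longleftrightarrow> leaves u = mate M ` leaves w"
  proof
    assume eq: "{b \<in> leaves R. mate M b \<in> leaves u} = leaves w"
    have "\<exists>b\<in>leaves R. x = mate M b" if "x \<in> leaves u" for x
      using that sub(2) unfolding img[symmetric] by blast
    then show "leaves u = mate M ` leaves w" unfolding eq[symmetric] by blast
  next
    assume "leaves u = mate M ` leaves w"
    then show "{b \<in> leaves R. mate M b \<in> leaves u} = leaves w"
      using inj_on_image_mem_iff[OF inj _ sub(1)] sub(1) by auto
  qed
  ultimately have eq: "M `` leaves u = leaves w \<longleftrightarrow> leaves u = mate M ` leaves w" by simp
  have root: "u = L \<longleftrightarrow> leaves u = leaves L" "w = R \<longleftrightarrow> leaves w = leaves R"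
    using vertex_eqI[OF bin(1) uw(1)] vertex_eqI[OF bin(2) uw(2)] by auto
  have match: "leaves w = leaves R \<longleftrightarrow> leaves u = leaves L" "card (leaves u) = card (leaves w)"
    if "leaves u = mate M ` leaves w"
    using that inj_on_image_eq_iff[OF inj sub(1), of "leaves R"] img card_image[OF inj_on_subset[OF inj sub(1)]] by auto
  have "(u, w) \<in> proper_subs (L, R, M) \<longleftrightarrow> leaves u \<noteq> leaves L \<and> leaves w \<noteq> leaves R \<and>
      2 \<le> card (leaves u) \<and> 2 \<le> card (leaves w) \<and> leaves u = mate M ` leaves w"
    unfolding root[symmetric] card_leaves_ge2[OF bin(3)] card_leaves_ge2[OF bin(4)] eq[symmetric]
    using uw by simp
  also have "\<dots> \<longleftrightarrow> leaves u = mate M ` leaves w \<and> 2 \<le> card (leaves u) \<and> leaves u \<noteq> leaves L"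
    using match by metis
  finally show ?thesis using uw by simp
next
  case False
  then show ?thesis by (simp add: proper_subs.simps) blast
qed

lemma common_diagonal:
  "A \<in> common (diagonal (L, R, M)) \<longleftrightarrow> (\<exists>u\<in>vertices L. \<exists>w\<in>vertices R. A = leaves u \<and> leaves u = mate M ` leaves w)"
  by (auto simp: common_def clusters_def vertices_map_btree leaves_map_btree image_iff)

lemma irreducible_iff:
  assumes "tanglegram T" shows "irreducible_tanglegram T \<longleftrightarrow> pirred (diagonal T)"
proof -
  obtain L R M where T: "T = (L, R, M)" by (cases T)
  have "proper_subs T \<noteq> {} \<longleftrightarrow> (\<exists>u w. (u, w) \<in> proper_subs (L, R, M))"
    unfolding T by (simp only: ex_in_conv[symmetric] split_paired_Ex)
  also have "\<dots> \<longleftrightarrow> (\<exists>A\<in>common (diagonal T). A \<noteq> leaves L \<and> 2 \<le> card A)"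
    unfolding proper_subs_iff[OF assms[unfolded T]] T Bex_def common_diagonal by blast
  also have "\<dots> \<longleftrightarrow> \<not> pirred (diagonal T)"
    by (auto simp: pirred_def T pleaves_def not_le numeral_2_eq_2 Suc_le_eq)
  finally show ?thesis unfolding irreducible_tanglegram_def by blast
qed

text \<open>\<open>tsize\<close> looks at the left tree, so it suffices that the left roots of the
  maximal subtanglegrams are the internal vertices spanning a block. Maximality among pairs of
  vertices is translated into maximality among leaf sets.\<close>

lemma tsize_irr:
  assumes "tanglegram T" shows "tsize (irr T) = irrsize (diagonal T)"
proof -
  obtain L R M where T: "T = (L, R, M)" by (cases T)
  note tang = assms[unfolded T]
  let ?P = "diagonal T"
  have P: "tpair ?P" using tpair_diagonal[OF assms] .
  have bin: "binary_tree L" "binary_tree R" using tang by auto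
  have pl: "pleaves ?P = leaves L" by (simp add: T pleaves_def)
  define U where "U = fst ` maximal_subs (L, R, M)"
  have size: "tsize (irr T) = card (leaves (contract U L))"
    by (simp add: T U_def Let_def)
  show ?thesis
  proof (cases "psize ?P = 1")
    case True
    then obtain a where "leaves L = {a}" by (auto simp: psize_def pl card_1_singleton_iff)
    then have "L = Leaf a" using leaves_singleton[OF bin(1)] by simp
    then show ?thesis using True size by (simp add: irrsize_def)
  next
    case False
    then have P2: "2 \<le> psize ?P" using psize_pos[of ?P] by linarith
    have sub: "(u, w) \<in> proper_subs (L, R, M) \<longleftrightarrow> u \<in> vertices L \<and> w \<in> vertices R \<and>
      leaves u = mate M ` leaves w \<and> 2 \<le> card (leaves u) \<and> leaves u \<noteq> leaves L" for u w
      using proper_subs_iff[OF tang] .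
    have inj: "inj_on (mate M) (leaves R)" using bij_mate[OF tang] by (simp add: bij_betw_def)
    have U: "v \<in> U \<longleftrightarrow> leaves v \<in> blocks ?P" if v: "v \<in> vertices L" "children v \<noteq> {}" for v
    proof
      assume "v \<in> U"
      then obtain w where w: "(v, w) \<in> maximal_subs (L, R, M)" by (auto simp: U_def)
      then have vw: "(v, w) \<in> proper_subs (L, R, M)"
        and max: "\<And>v' w'. (v', w') \<in> proper_subs (L, R, M) \<Longrightarrow> v \<in> vertices v' \<Longrightarrow> w \<in> vertices w' \<Longrightarrow> v' = v"
        unfolding maximal_subs_def by blast+
      have "B = leaves v" if B: "B \<in> common ?P" "B \<noteq> leaves L" "leaves v \<subseteq> B" for B
      proof -
        obtain v' w' where vw': "v' \<in> vertices L" "w' \<in> vertices R" "B = leaves v'" "leaves v' = mate M ` leaves w'"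
          using B(1) unfolding T common_diagonal by blast
        have "v \<in> vertices v'" using vertices_leaves_le[OF bin(1) v(1) vw'(1)] B vw' by simp
        moreover have "leaves w \<subseteq> leaves w'"
          using inj_on_image_subset_iff[OF inj leaves_vertex leaves_vertex] vw vw' B(3) sub by metis
        then have "w \<in> vertices w'" using vertices_leaves_le[OF bin(2) _ vw'(2)] vw sub by blast
        moreover have "card (leaves v) \<le> card (leaves v')" using B(3) vw'(3) by (simp add: card_mono)
        then have "(v', w') \<in> proper_subs (L, R, M)" using sub vw vw' B(2) by auto
        ultimately show ?thesis using max vw'(3) by blast
      qed
      moreover have "leaves v \<in> common ?P" "leaves v \<noteq> leaves L"
        using vw sub unfolding T common_diagonal by blast+
      ultimately show "leaves v \<in> blocks ?P" unfolding blocks_def pl by blast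
    next
      assume b: "leaves v \<in> blocks ?P"
      then obtain v1 w where w: "v1 \<in> vertices L" "w \<in> vertices R" "leaves v = leaves v1" "leaves v1 = mate M ` leaves w"
        using blocksD(1)[OF b] unfolding T common_diagonal by blast
      have "2 \<le> card (leaves v)" using card_leaves_ge2 binary_vertex[OF bin(1) v(1)] v(2) by blast
      then have vw: "(v, w) \<in> proper_subs (L, R, M)" using sub v w blocksD(2)[OF b] pl by auto
      have "(v', w') = (v, w)" if vw': "(v', w') \<in> proper_subs (L, R, M)" "v \<in> vertices v'" for v' w'
      proof -
        have "leaves v' \<in> common ?P" "leaves v' \<noteq> pleaves ?P"
          using vw' sub unfolding T common_diagonal pl[unfolded T] by blast+
        then have eq: "leaves v' = leaves v" using blocksD(3)[OF b] leaves_vertex[OF vw'(2)] by blast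
        then have "v' = v" using vertex_eqI[OF bin(1)] vw' v(1) sub by blast
        moreover have "leaves w' = leaves w"
          using inj_on_image_eq_iff[OF inj leaves_vertex leaves_vertex] vw vw' eq sub by metis
        then have "w' = w" using vertex_eqI[OF bin(2)] vw vw' sub by blast
        ultimately show ?thesis by simp
      qed
      then have "(v, w) \<in> maximal_subs (L, R, M)" using vw unfolding maximal_subs_def by blast
      then show "v \<in> U" unfolding U_def by force
    qed
    have "leaves (contract U L) = blocks ?P"
      using leaves_contract_blocks[OF P P2 bin(1) pl[symmetric] _ U] T by (auto simp: blocks_def common_def)
    then show ?thesis using size False by (simp add: irrsize_def)
  qed
qed

section \<open>Isomorphism classes\<close>

text \<open>The members have natural leaf names whatever the leaf type of \<open>P\<close>, so that
  pairs with sets or tagged numbers as leaf names can be compared.\<close>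

definition cls :: "'a tpair \<Rightarrow> nat tpair set" where
  "cls P = {Q. piso P Q}"

lemma piso_nat_representative:
  assumes "tpair P"
  obtains Q :: "nat tpair" where "piso P Q" "pleaves Q = {..<psize P}"
proof -
  obtain h where h: "bij_betw h (pleaves P) {0..<card (pleaves P)}"
    using ex_bij_betw_finite_nat finite_pleaves by blast
  then have "piso P (pmap h P)" "pleaves (pmap h P) = {..<psize P}"
    by (auto simp: piso_def bij_betw_def pleaves_pmap psize_def)
  then show ?thesis using that by blast
qed

lemma cls_eq_iff:
  assumes "tpair P" "tpair Q" shows "cls P = cls Q \<longleftrightarrow> piso P Q"
proof
  assume eq: "cls P = cls Q"
  obtain P' :: "nat tpair" where "piso P P'" using piso_nat_representative[OF assms(1)] by blast
  moreover then have "piso Q P'" using eq by (auto simp: cls_def)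
  ultimately show "piso P Q" using piso_trans piso_sym[OF assms(2)] by blast
next
  assume "piso P Q"
  then show "cls P = cls Q"
    using piso_trans[of P Q] piso_trans[OF piso_sym[OF assms(1)], of Q] unfolding cls_def
    by (intro Collect_cong iffI)
qed

lemma card_image_same_kernel:
  assumes "\<And>x y. x \<in> A \<Longrightarrow> y \<in> A \<Longrightarrow> g x = g y \<longleftrightarrow> f x = f y"
  shows "card (g ` A) = card (f ` A)"
proof (rule bij_betw_same_card)
  have "(\<lambda>c. f (inv_into A g c)) (g x) = f x" if "x \<in> A" for x
    using assms[OF inv_into_into[OF imageI[OF that, of g]] that] f_inv_into_f[OF imageI[OF that, of g]] by simp
  then show "bij_betw (\<lambda>c. f (inv_into A g c)) (g ` A) (f ` A)"
    using assms by (auto simp: bij_betw_def inj_on_def image_image)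
qed

text \<open>Every pair of trees with the same leaves is the diagonal form of a tanglegram, namely of
  the one with the identity matching, so counting may ignore matchings.\<close>

lemma iso_count_eq:
  "iso_count {T. tanglegram T \<and> \<Phi> (diagonal T)} = card {cls P |P :: nat tpair. tpair P \<and> \<Phi> P}"
proof -
  let ?A = "{T. tanglegram T \<and> \<Phi> (diagonal T)}"
  have "tanglegram_iso `` {S} = tanglegram_iso `` {T} \<longleftrightarrow> cls (diagonal S) = cls (diagonal T)"
    if ST: "S \<in> ?A" "T \<in> ?A" for S T
  proof -
    have tang: "tanglegram S" "tanglegram T" using ST by auto
    note diag = tpair_diagonal[OF tang(1)] tpair_diagonal[OF tang(2)]
    have iso: "V \<in> tanglegram_iso `` {U} \<longleftrightarrow> tanglegram V \<and> cls (diagonal U) = cls (diagonal V)"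
      if "tanglegram U" for U V
      using that isomorphic_iff[of U V] cls_eq_iff[OF tpair_diagonal tpair_diagonal, of U V]
      by (auto simp: tanglegram_iso_def)
    have "T \<in> tanglegram_iso `` {T}" using iso[OF tang(2)] tang by simp
    then show ?thesis using iso[OF tang(1)] iso[OF tang(2)] by blast
  qed
  then have "card ((\<lambda>T. tanglegram_iso `` {T}) ` ?A) = card ((\<lambda>T. cls (diagonal T)) ` ?A)"
    by (intro card_image_same_kernel)
  moreover have "(\<lambda>T. cls (diagonal T)) ` ?A = {cls P |P :: nat tpair. tpair P \<and> \<Phi> P}"
  proof (intro equalityI subsetI)
    fix c assume "c \<in> {cls P |P :: nat tpair. tpair P \<and> \<Phi> P}"
    then obtain P :: "nat tpair" where P: "tpair P" "\<Phi> P" "c = cls P" by blast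
    define T where "T = (fst P, snd P, Id_on (pleaves P))"
    have "mate (Id_on (pleaves P)) b = b" if "b \<in> pleaves P" for b
      unfolding mate_def using that by auto
    then have "map_btree (mate (Id_on (pleaves P))) (snd P) = snd P"
      using tpairD(4)[OF P(1)] by (intro map_btree_id_on) simp
    then have "diagonal T = P" by (simp add: T_def)
    moreover have "tanglegram T"
      using tpairD[OF P(1)] by (auto simp: T_def)
    ultimately show "c \<in> (\<lambda>T. cls (diagonal T)) ` ?A" using P by force
  next
    fix c assume "c \<in> (\<lambda>T. cls (diagonal T)) ` ?A"
    then show "c \<in> {cls P |P :: nat tpair. tpair P \<and> \<Phi> P}" using tpair_diagonal by blast
  qed
  ultimately show ?thesis
    by (simp add: iso_count_def quotient_def UNION_singleton_eq_range)
qed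

definition planar_classes :: "nat tpair set set" where
  "planar_classes = {cls P |P :: nat tpair. tpair P \<and> pplanar P}"

text \<open>Leaf names \<open>{..<n}\<close> are requested so that the leaves of a skeleton can
  serve as positions in a list.\<close>

definition rep :: "nat tpair set \<Rightarrow> nat tpair" where
  "rep c = (SOME P. tpair P \<and> pplanar P \<and> cls P = c \<and> pleaves P = {..<psize P})"

definition wt :: "nat tpair set \<Rightarrow> nat" where
  "wt c = psize (rep c)"

lemma rep_cls:
  fixes P :: "'a tpair"
  assumes "tpair P" "pplanar P"
  shows "cls P \<in> planar_classes" "piso P (rep (cls P))" "tpair (rep (cls P))" "pplanar (rep (cls P))"
    "cls (rep (cls P)) = cls P" "pleaves (rep (cls P)) = {..<wt (cls P)}"
proof -
  obtain Q :: "nat tpair" where Q: "piso P Q" "pleaves Q = {..<psize P}"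
    using piso_nat_representative[OF assms(1)] by blast
  have Q': "tpair Q" "pplanar Q" "cls Q = cls P" "pleaves Q = {..<psize Q}"
    using Q assms(2) piso_tpair[OF assms(1) Q(1)] piso_pplanar[OF assms(1) Q(1)] piso_psize[OF Q(1)]
      cls_eq_iff[OF assms(1) piso_tpair[OF assms(1) Q(1)]] by simp_all
  then show "cls P \<in> planar_classes"
    unfolding planar_classes_def by (intro CollectI exI[of _ Q]) simp
  have *: "tpair (rep (cls P)) \<and> pplanar (rep (cls P)) \<and> cls (rep (cls P)) = cls P \<and>
      pleaves (rep (cls P)) = {..<psize (rep (cls P))}"
    unfolding rep_def by (rule someI[of _ Q]) (use Q' in blast)
  then show "tpair (rep (cls P))" "pplanar (rep (cls P))" "cls (rep (cls P)) = cls P"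
    "pleaves (rep (cls P)) = {..<wt (cls P)}" by (simp_all add: wt_def)
  then show "piso P (rep (cls P))" using cls_eq_iff[OF assms(1)] by metis
qed

lemma rep_class:
  assumes "c \<in> planar_classes"
  shows "tpair (rep c)" "pplanar (rep c)" "cls (rep c) = c" "pleaves (rep c) = {..<wt c}"
proof -
  obtain P :: "nat tpair" where "tpair P" "pplanar P" "c = cls P"
    using assms unfolding planar_classes_def by blast
  then show "tpair (rep c)" "pplanar (rep c)" "cls (rep c) = c" "pleaves (rep c) = {..<wt c}"
    using rep_cls[of P] by simp_all
qed

lemma wt_pos: "0 < wt c"
  by (simp add: wt_def)

lemma rep_eq_iff: "c \<in> planar_classes \<Longrightarrow> d \<in> planar_classes \<Longrightarrow> piso (rep c) (rep d) \<longleftrightarrow> c = d"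
  using rep_class cls_eq_iff by metis

lemma
  assumes "tpair P" "pplanar P"
  shows wt_cls: "wt (cls P) = psize P" and irrsize_rep: "irrsize (rep (cls P)) = irrsize P"
    and pirred_rep: "pirred (rep (cls P)) \<longleftrightarrow> pirred P"
  using piso_psize[OF rep_cls(2)[OF assms]] piso_irrsize[OF assms(1) rep_cls(2)[OF assms]]
    piso_pirred[OF assms(1) rep_cls(2)[OF assms]]
  by (simp_all add: wt_def)

lemma class_set_eq:
  assumes "\<And>P Q :: nat tpair. tpair P \<Longrightarrow> piso P Q \<Longrightarrow> \<Phi> Q = \<Phi> P"
  shows "{cls P |P :: nat tpair. tpair P \<and> pplanar P \<and> \<Phi> P} = {c \<in> planar_classes. \<Phi> (rep c)}"
proof (intro equalityI subsetI)
  fix c assume "c \<in> {cls P |P :: nat tpair. tpair P \<and> pplanar P \<and> \<Phi> P}"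
  then obtain P :: "nat tpair" where "tpair P" "pplanar P" "\<Phi> P" "c = cls P" by blast
  then show "c \<in> {c \<in> planar_classes. \<Phi> (rep c)}" using rep_cls[of P] assms by auto
next
  fix c assume "c \<in> {c \<in> planar_classes. \<Phi> (rep c)}"
  then show "c \<in> {cls P |P :: nat tpair. tpair P \<and> pplanar P \<and> \<Phi> P}"
    using rep_class[of c] by (intro CollectI exI[of _ "rep c"]) simp
qed

lemma iso_count_planar:
  assumes "\<And>T :: nat tanglegram. tanglegram T \<Longrightarrow> \<Psi> T \<longleftrightarrow> \<Phi> (diagonal T)"
    "\<And>P Q :: nat tpair. tpair P \<Longrightarrow> piso P Q \<Longrightarrow> \<Phi> Q = \<Phi> P"
  shows "iso_count {T \<in> planar_tanglegrams. \<Psi> T} = card {c \<in> planar_classes. \<Phi> (rep c)}"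
proof -
  have "{T \<in> planar_tanglegrams. \<Psi> T} = {T. tanglegram T \<and> pplanar (diagonal T) \<and> \<Phi> (diagonal T)}"
    using assms(1) planar_iff unfolding planar_tanglegrams_def by blast
  then show ?thesis
    using iso_count_eq[of "\<lambda>P. pplanar P \<and> \<Phi> P"] class_set_eq[of \<Phi>, OF assms(2)] by simp
qed

definition tcount :: "nat \<Rightarrow> nat" where
  "tcount n = card {c \<in> planar_classes. wt c = n}"

definition icount :: "nat \<Rightarrow> nat" where
  "icount n = card {c \<in> planar_classes. wt c = n \<and> pirred (rep c)}"

definition tcount2 :: "nat \<Rightarrow> nat \<Rightarrow> nat" where
  "tcount2 n k = card {c \<in> planar_classes. wt c = n \<and> irrsize (rep c) = k}"

lemma tsize_psize: "tsize T = psize (diagonal T)"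
  by (simp add: tsize_diagonal psize_def)

lemma iso_count_T: "iso_count {T \<in> planar_tanglegrams. tsize T = n} = tcount n"
  unfolding tcount_def wt_def
  by (rule iso_count_planar[of _ "\<lambda>P. psize P = n"]) (simp_all add: tsize_psize piso_psize)

lemma iso_count_I: "iso_count {T \<in> irreducible_planar_tanglegrams. tsize T = n} = icount n"
proof -
  have "{T \<in> irreducible_planar_tanglegrams. tsize T = n} =
      {T \<in> planar_tanglegrams. tsize T = n \<and> irreducible_tanglegram T}"
    by (auto simp: irreducible_planar_tanglegrams_def)
  moreover have "iso_count {T \<in> planar_tanglegrams. tsize T = n \<and> irreducible_tanglegram T} = icount n"
    unfolding icount_def wt_def
    by (rule iso_count_planar[of _ "\<lambda>P. psize P = n \<and> pirred P"])
      (simp_all add: tsize_psize piso_psize piso_pirred irreducible_iff)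
  ultimately show ?thesis by simp
qed

lemma iso_count_T2: "iso_count {T \<in> planar_tanglegrams. tsize T = n \<and> tsize (irr T) = k} = tcount2 n k"
  unfolding tcount2_def wt_def
proof (rule iso_count_planar[of _ "\<lambda>P. psize P = n \<and> irrsize P = k"])
  fix T :: "nat tanglegram"
  assume "tanglegram T"
  then show "tsize T = n \<and> tsize (irr T) = k \<longleftrightarrow> psize (diagonal T) = n \<and> irrsize (diagonal T) = k"
    by (simp only: tsize_irr tsize_psize[of T])
qed (simp add: piso_psize piso_irrsize)

text \<open>\<open>rep\<close> is injective on classes and lands in pairs of trees with leaf set
  \<open>{..<n}\<close>, of which there are finitely many.\<close>

lemma finite_classes: "finite {c \<in> planar_classes. wt c = n}"
proof -
  let ?B = "{t :: nat btree. binary_tree t \<and> leaves t = {..<n}}"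
  have "inj_on rep {c \<in> planar_classes. wt c = n}"
    using rep_class(3) by (metis (mono_tags, lifting) inj_on_def mem_Collect_eq)
  moreover have "rep c \<in> ?B \<times> ?B" if "c \<in> planar_classes" "wt c = n" for c
    using rep_class[OF that(1)] tpairD[OF rep_class(1)[OF that(1)]] that(2) by (simp add: mem_Times_iff)
  then have "rep ` {c \<in> planar_classes. wt c = n} \<subseteq> ?B \<times> ?B" by blast
  moreover have "finite (?B \<times> ?B)" using finite_binary_trees[of "{..<n}"] by simp
  ultimately show ?thesis by (meson finite_imageD finite_subset)
qed

section \<open>Building planar classes from irreducible ones\<close>

text \<open>The copies of the representatives are made disjoint by tagging the leaves with the position.\<close>

definition tagged :: "nat tpair set list \<Rightarrow> nat \<Rightarrow> (nat \<times> nat) tpair" where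
  "tagged cs j = pmap (Pair j) (rep (cs ! j))"

definition build :: "nat tpair \<Rightarrow> nat tpair set list \<Rightarrow> nat tpair set" where
  "build I cs = cls (graft I (tagged cs))"

lemma piso_tagged: "piso (rep (cs ! j)) (tagged cs j)"
  by (auto simp: tagged_def piso_def inj_on_def)

lemma psize_tagged: "psize (tagged cs j) = wt (cs ! j)"
  using piso_psize[OF piso_tagged] by (simp add: wt_def)

locale building =
  fixes I :: "nat tpair" and cs :: "nat tpair set list"
  assumes tpair_I: "tpair I" and planar_I: "pplanar I" and irred_I: "pirred I"
    and leaves_I: "pleaves I = {..<length cs}" and two: "2 \<le> length cs" and cs: "set cs \<subseteq> planar_classes"
begin

lemma tpair_tagged: "j < length cs \<Longrightarrow> tpair (tagged cs j)"
  using piso_tpair[OF rep_class(1) piso_tagged] cs nth_mem by blast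

sublocale composition I "tagged cs"
proof
  have "pleaves (tagged cs i) \<inter> pleaves (tagged cs j) = {}" if "i \<noteq> j" for i j
    using that by (auto simp: tagged_def pleaves_pmap)
  then show "disjoint_pairs (pleaves I) (tagged cs)"
    using tpair_tagged by (auto simp: disjoint_pairs_def disjoint_family_on_def leaves_I)
qed (rule tpair_I)

lemma psize_I: "psize I = length cs"
  by (simp add: psize_def leaves_I)

lemma pplanar_tagged: "pplanar (graft I (tagged cs))"
  using planar_I rep_class(2) piso_pplanar[OF rep_class(1) piso_tagged] cs nth_mem[of _ cs]
  by (simp add: pplanar_graft leaves_I subset_iff)

lemma build:
  "build I cs \<in> planar_classes" "wt (build I cs) = sum_list (map wt cs)"
  "irrsize (rep (build I cs)) = length cs"
proof -
  show "build I cs \<in> planar_classes" unfolding build_def by (rule rep_cls(1)[OF tpair_graft pplanar_tagged])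
  have "wt (build I cs) = (\<Sum>j<length cs. wt (cs ! j))"
    unfolding build_def wt_cls[OF tpair_graft pplanar_tagged] by (simp add: psize_graft psize_tagged leaves_I)
  then show "wt (build I cs) = sum_list (map wt cs)"
    by (simp add: sum_list_sum_nth atLeast0LessThan)
  show "irrsize (rep (build I cs)) = length cs"
    unfolding build_def irrsize_rep[OF tpair_graft pplanar_tagged]
    using irrsize_graft[OF irred_I] two by (simp add: psize_I)
qed

end

text \<open>Together with \<open>build_eqI\<close> this determines multiplicities: the lists over a
  fixed skeleton that build the same class form an orbit under its automorphisms.\<close>

lemma build_eqD:
  assumes "building I cs" "building I' cs'" "build I cs = build I' cs'"
  obtains h where "inj_on h (pleaves I)" "I' = pmap h I" "\<And>j. j < length cs \<Longrightarrow> cs ! j = cs' ! h j"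
proof -
  interpret A: building I cs by fact
  interpret B: building I' cs' by fact
  have "piso (graft I (tagged cs)) (graft I' (tagged cs'))"
    using assms(3) cls_eq_iff[OF A.tpair_graft B.tpair_graft] by (simp add: build_def)
  then obtain h where h: "inj_on h (pleaves I)" "I' = pmap h I"
    "\<And>j. j \<in> pleaves I \<Longrightarrow> piso (tagged cs j) (tagged cs' (h j))"
    using piso_graftD[OF A.composition_axioms B.composition_axioms A.irred_I B.irred_I]
      A.two B.two by (metis A.psize_I B.psize_I)
  have "cs ! j = cs' ! h j" if j: "j < length cs" for j
  proof -
    have "h j < length cs'"
      using h(2) j A.leaves_I B.leaves_I by (metis imageI lessThan_iff pleaves_pmap)
    then have cl: "cs ! j \<in> planar_classes" "cs' ! h j \<in> planar_classes"
      using A.cs B.cs j nth_mem by blast+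
    have "piso (rep (cs ! j)) (rep (cs' ! h j))"
      using piso_trans[OF piso_trans[OF piso_tagged h(3)[of j]] piso_sym[OF rep_class(1)[OF cl(2)] piso_tagged]]
        j A.leaves_I by simp
    then show ?thesis using rep_eq_iff[OF cl] by simp
  qed
  then show ?thesis using that h by blast
qed

lemma build_eqI:
  assumes "building I cs" "building I' cs'" and h: "inj_on h (pleaves I)" "I' = pmap h I"
    "\<And>j. j < length cs \<Longrightarrow> cs ! j = cs' ! h j"
  shows "build I cs = build I' cs'"
proof -
  interpret A: building I cs by fact
  interpret B: building I' cs' by fact
  have "piso (tagged cs j) (tagged cs' (h j))" if j: "j \<in> pleaves I" for j
  proof -
    have "cs ! j \<in> planar_classes" using A.cs A.leaves_I j nth_mem by auto
    then have "piso (tagged cs j) (rep (cs ! j))" using piso_sym[OF rep_class(1) piso_tagged] by blast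
    moreover have "cs ! j = cs' ! h j" using h(3) j A.leaves_I by simp
    ultimately show ?thesis using piso_trans[OF _ piso_tagged[of cs' "h j"]] by simp
  qed
  then have "piso (graft I (tagged cs)) (graft I' (tagged cs'))"
    using piso_graft[OF A.composition_axioms B.composition_axioms h(1,2)] by blast
  then show ?thesis using cls_eq_iff[OF A.tpair_graft B.tpair_graft] by (simp add: build_def)
qed

text \<open>The skeleton found by \<open>decomposition\<close> has sets as leaf names, so only its
  class \<open>J\<close> is fixed. Quantifying over all \<open>I\<close> of that class with standard
  leaf names makes the result usable with \<open>rep J\<close> as well as with a concrete
  pair.\<close>

lemma build_surj:
  assumes c: "c \<in> planar_classes" and k: "2 \<le> irrsize (rep c)"
  obtains J where "J \<in> planar_classes" "wt J = irrsize (rep c)" "pirred (rep J)"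
    "\<And>I. tpair I \<Longrightarrow> pleaves I = {..<irrsize (rep c)} \<Longrightarrow> cls I = J \<Longrightarrow> \<exists>cs. building I cs \<and> c = build I cs"
proof -
  define P where "P = rep c"
  note rc = rep_class[OF c, folded P_def]
  have "psize P \<noteq> 1" using k by (auto simp: irrsize_def P_def)
  then have P2: "2 \<le> psize P" using psize_pos[of P] by linarith
  then have irrP: "irrsize P = card (blocks P)" by (simp add: irrsize_def)
  obtain K :: "nat set tpair" and S where K: "tpair K" "pirred K" "pleaves K = blocks P"
    "disjoint_pairs (blocks P) S" "graft K S = P"
    using decomposition[OF rc(1) P2] by metis
  interpret composition K S using K by unfold_locales simp_all
  have planar: "pplanar K" "\<And>A. A \<in> blocks P \<Longrightarrow> pplanar (S A)"
    using rc(2) pplanar_graft K by auto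
  have size_K: "psize K = irrsize P" using irrP K by (simp add: psize_def)
  have tS: "tpair (S A)" if "A \<in> blocks P" for A using disjoint_pairsD(2)[OF K(4) that] .
  show ?thesis
  proof (rule that[of "cls K"])
    show "cls K \<in> planar_classes" "pirred (rep (cls K))" "wt (cls K) = irrsize (rep c)"
      using rep_cls(1)[OF K(1) planar(1)] pirred_rep[OF K(1) planar(1)] K(2) wt_cls[OF K(1) planar(1)] size_K P_def
      by auto
  next
    fix I :: "nat tpair"
    assume I: "tpair I" "pleaves I = {..<irrsize (rep c)}" "cls I = cls K"
    then have iso: "piso I K" using cls_eq_iff K(1) by blast
    then obtain h where h: "inj_on h (pleaves I)" "K = pmap h I" by (auto simp: piso_def)
    define cs where "cs = map (\<lambda>j. cls (S (h j))) [0..<irrsize P]"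
    have hj: "h j \<in> blocks P" if "j < irrsize P" for j
      using that h(2) I(2) K(3) P_def by (metis imageI lessThan_iff pleaves_pmap)
    have bu: "building I cs"
    proof
      show "pplanar I" "pirred I"
        using piso_pplanar[OF I(1) iso] piso_pirred[OF I(1) iso] planar(1) K(2) by auto
      show "set cs \<subseteq> planar_classes"
        using hj rep_cls(1)[OF tS planar(2)] by (auto simp: cs_def)
    qed (use I k P_def in \<open>auto simp: cs_def\<close>)
    interpret B: building I cs by fact
    have part: "piso (tagged cs j) (S (h j))" if "j \<in> pleaves I" for j
    proof -
      have j: "j < irrsize P" using that I(2) P_def by simp
      then have "cs ! j = cls (S (h j))" by (simp add: cs_def)
      then have "piso (S (h j)) (tagged cs j)"
        using piso_trans[OF rep_cls(2)[OF tS[OF hj[OF j]] planar(2)[OF hj[OF j]]], of "tagged cs j"]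
          piso_tagged[of cs j] by simp
      then show ?thesis using piso_sym tS hj[OF j] by blast
    qed
    have "piso (graft I (tagged cs)) P"
      using piso_graft[OF B.composition_axioms composition_axioms h part] K(5) by simp
    then have "build I cs = c"
      using cls_eq_iff[OF B.tpair_graft rc(1)] rc(3) by (simp add: build_def)
    then show "\<exists>cs. building I cs \<and> c = build I cs" using bu by blast
  qed
qed

section \<open>Counting\<close>

unbundle no vec_syntax
unbundle fps_syntax

definition class_lists :: "nat \<Rightarrow> nat \<Rightarrow> nat tpair set list set" where
  "class_lists k n = {cs. length cs = k \<and> set cs \<subseteq> planar_classes \<and> sum_list (map wt cs) = n}"

lemma class_lists_Suc:
  "class_lists (Suc k) n = (\<lambda>(m, c, cs). c # cs) `
    (SIGMA m:{0..n}. {c \<in> planar_classes. wt c = m} \<times> class_lists k (n - m))"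
proof (intro equalityI subsetI)
  fix xs assume "xs \<in> class_lists (Suc k) n"
  then obtain c cs where "xs = c # cs" "length cs = k" "c \<in> planar_classes" "set cs \<subseteq> planar_classes"
    "wt c + sum_list (map wt cs) = n"
    by (cases xs) (auto simp: class_lists_def)
  then show "xs \<in> (\<lambda>(m, c, cs). c # cs) ` (SIGMA m:{0..n}. {c \<in> planar_classes. wt c = m} \<times> class_lists k (n - m))"
    by (intro image_eqI[of _ _ "(wt c, c, cs)"]) (auto simp: class_lists_def)
qed (auto simp: class_lists_def)

lemma finite_class_lists: "finite (class_lists k n)"
proof (induction k arbitrary: n)
  case 0
  have "class_lists 0 n \<subseteq> {[]}" by (auto simp: class_lists_def)
  then show ?case using finite_subset by blast
next
  case (Suc k)
  then show ?case unfolding class_lists_Suc using finite_classes by (intro finite_imageI finite_SigmaI finite_cartesian_product) auto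
qed

lemma T_series_nth: "T_series $ n = of_nat (tcount n)"
  by (simp add: T_series_def iso_count_T)

text \<open>Splitting off the first entry of a list is the Cauchy product with
  \<open>T_series\<close>.\<close>

lemma card_class_lists: "of_nat (card (class_lists k n)) = (T_series ^ k) $ n"
proof (induction k arbitrary: n)
  case 0
  have "class_lists 0 n = (if n = 0 then {[]} else {})" by (auto simp: class_lists_def)
  then show ?case by simp
next
  case (Suc k)
  let ?D = "SIGMA m:{0..n}. {c \<in> planar_classes. wt c = m} \<times> class_lists k (n - m)"
  have "inj_on (\<lambda>(m, c, cs). c # cs) ?D" by (auto simp: inj_on_def)
  then have "card (class_lists (Suc k) n) = card ?D"
    by (simp add: class_lists_Suc card_image)
  also have "\<dots> = (\<Sum>m=0..n. tcount m * card (class_lists k (n - m)))"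
    using finite_classes finite_class_lists by (subst card_SigmaI) (auto simp: card_cartesian_product tcount_def)
  finally show ?case
    by (simp add: fps_mult_nth T_series_nth Suc.IH)
qed

text \<open>\<open>build\<close> is a bijection from skeletons with lists: surjectivity is
  \<open>build_surj\<close>, and by rigidity the map \<open>h\<close> of \<open>build_eqD\<close> is
  the identity, so the list is recovered entry by entry.\<close>

lemma tcount2_gt2:
  assumes "2 < k"
  shows "tcount2 n k = icount k * card (class_lists k n)"
proof -
  let ?J = "{c \<in> planar_classes. wt c = k \<and> pirred (rep c)}"
  have bu: "building (rep J) cs" if "J \<in> ?J" "cs \<in> class_lists k n" for J cs
    using that assms rep_class[of J] by unfold_locales (auto simp: class_lists_def)
  have "bij_betw (\<lambda>(J, cs). build (rep J) cs) (?J \<times> class_lists k n)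
      {c \<in> planar_classes. wt c = n \<and> irrsize (rep c) = k}"
    unfolding bij_betw_def
  proof
    show "inj_on (\<lambda>(J, cs). build (rep J) cs) (?J \<times> class_lists k n)"
    proof (rule inj_onI, clarify)
      fix J cs J' cs'
      assume J: "J \<in> planar_classes" "pirred (rep J)" "k = wt J" and J': "J' \<in> planar_classes" "wt J' = wt J" "pirred (rep J')"
        and cs: "cs \<in> class_lists (wt J) n" "cs' \<in> class_lists (wt J) n" and eq: "build (rep J) cs = build (rep J') cs'"
      have len: "length cs = wt J" "length cs' = wt J" using cs by (auto simp: class_lists_def)
      obtain h where h: "inj_on h (pleaves (rep J))" "rep J' = pmap h (rep J)" "\<And>j. j < length cs \<Longrightarrow> cs ! j = cs' ! h j"
        using build_eqD[OF bu bu eq] J J' cs by blast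
      have "piso (rep J) (rep J')" using h by (auto simp: piso_def)
      then have JJ: "J' = J" using rep_eq_iff[OF J(1) J'(1)] by simp
      have "h j = j" if "j < wt J" for j
        using automorphism_trivial[OF rep_class(1,2)[OF J(1)] J(2) _ h(1) h(2)[unfolded JJ, symmetric], of j]
          that assms J rep_class(4)[OF J(1)] by (simp add: wt_def)
      then have "cs = cs'" using len h(3) by (intro nth_equalityI) simp_all
      then show "J = J' \<and> cs = cs'" using JJ by simp
    qed
    show "(\<lambda>(J, cs). build (rep J) cs) ` (?J \<times> class_lists k n) = {c \<in> planar_classes. wt c = n \<and> irrsize (rep c) = k}"
    proof (intro equalityI subsetI)
      fix c assume "c \<in> (\<lambda>(J, cs). build (rep J) cs) ` (?J \<times> class_lists k n)"
      then obtain J cs where J: "J \<in> ?J" "cs \<in> class_lists k n" "c = build (rep J) cs" by auto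
      interpret building "rep J" cs using bu[OF J(1,2)] .
      show "c \<in> {c \<in> planar_classes. wt c = n \<and> irrsize (rep c) = k}"
        using build J by (auto simp: class_lists_def)
    next
      fix c assume "c \<in> {c \<in> planar_classes. wt c = n \<and> irrsize (rep c) = k}"
      then have c: "c \<in> planar_classes" "wt c = n" "irrsize (rep c) = k" by auto
      obtain J where J: "J \<in> ?J" and ex: "\<And>I. tpair I \<Longrightarrow> pleaves I = {..<k} \<Longrightarrow> cls I = J \<Longrightarrow> \<exists>cs. building I cs \<and> c = build I cs"
        using build_surj[OF c(1)] assms c(3) by (smt (verit) less_imp_le mem_Collect_eq)
      have rJ: "tpair (rep J)" "pleaves (rep J) = {..<k}" "cls (rep J) = J" using rep_class[of J] J by auto
      then obtain cs where bc: "building (rep J) cs" "c = build (rep J) cs" using ex by blast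
      interpret building "rep J" cs by fact
      have "length cs = k" using leaves_I rJ(2) by (metis card_lessThan)
      then have "cs \<in> class_lists k n"
        using build bc(2) c(2) cs by (auto simp: class_lists_def)
      then show "c \<in> (\<lambda>(J, cs). build (rep J) cs) ` (?J \<times> class_lists k n)" using J bc(2) by force
    qed
  qed
  then have "card (?J \<times> class_lists k n) = tcount2 n k"
    unfolding tcount2_def by (rule bij_betw_same_card)
  then show ?thesis by (simp add: card_cartesian_product icount_def)
qed

section \<open>The skeleton with two leaves and its swap\<close>

definition cherry :: "nat tpair" where
  "cherry = (node (Leaf 0) (Leaf 1), node (Leaf 0) (Leaf 1))"

lemma cherry: "tpair cherry" "pleaves cherry = {..<2}" "pplanar cherry"
proof -
  show "tpair cherry" "pleaves cherry = {..<2}" by (auto simp: cherry_def tpair_def pleaves_def)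
  show "pplanar cherry"
    unfolding pplanar_def by (rule exI[of _ real]) (auto simp: cherry_def intro!: convex_orderI)
qed

lemma pirred_size_2:
  assumes "psize P = 2" shows "pirred P"
  unfolding pirred_def
proof (intro ballI impI)
  fix A assume "A \<in> common P" "A \<noteq> pleaves P"
  then have "A \<subset> pleaves P" using commonD by blast
  then have "card A < psize P" unfolding psize_def by (intro psubset_card_mono) auto
  then show "card A \<le> 1" using assms by simp
qed

lemma two_leaves:
  assumes "binary_tree t" "leaves t = {a, b}" "a \<noteq> b" shows "t = node (Leaf a) (Leaf b)"
proof (cases t rule: btree_exhaust)
  case (node l r)
  have bin: "binary_tree l" "binary_tree r" using assms(1) node by simp_all
  have "card (leaves l) + card (leaves r) = 2"
    using card_leaves_node[of l r] assms node by simp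
  then have "\<not> 2 \<le> card (leaves l)" "\<not> 2 \<le> card (leaves r)"
    using card_leaves_pos[of l] card_leaves_pos[of r] by linarith+
  then obtain x y where "l = Leaf x" "r = Leaf y"
    using card_leaves_ge2 bin by (metis children_empty_iff)
  then show ?thesis using assms(2) node by (auto simp: doubleton_eq_iff)
qed (use assms in auto)

lemma size_2_cherry:
  assumes "tpair P" "psize P = 2" shows "piso cherry P"
proof -
  obtain a b where ab: "pleaves P = {a, b}" "a \<noteq> b"
    using assms(2) unfolding psize_def card_2_iff by blast
  then have "P = (node (Leaf a) (Leaf b), node (Leaf a) (Leaf b))"
    using two_leaves tpairD[OF assms(1)] by (metis prod.collapse)
  then have "P = pmap (\<lambda>i. if i = 0 then a else b) cherry"
    by (simp add: pmap_def cherry_def)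
  moreover have "inj_on (\<lambda>i. if i = 0 then a else b) (pleaves cherry)"
    using ab(2) by (auto simp: cherry(2) inj_on_def)
  ultimately show ?thesis unfolding piso_def by blast
qed

lemma building_cherry:
  "c \<in> planar_classes \<Longrightarrow> d \<in> planar_classes \<Longrightarrow> building cherry [c, d]"
  using cherry by unfold_locales (auto simp: pirred_size_2 psize_def)

text \<open>Both bijections of the two leaves are automorphisms of \<open>cherry\<close>, so exactly
  the order of the two classes is lost.\<close>

lemma build_cherry_eq_iff:
  assumes "c \<in> planar_classes" "d \<in> planar_classes" "c' \<in> planar_classes" "d' \<in> planar_classes"
  shows "build cherry [c, d] = build cherry [c', d'] \<longleftrightarrow> (c = c' \<and> d = d') \<or> (c = d' \<and> d = c')"
proof
  note bu = building_cherry[OF assms(1,2)] building_cherry[OF assms(3,4)]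
  {
    assume "build cherry [c, d] = build cherry [c', d']"
    then obtain h where h: "inj_on h (pleaves cherry)" "cherry = pmap h cherry"
      "\<And>j. j < length [c, d] \<Longrightarrow> [c, d] ! j = [c', d'] ! h j"
      using build_eqD[OF bu] by blast
    have "h ` {..<2} = {..<2}" using h(2) cherry(2) by (metis pleaves_pmap)
    then have "h 0 \<in> {..<2}" "h 1 \<in> {..<2}" by auto
    moreover have "h 0 \<noteq> h 1" using inj_onD[OF h(1), of 0 1] cherry(2) by auto
    ultimately have "h 0 = 0 \<and> h 1 = 1 \<or> h 0 = 1 \<and> h 1 = 0" by auto
    then show "(c = c' \<and> d = d') \<or> (c = d' \<and> d = c')" using h(3)[of 0] h(3)[of 1] by auto
  next
    assume "(c = c' \<and> d = d') \<or> (c = d' \<and> d = c')"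
    then show "build cherry [c, d] = build cherry [c', d']"
    proof
      assume "c = d' \<and> d = c'"
      \<comment> \<open>The swap of the leaves 0 and 1; both trees are unchanged because children
        are unordered.\<close>
      moreover have "cherry = pmap (\<lambda>i. 1 - i) cherry" by (simp add: pmap_def cherry_def)
      moreover have "inj_on (\<lambda>i. 1 - i) (pleaves cherry)" by (auto simp: cherry(2) inj_on_def)
      ultimately show ?thesis
        by (intro build_eqI[OF bu, of "\<lambda>i. 1 - i"]) (auto simp: less_Suc_eq nth_Cons')
    qed simp
  }
qed

text \<open>Off the diagonal \<open>f\<close> is two-to-one, on the diagonal one-to-one.\<close>

lemma card_unordered_image:
  assumes S: "finite S" "\<And>x y. (x, y) \<in> S \<Longrightarrow> (y, x) \<in> S"
    and f: "\<And>x y x' y'. (x, y) \<in> S \<Longrightarrow> (x', y') \<in> S \<Longrightarrow>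
      f (x, y) = f (x', y') \<longleftrightarrow> (x = x' \<and> y = y') \<or> (x = y' \<and> y = x')"
  shows "2 * card (f ` S) = card S + card {z \<in> S. fst z = snd z}"
proof -
  have "finite (fst ` S \<union> snd ` S)" using S(1) by simp
  \<comment> \<open>An arbitrary injection into \<open>nat\<close> orders the coordinates linearly,
    to select one of the two orientations of each pair.\<close>
  then obtain e :: "_ \<Rightarrow> nat" where e: "inj_on e (fst ` S \<union> snd ` S)"
    using finite_imp_inj_to_nat_seg by metis
  have e_eq: "e x = e y \<longleftrightarrow> x = y" if "(x, y) \<in> S" for x y
    using inj_on_eq_iff[OF e, of x y] that by force
  let ?L = "{z \<in> S. e (fst z) < e (snd z)}" and ?E = "{z \<in> S. fst z = snd z}" and ?G = "{z \<in> S. e (snd z) < e (fst z)}"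
  have "S = ?L \<union> ?E \<union> ?G" using e_eq by fastforce
  moreover have "card (?L \<union> ?E \<union> ?G) = card ?L + card ?E + card ?G"
    using S(1) by (subst card_Un_disjoint; auto)+
  moreover have "bij_betw prod.swap ?L ?G"
    using S(2) by (auto simp: bij_betw_def inj_on_def image_iff)
  then have "card ?L = card ?G" by (rule bij_betw_same_card)
  moreover have "f ` S = f ` (?L \<union> ?E)"
  proof (intro equalityI subsetI)
    fix w assume "w \<in> f ` S"
    then obtain x y where xy: "(x, y) \<in> S" "w = f (x, y)" by auto
    then have "f (y, x) = w" using f S(2) by blast
    then show "w \<in> f ` (?L \<union> ?E)"
      using xy S(2)[OF xy(1)] e_eq[OF xy(1)] by (cases "e x" "e y" rule: linorder_cases) (auto intro: rev_image_eqI)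
  qed auto
  moreover have "inj_on f (?L \<union> ?E)"
  proof (rule inj_onI)
    fix z z' assume "z \<in> ?L \<union> ?E" "z' \<in> ?L \<union> ?E" "f z = f z'"
    then show "z = z'" using f[of "fst z" "snd z" "fst z'" "snd z'"] by (cases z; cases z') auto
  qed
  then have "card (f ` (?L \<union> ?E)) = card ?L + card ?E"
    using S(1) by (simp add: card_image) (subst card_Un_disjoint; auto)
  ultimately show ?thesis by simp
qed

text \<open>Coefficient form of (T(x)^2 + T(x^2)) / 2: a diagonal pair \<open>(c, c)\<close> has
  weight \<open>2 * wt c\<close>, so it occurs only for even \<open>n\<close>.\<close>

lemma tcount2_2:
  "2 * tcount2 n 2 = card (class_lists 2 n) + (if even n then tcount (n div 2) else 0)"
proof -
  define S where "S = {(c, d). c \<in> planar_classes \<and> d \<in> planar_classes \<and> wt c + wt d = n}"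
  let ?f = "\<lambda>(c, d). build cherry [c, d]"
  have bij: "bij_betw (\<lambda>(c, d). [c, d]) S (class_lists 2 n)"
    by (auto simp: bij_betw_def inj_on_def S_def class_lists_def length_Suc_conv numeral_2_eq_2 image_iff)
  have "finite S" using bij_betw_finite[OF bij] finite_class_lists by simp
  moreover have "?f ` S = {c \<in> planar_classes. wt c = n \<and> irrsize (rep c) = 2}"
  proof (intro equalityI subsetI)
    fix w assume "w \<in> ?f ` S"
    then obtain c d where cd: "c \<in> planar_classes" "d \<in> planar_classes" "wt c + wt d = n" "w = build cherry [c, d]"
      by (auto simp: S_def)
    interpret building cherry "[c, d]" using building_cherry[OF cd(1,2)] .
    show "w \<in> {c \<in> planar_classes. wt c = n \<and> irrsize (rep c) = 2}" using build cd by simp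
  next
    fix w assume "w \<in> {c \<in> planar_classes. wt c = n \<and> irrsize (rep c) = 2}"
    then have w: "w \<in> planar_classes" "wt w = n" "irrsize (rep w) = 2" by auto
    obtain J where J: "J \<in> planar_classes" "wt J = 2"
      and ex: "\<And>I. tpair I \<Longrightarrow> pleaves I = {..<2} \<Longrightarrow> cls I = J \<Longrightarrow> \<exists>cs. building I cs \<and> w = build I cs"
      using build_surj[OF w(1)] w(3) by (smt (verit) order_refl)
    have "cls cherry = J"
      using size_2_cherry[OF rep_class(1)[OF J(1)]] cls_eq_iff[OF cherry(1) rep_class(1)[OF J(1)]] rep_class(3)[OF J(1)] J(2)
      by (simp add: wt_def)
    then obtain cs where bc: "building cherry cs" "w = build cherry cs" using ex cherry by blast
    interpret building cherry cs by fact
    have "length cs = 2" using leaves_I cherry(2) by (metis card_lessThan)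
    then obtain c d where "cs = [c, d]" by (auto simp: length_Suc_conv numeral_2_eq_2)
    then have "(c, d) \<in> S" "w = build cherry [c, d]" using cs bc(2) build w(2) by (auto simp: S_def)
    then show "w \<in> ?f ` S" by force
  qed
  moreover have "2 * card (?f ` S) = card S + card {z \<in> S. fst z = snd z}"
  proof (rule card_unordered_image)
    show "finite S" by fact
  qed (use build_cherry_eq_iff in \<open>auto simp: S_def\<close>)
  moreover have "card S = card (class_lists 2 n)" using bij_betw_same_card[OF bij] .
  moreover have "card {z \<in> S. fst z = snd z} = (if even n then tcount (n div 2) else 0)"
  proof -
    have "bij_betw fst {z \<in> S. fst z = snd z} {c \<in> planar_classes. 2 * wt c = n}"
      by (auto simp: bij_betw_def inj_on_def S_def image_iff)
    then have "card {z \<in> S. fst z = snd z} = card {c \<in> planar_classes. 2 * wt c = n}" by (rule bij_betw_same_card)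
    also have "{c \<in> planar_classes. 2 * wt c = n} = (if even n then {c \<in> planar_classes. wt c = n div 2} else {})"
      by auto
    finally show ?thesis by (simp add: tcount_def)
  qed
  ultimately show ?thesis unfolding tcount2_def by simp
qed

section \<open>The cases k = 1 and k = 0\<close>

lemma
  assumes "tpair P"
  shows irrsize_1_iff: "irrsize P = 1 \<longleftrightarrow> psize P = 1" and irrsize_pos: "0 < irrsize P"
proof -
  have "2 \<le> card (blocks P)" if "psize P \<noteq> 1"
    using card_blocks[OF assms] psize_pos[of P] that by linarith
  then have "psize P = 1 \<or> psize P \<noteq> 1 \<and> 2 \<le> irrsize P" by (auto simp: irrsize_def)
  moreover have "irrsize P = 1" if "psize P = 1" using that by (simp add: irrsize_def)
  ultimately show "irrsize P = 1 \<longleftrightarrow> psize P = 1" "0 < irrsize P" by linarith+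
qed

text \<open>From two leaves on there are at least two blocks, so contraction to size 1 happens for
  the one-leaf tanglegram alone; this is the term xy.\<close>

lemma tcount2_1: "tcount2 n 1 = (if n = 1 then 1 else 0)"
proof -
  let ?D = "(Leaf 0, Leaf 0) :: nat tpair"
  have D: "tpair ?D" "pplanar ?D" "psize ?D = 1"
    by (auto simp: tpair_def pplanar_def convex_order_def psize_def pleaves_def)
  have one: "c = cls ?D" if c: "c \<in> planar_classes" "wt c = 1" for c
  proof -
    note rc = rep_class[OF c(1)]
    have "leaves (fst (rep c)) = {0}" "leaves (snd (rep c)) = {0}" using tpairD[OF rc(1)] rc(4) c(2) by auto
    then have "rep c = ?D" using tpairD[OF rc(1)] leaves_singleton by (metis prod.collapse)
    then show ?thesis using rc(3) by simp
  qed
  have "{c \<in> planar_classes. wt c = n \<and> irrsize (rep c) = 1} = {c \<in> planar_classes. wt c = n \<and> wt c = 1}"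
    using irrsize_1_iff[OF rep_class(1)] by (auto simp: wt_def)
  also have "\<dots> = (if n = 1 then {cls ?D} else {})"
  proof -
    have "cls ?D \<in> planar_classes" "wt (cls ?D) = 1"
      using rep_cls(1)[OF D(1,2)] wt_cls[OF D(1,2)] D(3) by simp_all
    then have "{c \<in> planar_classes. wt c = 1} = {cls ?D}" using one by blast
    then show ?thesis by (cases "n = 1") auto
  qed
  finally show ?thesis by (simp add: tcount2_def)
qed

lemma tcount2_0: "tcount2 n 0 = 0"
proof -
  have "irrsize (rep c) \<noteq> 0" if "c \<in> planar_classes" for c
    using irrsize_pos[OF rep_class(1)[OF that]] by simp
  then have "{c \<in> planar_classes. wt c = n \<and> irrsize (rep c) = 0} = {}" by blast
  then show ?thesis unfolding tcount2_def by (simp only: card.empty)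
qed

section \<open>Generating functions\<close>

lemma T_series_0: "T_series $ 0 = 0"
proof -
  have "wt c \<noteq> 0" for c using wt_pos[of c] by simp
  then have "{c \<in> planar_classes. wt c = 0} = {}" by blast
  then show ?thesis unfolding T_series_nth tcount_def by (simp only: card.empty of_nat_0)
qed

lemma H_series_nth: "H_series $ i = (if i = 2 then 1 / 2 else if 2 < i then of_nat (icount i) else 0)"
  by (simp add: H_series_def iso_count_I)

lemma H_series2_nth: "H_series2 $ i = fps_const (H_series $ i) * fps_X ^ i"
proof (rule fps_ext)
  fix k
  have "half * var_x ^ 2 * var_y ^ 2 = (fps_const (fps_const (1 / 2) * fps_X ^ 2) * fps_X ^ 2 :: rat fps fps)"
    by (simp add: half_def var_x_def var_y_def mult_ac flip: fps_const_mult)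
  then have "(half * var_x ^ 2 * var_y ^ 2) $ i = (if i = 2 then fps_const (1 / 2) * fps_X ^ 2 else 0 :: rat fps)"
    by simp
  then show "H_series2 $ i $ k = (fps_const (H_series $ i) * fps_X ^ i) $ k"
    by (simp add: H_series2_def iso_count_I H_series_nth)
qed

lemma in_x_nth: "in_x f $ n = fps_const (f $ n)"
  by (simp add: in_x_def)

lemma fps_const_sum: "fps_const (sum f A) = (\<Sum>x\<in>A. fps_const (f x))"
  by (rule fps_ext) (simp add: fps_sum_nth)

lemma in_x_mult: "in_x (f * g) = in_x f * in_x g"
  by (rule fps_ext) (simp add: in_x_nth fps_mult_nth fps_const_sum)

lemma in_x_power: "in_x f ^ k = in_x (f ^ k)"
proof (induction k)
  case 0
  show ?case by (rule fps_ext) (simp add: in_x_def)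
qed (simp add: in_x_mult)

lemma H_series2_eq: "H_series2 = in_x H_series oo (var_x * var_y)"
proof (rule fps_ext)
  fix n
  have "in_x H_series $ i * ((var_x * var_y) ^ i) $ n = (if i = n then fps_const (H_series $ n) * fps_X ^ n else 0)" for i
    by (simp add: var_x_def var_y_def power_mult_distrib in_x_nth)
  then have "(in_x H_series oo (var_x * var_y)) $ n =
      (\<Sum>i=0..n. if i = n then fps_const (H_series $ n) * fps_X ^ n else 0)"
    by (simp only: fps_compose_nth)
  then show "H_series2 $ n = (in_x H_series oo (var_x * var_y)) $ n"
    by (simp add: H_series2_nth)
qed

text \<open>Composition substitutes for the outer variable \<open>x\<close> and leaves the
  coefficients, hence \<open>y\<close>, alone; this is the meaning of H(T(x), y).\<close>

lemma H_series2_compose: "H_series2 oo in_x T_series = in_x H_series oo (var_y * in_x T_series)"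
proof -
  \<comment> \<open>The vanishing constant term is what makes composition with
    \<open>in_x T_series\<close> associative and multiplicative.\<close>
  have 0: "in_x T_series $ 0 = 0" by (simp add: in_x_nth T_series_0)
  have "in_x H_series oo (var_x * var_y) oo in_x T_series = in_x H_series oo ((var_x * var_y) oo in_x T_series)"
    by (rule fps_compose_assoc[symmetric]) (simp_all add: 0 var_x_def)
  also have "(var_x * var_y) oo in_x T_series = var_y * in_x T_series"
    by (simp add: fps_compose_mult_distrib[OF 0] var_x_def var_y_def 0 mult.commute)
  finally show ?thesis by (simp add: H_series2_eq)
qed

lemma T_series_compose_square_nth:
  "(T_series oo fps_X ^ 2) $ n = (if even n then T_series $ (n div 2) else 0)"
proof -
  have step: "T_series $ i * ((fps_X ^ 2) ^ i) $ n = (if n = 2 * i then T_series $ i else 0)" for i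
    by (simp flip: power_mult)
  have sum: "(T_series oo fps_X ^ 2) $ n = (\<Sum>i=0..n. if n = 2 * i then T_series $ i else 0)"
    by (simp only: fps_compose_nth step)
  show ?thesis
  proof (cases "even n")
    case True
    then obtain m where m: "n = 2 * m" by blast
    have "(\<Sum>i=0..n. if n = 2 * i then T_series $ i else 0) = (\<Sum>i=0..n. if i = m then T_series $ m else 0)"
      by (rule sum.cong) (simp_all add: m)
    then show ?thesis unfolding sum using m by simp
  next
    case False
    then show ?thesis unfolding sum by (subst sum.neutral) auto
  qed
qed

lemma H_series2_compose_nth: "(H_series2 oo in_x T_series) $ n $ k = H_series $ k * (T_series ^ k) $ n"
proof -
  have step: "(H_series2 $ i * (in_x T_series ^ i) $ n) $ k = (if i = k then H_series $ k * (T_series ^ k) $ n else 0)" for i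
    by (simp add: in_x_power in_x_nth H_series2_nth)
  have "(H_series2 oo in_x T_series) $ n $ k = (\<Sum>i=0..n. if i = k then H_series $ k * (T_series ^ k) $ n else 0)"
    by (simp only: fps_compose_nth fps_sum_nth step)
  also have "\<dots> = (if k \<le> n then H_series $ k * (T_series ^ k) $ n else 0)"
    by (simp add: sum.delta)
  \<comment> \<open>For \<open>k > n\<close> the finite sum has no term with \<open>i = k\<close>,
    but then \<open>(T_series ^ k) $ n\<close> vanishes too, as \<open>T_series\<close> has no
    constant term.\<close>
  finally show ?thesis using startsby_zero_power_prefix[OF T_series_0, of k] by auto
qed

text \<open>Comparison of the coefficients of x^n y^k: k = 0 contributes nothing, k = 1 the term xy,
  k > 2 the lists over rigid skeletons, and for k = 2 the coefficient 1/2 of \<open>H_series\<close>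
  joins with half of T(x^2).\<close>

lemma T_series2_eq:
  "T_series2 = (H_series2 oo in_x T_series) + half * in_x (T_series oo fps_X ^ 2) * var_y ^ 2 + var_x * var_y"
proof (rule fps_ext, rule fps_ext)
  fix n k
  let ?E = "if even n then T_series $ (n div 2) else 0"
  have half: "(half * in_x (T_series oo fps_X ^ 2) * var_y ^ 2) $ n $ k = (if k = 2 then 1 / 2 * ?E else 0)"
    by (simp add: half_def var_y_def in_x_nth T_series_compose_square_nth)
  have xy: "(var_x * var_y) $ n $ k = (if n = 1 \<and> k = 1 then 1 else 0 :: rat)"
    by (simp add: var_x_def var_y_def)
  have "of_nat (tcount2 n k) = H_series $ k * (T_series ^ k) $ n + (if k = 2 then 1 / 2 * ?E else 0) + (if n = 1 \<and> k = 1 then 1 else 0)"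
  proof -
    consider "k = 0" | "k = 1" | "k = 2" | "2 < k" by linarith
    then show ?thesis
    proof cases
      case 3
      have "2 * of_nat (tcount2 n 2) = (T_series ^ 2) $ n + ?E"
        unfolding card_class_lists[symmetric] T_series_nth using arg_cong[OF tcount2_2[of n], of "of_nat :: nat \<Rightarrow> rat"] by simp
      then show ?thesis using 3 by (simp add: H_series_nth)
    next
      case 4
      then show ?thesis by (simp add: H_series_nth tcount2_gt2 card_class_lists)
    qed (simp_all add: H_series_nth tcount2_0 tcount2_1[simplified])
  qed
  moreover have "T_series2 $ n $ k = of_nat (tcount2 n k)"
    by (simp add: T_series2_def iso_count_T2)
  ultimately show "T_series2 $ n $ k = ((H_series2 oo in_x T_series) + half * in_x (T_series oo fps_X ^ 2) * var_y ^ 2 + var_x * var_y) $ n $ k"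
    by (simp only: fps_add_nth H_series2_compose_nth half xy)
qed

text \<open>The last two conjuncts justify the notation of the first: they identify H(x, y) with
  H(xy) and H(T(x), y) with H(y T(x)).\<close>

theorem theorem1p1:
  "T_series2 =
     (H_series2 oo in_x T_series) + half * in_x (T_series oo fps_X ^ 2) * var_y ^ 2 + var_x * var_y
   \<and> H_series2 = in_x H_series oo (var_x * var_y)
   \<and> H_series2 oo in_x T_series = in_x H_series oo (var_y * in_x T_series)"
  using T_series2_eq H_series2_eq H_series2_compose by blast

end
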